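(* The adjunction consisting of the inclusion functor $\mathbf{Flex}\longrightarrow\mathbf{2Cat}$ as left adjoint and the path $2$-category functor $Q\colon\mathbf{2Cat}\longrightarrow\mathbf{Flex}$ as right adjoint is a Quillen equivalence between the left-induced model structure on $\mathbf{Flex}$ and Lack's model structure on $\mathbf{2Cat}$.
   Context: A morphism $f$ in a category is atomic if it is not an identity and if, whenever $f=h\circ g$, either $g$ or $h$ is an identity. A category is free if each of its morphisms $f$ can be uniquely expressed as a composite of atomic morphisms $f=f_n\circ\cdots\circ f_1$ ($n\ge 0$). A functor between free categories is a morphism of free categories if it sends each atomic morphism to an atomic morphism or an identity morphism. A (strict, small) $2$-category is flexible if its underlying category is free; a $2$-functor between flexible $2$-categories is a morphism of flexible $2$-categories if its underlying functor is a morphism of free categories. $\mathbf{Flex}$ is the category of flexible $2$-categories and their morphisms, a non-full subcategory of the category $\mathbf{2Cat}$ of $2$-categories and $2$-functors. A $2$-functor is a biequivalence if it is surjective on objects up to equivalence and an equivalence on hom-categories. A $2$-functor $F\colon A\to B$ is an equifibration if for each object $a\in A$ and each equivalence $g\colon Fa\to b$ in $B$ there is an equivalence $f\colon a\to a'$ in $A$ with $Ff=g$, and $F$ is an isofibration on hom-categories. Lack's model structure on $\mathbf{2Cat}$ has the biequivalences as weak equivalences and the equifibrations as fibrations. The left-induced model structure on $\mathbf{Flex}$ has as weak equivalences (resp. cofibrations) those morphisms of flexible $2$-categories that are weak equivalences (resp. cofibrations) in Lack's model structure; its cofibrations are precisely the morphisms of flexible $2$-categories that are injective on objects and faithful on $1$-cells.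 Path $2$-category: for a $2$-category $A$, $QA$ is the flexible $2$-category whose objects are those of $A$, whose $1$-cells are paths $(f_n,\ldots,f_1)$ ($n\ge 0$) of non-identity $1$-cells of $A$ composed by concatenation, whose $2$-cells $(f_m,\ldots,f_1)\Rightarrow(g_n,\ldots,g_1)$ are the $2$-cells $f_m\circ\cdots\circ f_1\Rightarrow g_n\circ\cdots\circ g_1$ in $A$, with $2$-cell compositions and identities induced from $A$. The counit $\varepsilon_A\colon QA\to A$ is the identity on objects, sends a path to its composite, and sends a $2$-cell to the $2$-cell of $A$ naming it. For flexible $A$, the unit $\eta_A\colon A\to QA$ is the identity on objects, sends a $1$-cell with atomic decomposition $f_n\circ\cdots\circ f_1$ to the path $(f_n,\ldots,f_1)$, and sends a $2$-cell $\alpha$ to the $2$-cell named by $\alpha$. *)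

theory Defs
  imports Main "HOL-Library.FuncSet"
begin

section \<open>Categories and functors\<close>

text \<open>
  Composition is written in the usual order: \<open>Cmp C g f\<close> is \<open>g\<close> after \<open>f\<close>.
  Categories and functors are only constrained on their carriers.  Where equality of the
  structures themselves matters (2-categories and 2-functors, which are the objects and arrows
  of \<open>TwoCat\<close>), all operations are moreover required to be \<open>undefined\<close> off their domains.
\<close>

record ('o, 'm) cat =
  Ob :: "'o set"
  Ar :: "'m set"
  Dom :: "'m \<Rightarrow> 'o"
  Cod :: "'m \<Rightarrow> 'o"
  Idn :: "'o \<Rightarrow> 'm"
  Cmp :: "'m \<Rightarrow> 'm \<Rightarrow> 'm"

definition hom :: "('o, 'm) cat \<Rightarrow> 'o \<Rightarrow> 'o \<Rightarrow> 'm set" where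
  "hom C a b = {f \<in> Ar C. Dom C f = a \<and> Cod C f = b}"

locale category =
  fixes C :: "('o, 'm) cat"
  assumes Dom_in_Ob: "f \<in> Ar C \<Longrightarrow> Dom C f \<in> Ob C"
    and Cod_in_Ob: "f \<in> Ar C \<Longrightarrow> Cod C f \<in> Ob C"
    and Idn_in_hom: "a \<in> Ob C \<Longrightarrow> Idn C a \<in> hom C a a"
    and Cmp_in_hom: "\<lbrakk>f \<in> hom C a b; g \<in> hom C b c\<rbrakk> \<Longrightarrow> Cmp C g f \<in> hom C a c"
    and Cmp_Idn_left: "f \<in> hom C a b \<Longrightarrow> Cmp C (Idn C b) f = f"
    and Cmp_Idn_right: "f \<in> hom C a b \<Longrightarrow> Cmp C f (Idn C a) = f"
    and Cmp_assoc: "\<lbrakk>f \<in> hom C a b; g \<in> hom C b c; h \<in> hom C c d\<rbrakk>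
          \<Longrightarrow> Cmp C h (Cmp C g f) = Cmp C (Cmp C h g) f"

definition extensional_cat :: "('o, 'm) cat \<Rightarrow> bool" where
  "extensional_cat C \<longleftrightarrow>
     Dom C \<in> extensional (Ar C) \<and> Cod C \<in> extensional (Ar C) \<and> Idn C \<in> extensional (Ob C) \<and>
     (\<forall>g f. \<not> (g \<in> Ar C \<and> f \<in> Ar C \<and> Dom C g = Cod C f) \<longrightarrow> Cmp C g f = undefined)"

definition is_identity :: "('o, 'm) cat \<Rightarrow> 'm \<Rightarrow> bool" where
  "is_identity C f \<longleftrightarrow> (\<exists>a \<in> Ob C. f = Idn C a)"

definition isos :: "('o, 'm) cat \<Rightarrow> 'o \<Rightarrow> 'o \<Rightarrow> 'm set" where
  "isos C a b = {f \<in> hom C a b. \<exists>g \<in> hom C b a. Cmp C g f = Idn C a \<and> Cmp C f g = Idn C b}"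

record ('o, 'm, 'p, 'n) func =
  fob :: "'o \<Rightarrow> 'p"
  far :: "'m \<Rightarrow> 'n"

definition is_functor :: "('o, 'm) cat \<Rightarrow> ('p, 'n) cat \<Rightarrow> ('o, 'm, 'p, 'n) func \<Rightarrow> bool" where
  "is_functor C D F \<longleftrightarrow>
     category C \<and> category D \<and>
     (\<forall>a \<in> Ob C. fob F a \<in> Ob D) \<and>
     (\<forall>a b. \<forall>f \<in> hom C a b. far F f \<in> hom D (fob F a) (fob F b)) \<and>
     (\<forall>a \<in> Ob C. far F (Idn C a) = Idn D (fob F a)) \<and>
     (\<forall>a b c. \<forall>f \<in> hom C a b. \<forall>g \<in> hom C b c. far F (Cmp C g f) = Cmp D (far F g) (far F f))"

definition id_func :: "('o, 'm, 'o, 'm) func" where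
  "id_func = \<lparr>fob = (\<lambda>a. a), far = (\<lambda>f. f)\<rparr>"

definition comp_func ::
  "('p, 'n, 'q, 'k) func \<Rightarrow> ('o, 'm, 'p, 'n) func \<Rightarrow> ('o, 'm, 'q, 'k) func" where
  "comp_func G F = \<lparr>fob = (\<lambda>a. fob G (fob F a)), far = (\<lambda>f. far G (far F f))\<rparr>"

definition nat_trans ::
  "('o, 'm) cat \<Rightarrow> ('p, 'n) cat \<Rightarrow> ('o, 'm, 'p, 'n) func \<Rightarrow> ('o, 'm, 'p, 'n) func \<Rightarrow> ('o \<Rightarrow> 'n) \<Rightarrow> bool"
  where
  "nat_trans C D F G t \<longleftrightarrow>
     is_functor C D F \<and> is_functor C D G \<and>
     (\<forall>a \<in> Ob C. t a \<in> hom D (fob F a) (fob G a)) \<and>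
     (\<forall>a b. \<forall>f \<in> hom C a b. Cmp D (t b) (far F f) = Cmp D (far G f) (t a))"

definition nat_iso ::
  "('o, 'm) cat \<Rightarrow> ('p, 'n) cat \<Rightarrow> ('o, 'm, 'p, 'n) func \<Rightarrow> ('o, 'm, 'p, 'n) func \<Rightarrow> ('o \<Rightarrow> 'n) \<Rightarrow> bool"
  where
  "nat_iso C D F G t \<longleftrightarrow>
     nat_trans C D F G t \<and> (\<forall>a \<in> Ob C. t a \<in> isos D (fob F a) (fob G a))"

definition equivalence_of_categories ::
  "('o, 'm) cat \<Rightarrow> ('p, 'n) cat \<Rightarrow> ('o, 'm, 'p, 'n) func \<Rightarrow> bool" where
  "equivalence_of_categories C D F \<longleftrightarrow>
     is_functor C D F \<and>
     (\<exists>G s t. is_functor D C G \<and>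
        nat_iso C C id_func (comp_func G F) s \<and> nat_iso D D (comp_func F G) id_func t)"

definition isofibration ::
  "('o, 'm) cat \<Rightarrow> ('p, 'n) cat \<Rightarrow> ('o, 'm, 'p, 'n) func \<Rightarrow> bool" where
  "isofibration C D F \<longleftrightarrow>
     is_functor C D F \<and>
     (\<forall>a \<in> Ob C. \<forall>b. \<forall>g \<in> isos D (fob F a) b. \<exists>a'. \<exists>f \<in> isos C a a'. far F f = g)"

definition adjunction ::
  "('o, 'm) cat \<Rightarrow> ('p, 'n) cat \<Rightarrow> ('o, 'm, 'p, 'n) func \<Rightarrow> ('p, 'n, 'o, 'm) func
     \<Rightarrow> ('o \<Rightarrow> 'm) \<Rightarrow> ('p \<Rightarrow> 'n) \<Rightarrow> bool" where
  "adjunction C D L R \<eta> \<epsilon> \<longleftrightarrow>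
     is_functor C D L \<and> is_functor D C R \<and>
     nat_trans C C id_func (comp_func R L) \<eta> \<and>
     nat_trans D D (comp_func L R) id_func \<epsilon> \<and>
     (\<forall>X \<in> Ob C. Cmp D (\<epsilon> (fob L X)) (far L (\<eta> X)) = Idn D (fob L X)) \<and>
     (\<forall>Y \<in> Ob D. Cmp C (far R (\<epsilon> Y)) (\<eta> (fob R Y)) = Idn C (fob R Y))"


section \<open>Free categories\<close>

definition atomic :: "('o, 'm) cat \<Rightarrow> 'm \<Rightarrow> bool" where
  "atomic C f \<longleftrightarrow>
     f \<in> Ar C \<and> \<not> is_identity C f \<and>
     (\<forall>g \<in> Ar C. \<forall>h \<in> Ar C. Cod C g = Dom C h \<and> f = Cmp C h g
        \<longrightarrow> is_identity C g \<or> is_identity C h)"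

text \<open>
  The list \<open>[f\<^sub>n, \<dots>, f\<^sub>1]\<close> represents the path \<open>(f\<^sub>n, \<dots>, f\<^sub>1)\<close>, i.e. it is in composition order,
  with the arrow applied first at the end.
\<close>

fun is_path :: "('o, 'm) cat \<Rightarrow> 'o \<Rightarrow> 'm list \<Rightarrow> 'o \<Rightarrow> bool" where
  "is_path C a [] b \<longleftrightarrow> a \<in> Ob C \<and> a = b"
| "is_path C a (f # fs) b \<longleftrightarrow> f \<in> Ar C \<and> Cod C f = b \<and> is_path C a fs (Dom C f)"

fun composite :: "('o, 'm) cat \<Rightarrow> 'o \<Rightarrow> 'm list \<Rightarrow> 'm" where
  "composite C a [] = Idn C a"
| "composite C a (f # fs) = Cmp C f (composite C a fs)"

definition atomic_decomposition :: "('o, 'm) cat \<Rightarrow> 'm \<Rightarrow> 'm list \<Rightarrow> bool" where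
  "atomic_decomposition C f fs \<longleftrightarrow>
     is_path C (Dom C f) fs (Cod C f) \<and> (\<forall>g \<in> set fs. atomic C g) \<and>
     composite C (Dom C f) fs = f"

definition free_category :: "('o, 'm) cat \<Rightarrow> bool" where
  "free_category C \<longleftrightarrow> category C \<and> (\<forall>f \<in> Ar C. \<exists>!fs. atomic_decomposition C f fs)"

definition atoms :: "('o, 'm) cat \<Rightarrow> 'm \<Rightarrow> 'm list" where
  "atoms C f = (THE fs. atomic_decomposition C f fs)"

definition free_functor ::
  "('o, 'm) cat \<Rightarrow> ('p, 'n) cat \<Rightarrow> ('o, 'm, 'p, 'n) func \<Rightarrow> bool" where
  "free_functor C D F \<longleftrightarrow>
     free_category C \<and> free_category D \<and> is_functor C D F \<and>
     (\<forall>f \<in> Ar C. atomic C f \<longrightarrow> atomic D (far F f) \<or> is_identity D (far F f))"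


section \<open>2-categories and 2-functors\<close>

text \<open>
  \<open>Und A\<close> is the underlying category (objects and 1-cells).  \<open>Vert A\<close> is the disjoint union of
  the hom-categories: its objects are the 1-cells, its arrows the 2-cells, its composition is
  vertical composition.
\<close>

record 'u two_cat =
  Und :: "('u, 'u) cat"
  Vert :: "('u, 'u) cat"
  HCmp :: "'u \<Rightarrow> 'u \<Rightarrow> 'u"

abbreviation "Obj A \<equiv> Ob (Und A)"
abbreviation "Cell1 A \<equiv> Ar (Und A)"
abbreviation "Cell2 A \<equiv> Ar (Vert A)"

definition hcomposable :: "'u two_cat \<Rightarrow> 'u \<Rightarrow> 'u \<Rightarrow> bool" where
  "hcomposable A \<beta> \<alpha> \<longleftrightarrow>
     \<beta> \<in> Cell2 A \<and> \<alpha> \<in> Cell2 A \<and> Dom (Und A) (Dom (Vert A) \<beta>) = Cod (Und A) (Dom (Vert A) \<alpha>)"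

locale two_category =
  fixes A :: "'u two_cat"
  assumes Und: "category (Und A)"
    and Vert: "category (Vert A)"
    and Ob_Vert: "Ob (Vert A) = Cell1 A"
    and parallel: "\<alpha> \<in> hom (Vert A) f g \<Longrightarrow> Dom (Und A) f = Dom (Und A) g \<and> Cod (Und A) f = Cod (Und A) g"
    and HCmp_in_hom:
      "\<lbrakk>\<alpha> \<in> hom (Vert A) f f'; \<beta> \<in> hom (Vert A) g g'; hcomposable A \<beta> \<alpha>\<rbrakk>
         \<Longrightarrow> HCmp A \<beta> \<alpha> \<in> hom (Vert A) (Cmp (Und A) g f) (Cmp (Und A) g' f')"
    and HCmp_Idn:
      "\<lbrakk>f \<in> hom (Und A) a b; g \<in> hom (Und A) b c\<rbrakk>
         \<Longrightarrow> HCmp A (Idn (Vert A) g) (Idn (Vert A) f) = Idn (Vert A) (Cmp (Und A) g f)"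
    and interchange:
      "\<lbrakk>\<alpha> \<in> hom (Vert A) f f'; \<alpha>' \<in> hom (Vert A) f' f''; \<beta> \<in> hom (Vert A) g g';
        \<beta>' \<in> hom (Vert A) g' g''; hcomposable A \<beta> \<alpha>\<rbrakk>
         \<Longrightarrow> HCmp A (Cmp (Vert A) \<beta>' \<beta>) (Cmp (Vert A) \<alpha>' \<alpha>)
            = Cmp (Vert A) (HCmp A \<beta>' \<alpha>') (HCmp A \<beta> \<alpha>)"
    and HCmp_unit_left:
      "\<lbrakk>\<alpha> \<in> hom (Vert A) f f'; f \<in> hom (Und A) a b\<rbrakk>
         \<Longrightarrow> HCmp A (Idn (Vert A) (Idn (Und A) b)) \<alpha> = \<alpha>"
    and HCmp_unit_right:
      "\<lbrakk>\<alpha> \<in> hom (Vert A) f f'; f \<in> hom (Und A) a b\<rbrakk>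
         \<Longrightarrow> HCmp A \<alpha> (Idn (Vert A) (Idn (Und A) a)) = \<alpha>"
    and HCmp_assoc:
      "\<lbrakk>hcomposable A \<beta> \<alpha>; hcomposable A \<gamma> \<beta>\<rbrakk>
         \<Longrightarrow> HCmp A \<gamma> (HCmp A \<beta> \<alpha>) = HCmp A (HCmp A \<gamma> \<beta>) \<alpha>"
    and extensional_Und: "extensional_cat (Und A)"
    and extensional_Vert: "extensional_cat (Vert A)"
    and extensional_HCmp: "\<not> hcomposable A \<beta> \<alpha> \<Longrightarrow> HCmp A \<beta> \<alpha> = undefined"

definition hom_cat :: "'u two_cat \<Rightarrow> 'u \<Rightarrow> 'u \<Rightarrow> ('u, 'u) cat" where
  "hom_cat A a b =
     \<lparr>Ob = hom (Und A) a b,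
      Ar = {\<alpha> \<in> Cell2 A. Dom (Vert A) \<alpha> \<in> hom (Und A) a b \<and> Cod (Vert A) \<alpha> \<in> hom (Und A) a b},
      Dom = Dom (Vert A), Cod = Cod (Vert A), Idn = Idn (Vert A), Cmp = Cmp (Vert A)\<rparr>"

definition equivalences :: "'u two_cat \<Rightarrow> 'u \<Rightarrow> 'u \<Rightarrow> 'u set" where
  "equivalences A a b =
     {f \<in> hom (Und A) a b. \<exists>g \<in> hom (Und A) b a.
        isos (Vert A) (Cmp (Und A) g f) (Idn (Und A) a) \<noteq> {} \<and>
        isos (Vert A) (Cmp (Und A) f g) (Idn (Und A) b) \<noteq> {}}"

record 'u two_func =
  src :: "'u two_cat"
  tgt :: "'u two_cat"
  map0 :: "'u \<Rightarrow> 'u"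
  map1 :: "'u \<Rightarrow> 'u"
  map2 :: "'u \<Rightarrow> 'u"

definition und_func :: "'u two_func \<Rightarrow> ('u, 'u, 'u, 'u) func" where
  "und_func F = \<lparr>fob = map0 F, far = map1 F\<rparr>"

definition vert_func :: "'u two_func \<Rightarrow> ('u, 'u, 'u, 'u) func" where
  "vert_func F = \<lparr>fob = map1 F, far = map2 F\<rparr>"

locale two_functor =
  fixes F :: "'u two_func"
  assumes src: "two_category (src F)"
    and tgt: "two_category (tgt F)"
    and und_func: "is_functor (Und (src F)) (Und (tgt F)) (und_func F)"
    and vert_func: "is_functor (Vert (src F)) (Vert (tgt F)) (vert_func F)"
    and map2_HCmp: "hcomposable (src F) \<beta> \<alpha>
          \<Longrightarrow> map2 F (HCmp (src F) \<beta> \<alpha>) = HCmp (tgt F) (map2 F \<beta>) (map2 F \<alpha>)"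
    and map0_extensional: "map0 F \<in> extensional (Obj (src F))"
    and map1_extensional: "map1 F \<in> extensional (Cell1 (src F))"
    and map2_extensional: "map2 F \<in> extensional (Cell2 (src F))"

definition id_two_func :: "'u two_cat \<Rightarrow> 'u two_func" where
  "id_two_func A =
     \<lparr>src = A, tgt = A, map0 = (\<lambda>a \<in> Obj A. a), map1 = (\<lambda>f \<in> Cell1 A. f), map2 = (\<lambda>\<alpha> \<in> Cell2 A. \<alpha>)\<rparr>"

definition comp_two_func :: "'u two_func \<Rightarrow> 'u two_func \<Rightarrow> 'u two_func" where
  "comp_two_func G F =
     \<lparr>src = src F, tgt = tgt G,
      map0 = (\<lambda>a \<in> Obj (src F). map0 G (map0 F a)),
      map1 = (\<lambda>f \<in> Cell1 (src F). map1 G (map1 F f)),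
      map2 = (\<lambda>\<alpha> \<in> Cell2 (src F). map2 G (map2 F \<alpha>))\<rparr>"

definition biequivalence :: "'u two_func \<Rightarrow> bool" where
  "biequivalence F \<longleftrightarrow>
     two_functor F \<and>
     (\<forall>b \<in> Obj (tgt F). \<exists>a \<in> Obj (src F). equivalences (tgt F) (map0 F a) b \<noteq> {}) \<and>
     (\<forall>a \<in> Obj (src F). \<forall>a' \<in> Obj (src F).
        equivalence_of_categories (hom_cat (src F) a a') (hom_cat (tgt F) (map0 F a) (map0 F a'))
          (vert_func F))"

definition equifibration :: "'u two_func \<Rightarrow> bool" where
  "equifibration F \<longleftrightarrow>
     two_functor F \<and>
     (\<forall>a \<in> Obj (src F). \<forall>b. \<forall>g \<in> equivalences (tgt F) (map0 F a) b.
        \<exists>a'. \<exists>f \<in> equivalences (src F) a a'. map1 F f = g) \<and>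
     (\<forall>a \<in> Obj (src F). \<forall>a' \<in> Obj (src F).
        isofibration (hom_cat (src F) a a') (hom_cat (tgt F) (map0 F a) (map0 F a'))
          (vert_func F))"

definition flexible :: "'u two_cat \<Rightarrow> bool" where
  "flexible A \<longleftrightarrow> two_category A \<and> free_category (Und A)"

definition flexible_functor :: "'u two_func \<Rightarrow> bool" where
  "flexible_functor F \<longleftrightarrow>
     two_functor F \<and> flexible (src F) \<and> flexible (tgt F) \<and>
     free_functor (Und (src F)) (Und (tgt F)) (und_func F)"


section \<open>The categories of small (flexible) 2-categories\<close>

text \<open>
  Smallness is relative to a notion of small set.  The assumptions below are much weaker than
  those on a Grothendieck universe; they also hold if every set over the type is small.
\<close>

locale size_universe =
  fixes small :: "'u set \<Rightarrow> bool"
  assumes small_subset: "\<lbrakk>small X; Y \<subseteq> X\<rbrakk> \<Longrightarrow> small Y"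
    and small_image: "small X \<Longrightarrow> small (f ` X)"
    and small_Union: "\<lbrakk>small I; \<And>i. i \<in> I \<Longrightarrow> small (Z i)\<rbrakk> \<Longrightarrow> small (\<Union>i \<in> I. Z i)"
    and small_infinite: "\<exists>X. small X \<and> infinite X"

definition small_two_cat :: "('u set \<Rightarrow> bool) \<Rightarrow> 'u two_cat \<Rightarrow> bool" where
  "small_two_cat small A \<longleftrightarrow> small (Obj A) \<and> small (Cell1 A) \<and> small (Cell2 A)"

definition TwoCat :: "('u set \<Rightarrow> bool) \<Rightarrow> ('u two_cat, 'u two_func) cat" where
  "TwoCat small =
     \<lparr>Ob = {A. two_category A \<and> small_two_cat small A},
      Ar = {F. two_functor F \<and> small_two_cat small (src F) \<and> small_two_cat small (tgt F)},
      Dom = src, Cod = tgt, Idn = id_two_func, Cmp = comp_two_func\<rparr>"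

definition Flex :: "('u set \<Rightarrow> bool) \<Rightarrow> ('u two_cat, 'u two_func) cat" where
  "Flex small =
     \<lparr>Ob = {A. flexible A \<and> small_two_cat small A},
      Ar = {F. flexible_functor F \<and> small_two_cat small (src F) \<and> small_two_cat small (tgt F)},
      Dom = src, Cod = tgt, Idn = id_two_func, Cmp = comp_two_func\<rparr>"

definition inclusion :: "('u two_cat, 'u two_func, 'u two_cat, 'u two_func) func" where
  "inclusion = \<lparr>fob = (\<lambda>A. A), far = (\<lambda>F. F)\<rparr>"


section \<open>The path 2-category functor\<close>

text \<open>
  The cells of the path 2-category are tuples of cells of the given one.  To have the path
  construction take values in the same category of 2-categories, cells are taken from a type
  that is closed under finite tuples; \<open>'a\<close> is an arbitrary type of atoms.
\<close>

datatype 'a cell = Atom 'a | Tup (untup: "'a cell list")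

lemma size_universe_all: "size_universe (\<lambda>X :: 'a cell set. True)"
proof
  have "inj (\<lambda>n. Tup (replicate n (Tup [])) :: 'a cell)"
    by (rule injI) (metis cell.inject(2) length_replicate)
  then have "infinite (UNIV :: 'a cell set)"
    by (auto simp: infinite_iff_countable_subset)
  then show "\<exists>X :: 'a cell set. True \<and> infinite X" by blast
qed auto

text \<open>
  A path from \<open>a\<close> is encoded as \<open>Tup (a # fs)\<close>: its source is recorded, since the empty paths on
  different objects are different 1-cells.
\<close>

definition path_src :: "'a cell \<Rightarrow> 'a cell" where
  "path_src p = hd (untup p)"

definition path_steps :: "'a cell \<Rightarrow> 'a cell list" where
  "path_steps p = tl (untup p)"

definition path_cells1 :: "'a cell two_cat \<Rightarrow> 'a cell set" where
  "path_cells1 A =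
     {Tup (a # fs) | a fs. (\<exists>b. is_path (Und A) a fs b) \<and> (\<forall>f \<in> set fs. \<not> is_identity (Und A) f)}"

definition path_value :: "'a cell two_cat \<Rightarrow> 'a cell \<Rightarrow> 'a cell" where
  "path_value A p = composite (Und A) (path_src p) (path_steps p)"

definition path_concat :: "'a cell \<Rightarrow> 'a cell \<Rightarrow> 'a cell" where
  "path_concat q p = Tup (path_src p # path_steps q @ path_steps p)"

definition path_und :: "'a cell two_cat \<Rightarrow> ('a cell, 'a cell) cat" where
  "path_und A =
     \<lparr>Ob = Obj A, Ar = path_cells1 A,
      Dom = (\<lambda>p \<in> path_cells1 A. path_src p),
      Cod = (\<lambda>p \<in> path_cells1 A. Cod (Und A) (path_value A p)),
      Idn = (\<lambda>a \<in> Obj A. Tup [a]),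
      Cmp = (\<lambda>q p. if q \<in> path_cells1 A \<and> p \<in> path_cells1 A
                        \<and> path_src q = Cod (Und A) (path_value A p)
                   then path_concat q p else undefined)\<rparr>"

text \<open>A 2-cell \<open>p \<Rightarrow> q\<close> named by the 2-cell \<open>\<alpha>\<close> of \<open>A\<close> is encoded as \<open>Tup [p, \<alpha>, q]\<close>.\<close>

definition cell_dom :: "'a cell \<Rightarrow> 'a cell" where
  "cell_dom x = untup x ! 0"

definition cell_name :: "'a cell \<Rightarrow> 'a cell" where
  "cell_name x = untup x ! 1"

definition cell_cod :: "'a cell \<Rightarrow> 'a cell" where
  "cell_cod x = untup x ! 2"

definition path_cells2 :: "'a cell two_cat \<Rightarrow> 'a cell set" where
  "path_cells2 A =
     {Tup [p, \<alpha>, q] | p \<alpha> q. p \<in> path_cells1 A \<and> q \<in> path_cells1 A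
        \<and> \<alpha> \<in> hom (Vert A) (path_value A p) (path_value A q)}"

definition path_vert :: "'a cell two_cat \<Rightarrow> ('a cell, 'a cell) cat" where
  "path_vert A =
     \<lparr>Ob = path_cells1 A, Ar = path_cells2 A,
      Dom = (\<lambda>x \<in> path_cells2 A. cell_dom x),
      Cod = (\<lambda>x \<in> path_cells2 A. cell_cod x),
      Idn = (\<lambda>p \<in> path_cells1 A. Tup [p, Idn (Vert A) (path_value A p), p]),
      Cmp = (\<lambda>y x. if y \<in> path_cells2 A \<and> x \<in> path_cells2 A \<and> cell_dom y = cell_cod x
                   then Tup [cell_dom x, Cmp (Vert A) (cell_name y) (cell_name x), cell_cod y]
                   else undefined)\<rparr>"

definition path_two_cat :: "'a cell two_cat \<Rightarrow> 'a cell two_cat" where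
  "path_two_cat A =
     \<lparr>Und = path_und A, Vert = path_vert A,
      HCmp = (\<lambda>y x. if y \<in> path_cells2 A \<and> x \<in> path_cells2 A
                         \<and> path_src (cell_dom y) = Cod (Und A) (path_value A (cell_dom x))
                    then Tup [path_concat (cell_dom y) (cell_dom x),
                              HCmp A (cell_name y) (cell_name x),
                              path_concat (cell_cod y) (cell_cod x)]
                    else undefined)\<rparr>"

text \<open>
  On 1-cells, \<open>Q F\<close> applies \<open>F\<close> to the members of a path and deletes those that become
  identities; this is the only choice for which \<open>\<epsilon>\<close> is natural and \<open>Q F\<close> is a morphism of
  flexible 2-categories.
\<close>

definition map_path :: "'a cell two_func \<Rightarrow> 'a cell \<Rightarrow> 'a cell" where
  "map_path F p =
     Tup (map0 F (path_src p)
          # filter (\<lambda>g. \<not> is_identity (Und (tgt F)) g) (map (map1 F) (path_steps p)))"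

definition path_two_func :: "'a cell two_func \<Rightarrow> 'a cell two_func" where
  "path_two_func F =
     \<lparr>src = path_two_cat (src F), tgt = path_two_cat (tgt F),
      map0 = map0 F,
      map1 = (\<lambda>p \<in> path_cells1 (src F). map_path F p),
      map2 = (\<lambda>x \<in> path_cells2 (src F).
                Tup [map_path F (cell_dom x), map2 F (cell_name x), map_path F (cell_cod x)])\<rparr>"

definition path_functor ::
  "('a cell two_cat, 'a cell two_func, 'a cell two_cat, 'a cell two_func) func" where
  "path_functor = \<lparr>fob = path_two_cat, far = path_two_func\<rparr>"

definition path_counit :: "'a cell two_cat \<Rightarrow> 'a cell two_func" where
  "path_counit A =
     \<lparr>src = path_two_cat A, tgt = A,
      map0 = (\<lambda>a \<in> Obj A. a),
      map1 = (\<lambda>p \<in> path_cells1 A. path_value A p),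
      map2 = (\<lambda>x \<in> path_cells2 A. cell_name x)\<rparr>"

definition atomic_path :: "'a cell two_cat \<Rightarrow> 'a cell \<Rightarrow> 'a cell" where
  "atomic_path A f = Tup (Dom (Und A) f # atoms (Und A) f)"

definition path_unit :: "'a cell two_cat \<Rightarrow> 'a cell two_func" where
  "path_unit A =
     \<lparr>src = A, tgt = path_two_cat A,
      map0 = (\<lambda>a \<in> Obj A. a),
      map1 = (\<lambda>f \<in> Cell1 A. atomic_path A f),
      map2 = (\<lambda>\<alpha> \<in> Cell2 A.
                Tup [atomic_path A (Dom (Vert A) \<alpha>), \<alpha>, atomic_path A (Cod (Vert A) \<alpha>)])\<rparr>"


section \<open>Model structures and Quillen equivalences\<close>

record 'm model_structure =
  weq :: "'m set"
  cofib :: "'m set"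
  fib :: "'m set"

definition has_lifting :: "('o, 'm) cat \<Rightarrow> 'm \<Rightarrow> 'm \<Rightarrow> bool" where
  "has_lifting C i p \<longleftrightarrow>
     (\<forall>u \<in> hom C (Dom C i) (Dom C p). \<forall>v \<in> hom C (Cod C i) (Cod C p).
        Cmp C p u = Cmp C v i
        \<longrightarrow> (\<exists>h \<in> hom C (Cod C i) (Dom C p). Cmp C h i = u \<and> Cmp C p h = v))"

definition llp :: "('o, 'm) cat \<Rightarrow> 'm set \<Rightarrow> 'm set" where
  "llp C S = {i \<in> Ar C. \<forall>p \<in> S. has_lifting C i p}"

definition rlp :: "('o, 'm) cat \<Rightarrow> 'm set \<Rightarrow> 'm set" where
  "rlp C S = {p \<in> Ar C. \<forall>i \<in> S. has_lifting C i p}"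

text \<open>
  A model structure is determined by its weak equivalences and fibrations, as well as by its weak
  equivalences and cofibrations; the third class is given by a lifting property.  The record below
  holds the three classes only; the model category axioms are not part of it.
\<close>

definition Lack_structure :: "('u set \<Rightarrow> bool) \<Rightarrow> 'u two_func model_structure" where
  "Lack_structure small =
     (let W = {F \<in> Ar (TwoCat small). biequivalence F};
          E = {F \<in> Ar (TwoCat small). equifibration F}
      in \<lparr>weq = W, cofib = llp (TwoCat small) (W \<inter> E), fib = E\<rparr>)"

definition left_induced ::
  "('o, 'm) cat \<Rightarrow> ('o, 'm, 'p, 'n) func \<Rightarrow> 'n model_structure \<Rightarrow> 'm model_structure" where
  "left_induced C L N =
     (let W = {f \<in> Ar C. far L f \<in> weq N};
          K = {f \<in> Ar C. far L f \<in> cofib N}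
      in \<lparr>weq = W, cofib = K, fib = rlp C (W \<inter> K)\<rparr>)"

definition initial_object :: "('o, 'm) cat \<Rightarrow> 'o \<Rightarrow> bool" where
  "initial_object C z \<longleftrightarrow> z \<in> Ob C \<and> (\<forall>X \<in> Ob C. \<exists>!f. f \<in> hom C z X)"

definition terminal_object :: "('o, 'm) cat \<Rightarrow> 'o \<Rightarrow> bool" where
  "terminal_object C z \<longleftrightarrow> z \<in> Ob C \<and> (\<forall>X \<in> Ob C. \<exists>!f. f \<in> hom C X z)"

definition cofibrant :: "('o, 'm) cat \<Rightarrow> 'm model_structure \<Rightarrow> 'o \<Rightarrow> bool" where
  "cofibrant C M X \<longleftrightarrow> X \<in> Ob C \<and> (\<exists>z. initial_object C z \<and> hom C z X \<subseteq> cofib M)"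

definition fibrant :: "('o, 'm) cat \<Rightarrow> 'm model_structure \<Rightarrow> 'o \<Rightarrow> bool" where
  "fibrant C M X \<longleftrightarrow> X \<in> Ob C \<and> (\<exists>z. terminal_object C z \<and> hom C X z \<subseteq> fib M)"

definition quillen_adjunction ::
  "('o, 'm) cat \<Rightarrow> 'm model_structure \<Rightarrow> ('p, 'n) cat \<Rightarrow> 'n model_structure
     \<Rightarrow> ('o, 'm, 'p, 'n) func \<Rightarrow> ('p, 'n, 'o, 'm) func \<Rightarrow> ('o \<Rightarrow> 'm) \<Rightarrow> ('p \<Rightarrow> 'n) \<Rightarrow> bool" where
  "quillen_adjunction C M D N L R \<eta> \<epsilon> \<longleftrightarrow>
     adjunction C D L R \<eta> \<epsilon> \<and>
     far L ` cofib M \<subseteq> cofib N \<and>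
     far L ` (cofib M \<inter> weq M) \<subseteq> cofib N \<inter> weq N"

text \<open>
  \<open>Cmp C (far R f) (\<eta> X)\<close> is the adjunct \<open>X \<rightarrow> R Y\<close> of \<open>f : L X \<rightarrow> Y\<close>.
\<close>

definition quillen_equivalence ::
  "('o, 'm) cat \<Rightarrow> 'm model_structure \<Rightarrow> ('p, 'n) cat \<Rightarrow> 'n model_structure
     \<Rightarrow> ('o, 'm, 'p, 'n) func \<Rightarrow> ('p, 'n, 'o, 'm) func \<Rightarrow> ('o \<Rightarrow> 'm) \<Rightarrow> ('p \<Rightarrow> 'n) \<Rightarrow> bool" where
  "quillen_equivalence C M D N L R \<eta> \<epsilon> \<longleftrightarrow>
     quillen_adjunction C M D N L R \<eta> \<epsilon> \<and>
     (\<forall>X Y. cofibrant C M X \<and> fibrant D N Y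
        \<longrightarrow> (\<forall>f \<in> hom D (fob L X) Y. f \<in> weq N \<longleftrightarrow> Cmp C (far R f) (\<eta> X) \<in> weq M))"

end

theory Submission
  imports Defs
begin

text \<open>
  The counit \<open>Q A \<rightarrow> A\<close> is the identity on objects, surjective on 1-cells and bijective on 2-cells
  between given 1-cells, so equivalences and invertible 2-cells of \<open>Q A\<close> are those of \<open>A\<close>, and
  composing with the counit neither creates nor destroys biequivalences.  For flexible \<open>X\<close> a
  2-functor \<open>f : X \<rightarrow> Y\<close> is its adjunct \<open>X \<rightarrow> Q Y\<close> followed by the counit of \<open>Y\<close>; hence one of them is
  a biequivalence if and only if the other is.  That the inclusion is left Quillen is immediate from
  the definition of the left-induced structure.
\<close>

section \<open>Categories, functors and paths\<close>

text \<open>The definition of an equivalence of categories asks for a quasi-inverse and two natural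
  isomorphisms, data that are awkward to move along the counit. They are traded for full
  faithfulness and essential surjectivity, conditions on single hom-sets and single objects, which
  the counit preserves and reflects one at a time. No general two-out-of-three argument is then
  required: only postcomposition with a counit has to be understood.

  The other delicate point is strictness. \<open>TwoCat\<close> and \<open>Flex\<close> are ordinary
  categories, so the adjunction demands equations between 2-functors. Freeness makes the unit
  strict, because unique decompositions of composable 1-cells concatenate. Its naturality uses the
  morphisms of \<open>Flex\<close>: atoms go to atoms or identities, and \<open>Q F\<close> deletes
  the identities so produced, since paths consist of non-identity 1-cells. Deletion leaves
  composites unchanged, which keeps the counit natural for every 2-functor.\<close>

lemma hom_iff: "f \<in> hom C a b \<longleftrightarrow> f \<in> Ar C \<and> Dom C f = a \<and> Cod C f = b"
  by (auto simp: hom_def)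

lemma Ar_in_hom: "f \<in> Ar C \<Longrightarrow> f \<in> hom C (Dom C f) (Cod C f)"
  by (simp add: hom_iff)

context category
begin

lemma hom_Ob:
  assumes "f \<in> hom C a b"
  shows "a \<in> Ob C" and "b \<in> Ob C"
  using assms Dom_in_Ob Cod_in_Ob by (auto simp: hom_iff)

lemma Ar_Idn: "a \<in> Ob C \<Longrightarrow> Idn C a \<in> Ar C"
  and Dom_Idn: "a \<in> Ob C \<Longrightarrow> Dom C (Idn C a) = a"
  and Cod_Idn: "a \<in> Ob C \<Longrightarrow> Cod C (Idn C a) = a"
  using Idn_in_hom[of a] by (auto simp: hom_iff)

lemma identity_eq_Idn:
  assumes "is_identity C f"
  shows "f = Idn C (Dom C f)" and "Cod C f = Dom C f"
  using assms by (auto simp: is_identity_def Dom_Idn Cod_Idn)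

lemma is_path_Ob: "is_path C a fs b \<Longrightarrow> a \<in> Ob C \<and> b \<in> Ob C"
  by (induction fs arbitrary: b) (auto simp: Cod_in_Ob)

lemma is_path_Ar: "\<lbrakk>is_path C a fs b; f \<in> set fs\<rbrakk> \<Longrightarrow> f \<in> Ar C"
  by (induction fs arbitrary: b) auto

lemma composite_in_hom: "is_path C a fs b \<Longrightarrow> composite C a fs \<in> hom C a b"
proof (induction fs arbitrary: b)
  case Nil
  then show ?case by (auto simp: Idn_in_hom)
next
  case (Cons f fs)
  then have "composite C a fs \<in> hom C a (Dom C f)" and "f \<in> hom C (Dom C f) b"
    by (auto simp: hom_iff)
  then show ?case by (simp add: Cmp_in_hom)
qed

lemma is_path_append: "is_path C a (gs @ fs) c \<longleftrightarrow> (\<exists>b. is_path C a fs b \<and> is_path C b gs c)"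
  by (induction gs arbitrary: c) (auto dest: is_path_Ob)

lemma composite_append:
  "\<lbrakk>is_path C a fs b; is_path C b gs c\<rbrakk>
     \<Longrightarrow> composite C a (gs @ fs) = Cmp C (composite C b gs) (composite C a fs)"
proof (induction gs arbitrary: c)
  case Nil
  then show ?case using Cmp_Idn_left[OF composite_in_hom[OF Nil(1)]] by simp
next
  case (Cons g gs)
  then have "composite C a fs \<in> hom C a b" "composite C b gs \<in> hom C b (Dom C g)"
    "g \<in> hom C (Dom C g) c"
    by (auto intro: composite_in_hom simp: hom_iff[of g])
  with Cons show ?case by (auto simp: Cmp_assoc)
qed

lemma composite_single: "f \<in> Ar C \<Longrightarrow> composite C (Dom C f) [f] = f"
  using Cmp_Idn_right[OF Ar_in_hom] by simp

text \<open>Prepares for \<open>map_path\<close>, which deletes the steps that become identities. A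
  deleted step starts and ends at the same object, so its neighbours still match.\<close>

lemma is_path_filter_nonidentity:
  "is_path C a fs b \<Longrightarrow> is_path C a (filter (\<lambda>f. \<not> is_identity C f) fs) b"
proof (induction fs arbitrary: b)
  case (Cons f fs)
  then show ?case using identity_eq_Idn(2)[of f] by auto
qed simp

text \<open>A deleted step is the identity of its own domain, which the unit law absorbs.\<close>

lemma composite_filter_nonidentity:
  "is_path C a fs b \<Longrightarrow> composite C a (filter (\<lambda>f. \<not> is_identity C f) fs) = composite C a fs"
proof (induction fs arbitrary: b)
  case (Cons f fs)
  have "Cmp C f (composite C a fs) = composite C a fs" if "is_identity C f"
  proof -
    have "composite C a fs \<in> hom C a (Dom C f)"
      using Cons.prems by (auto intro: composite_in_hom)
    then show ?thesis using identity_eq_Idn(1)[OF that] Cmp_Idn_left by metis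
  qed
  with Cons show ?case by auto
qed simp

lemma iso_inverse:
  assumes "f \<in> isos C a b"
  obtains g where "g \<in> isos C b a" "g \<in> hom C b a" "f \<in> hom C a b"
    "Cmp C g f = Idn C a" "Cmp C f g = Idn C b"
  using assms by (auto simp: isos_def)

lemma iso_monic:
  assumes "f \<in> isos C a b" "g \<in> hom C c a" "h \<in> hom C c a" "Cmp C f g = Cmp C f h"
  shows "g = h"
proof -
  obtain k where k: "k \<in> hom C b a" "f \<in> hom C a b" "Cmp C k f = Idn C a"
    using iso_inverse[OF assms(1)] by metis
  have "g = Cmp C k (Cmp C f g)" "h = Cmp C k (Cmp C f h)"
    using Cmp_assoc[OF _ k(2,1)] k(3) Cmp_Idn_left assms(2,3) by metis+
  with assms(4) show ?thesis by simp
qed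

lemma iso_epic:
  assumes "f \<in> isos C a b" "g \<in> hom C b c" "h \<in> hom C b c" "Cmp C g f = Cmp C h f"
  shows "g = h"
proof -
  obtain k where k: "k \<in> hom C b a" "f \<in> hom C a b" "Cmp C f k = Idn C b"
    using iso_inverse[OF assms(1)] by metis
  have "g = Cmp C (Cmp C g f) k" "h = Cmp C (Cmp C h f) k"
    using Cmp_assoc[OF k(1,2)] k(3) Cmp_Idn_right assms(2,3) by metis+
  with assms(4) show ?thesis by simp
qed

end

lemma is_functorD:
  assumes "is_functor C D F"
  shows "category C" and "category D"
    and "a \<in> Ob C \<Longrightarrow> fob F a \<in> Ob D"
    and "f \<in> hom C a b \<Longrightarrow> far F f \<in> hom D (fob F a) (fob F b)"
    and "a \<in> Ob C \<Longrightarrow> far F (Idn C a) = Idn D (fob F a)"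
    and "\<lbrakk>f \<in> hom C a b; g \<in> hom C b c\<rbrakk> \<Longrightarrow> far F (Cmp C g f) = Cmp D (far F g) (far F f)"
  using assms by (auto simp: is_functor_def)

lemma is_functorI:
  assumes "category C" "category D"
    and "\<And>a. a \<in> Ob C \<Longrightarrow> fob F a \<in> Ob D"
    and "\<And>f a b. f \<in> hom C a b \<Longrightarrow> far F f \<in> hom D (fob F a) (fob F b)"
    and "\<And>a. a \<in> Ob C \<Longrightarrow> far F (Idn C a) = Idn D (fob F a)"
    and "\<And>f g a b c. \<lbrakk>f \<in> hom C a b; g \<in> hom C b c\<rbrakk>
           \<Longrightarrow> far F (Cmp C g f) = Cmp D (far F g) (far F f)"
  shows "is_functor C D F"
  using assms by (auto simp: is_functor_def)

text \<open>2-functors are \<open>undefined\<close> off their carriers, so \<open>und_func\<close>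
  and \<open>vert_func\<close> of an identity or composite 2-functor are only known to agree with
  \<open>id_func\<close> and \<open>comp_func\<close> on carriers. This carries functoriality
  across.\<close>

lemma is_functor_cong:
  assumes F: "is_functor C D F"
    and ob: "\<And>a. a \<in> Ob C \<Longrightarrow> fob G a = fob F a"
    and ar: "\<And>f. f \<in> Ar C \<Longrightarrow> far G f = far F f"
  shows "is_functor C D G"
proof -
  interpret category C using F by (rule is_functorD)
  show ?thesis
  proof (rule is_functorI)
    fix f g a b c assume fg: "f \<in> hom C a b" "g \<in> hom C b c"
    then have "f \<in> Ar C" "g \<in> Ar C" "Cmp C g f \<in> Ar C"
      using Cmp_in_hom[OF fg] by (auto simp: hom_iff)
    then show "far G (Cmp C g f) = Cmp D (far G g) (far G f)"
      using is_functorD(6)[OF F fg] by (simp add: ar)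
  next
    fix f a b assume f: "f \<in> hom C a b"
    then show "far G f \<in> hom D (fob G a) (fob G b)"
      using is_functorD(4)[OF F f] hom_Ob[OF f] by (auto simp: ob ar hom_iff)
  qed (use F in \<open>auto simp: ob ar Ar_Idn dest: is_functorD\<close>)
qed

lemma is_functor_id: "category C \<Longrightarrow> is_functor C C id_func"
  by (auto simp: is_functor_def id_func_def)

lemma is_functor_comp:
  assumes "is_functor C D F" "is_functor D E G"
  shows "is_functor C E (comp_func G F)"
  using assms unfolding is_functor_def comp_func_def by (simp, blast)

lemma functor_identity: "\<lbrakk>is_functor C D F; is_identity C f\<rbrakk> \<Longrightarrow> is_identity D (far F f)"
  by (auto simp: is_identity_def is_functor_def)

lemma functor_path:
  assumes F: "is_functor C D F"
  shows "is_path C a fs b \<Longrightarrow> is_path D (fob F a) (map (far F) fs) (fob F b)"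
proof (induction fs arbitrary: b)
  case Nil
  then show ?case by (auto simp: is_functorD[OF F])
next
  case (Cons f fs)
  then have "far F f \<in> hom D (fob F (Dom C f)) (fob F b)"
    by (intro is_functorD(4)[OF F]) (auto simp: hom_iff)
  with Cons show ?case by (auto simp: hom_iff)
qed

lemma functor_composite:
  assumes F: "is_functor C D F"
  shows "is_path C a fs b \<Longrightarrow> composite D (fob F a) (map (far F) fs) = far F (composite C a fs)"
proof (induction fs arbitrary: b)
  case Nil
  then show ?case using is_functorD(5)[OF F] by auto
next
  case (Cons f fs)
  interpret category C using F by (rule is_functorD)
  have "composite C a fs \<in> hom C a (Dom C f)" "f \<in> hom C (Dom C f) b"
    using Cons.prems by (auto intro: composite_in_hom simp: hom_iff[of f])
  with Cons show ?case by (auto simp: is_functorD(6)[OF F])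
qed

section \<open>Equivalences of categories as fully faithful, essentially surjective functors\<close>

definition fully_faithful :: "('o, 'm) cat \<Rightarrow> ('p, 'n) cat \<Rightarrow> ('o, 'm, 'p, 'n) func \<Rightarrow> bool" where
  "fully_faithful C D F \<longleftrightarrow>
     (\<forall>a \<in> Ob C. \<forall>b \<in> Ob C. bij_betw (far F) (hom C a b) (hom D (fob F a) (fob F b)))"

definition essentially_surjective ::
  "('o, 'm) cat \<Rightarrow> ('p, 'n) cat \<Rightarrow> ('o, 'm, 'p, 'n) func \<Rightarrow> bool" where
  "essentially_surjective C D F \<longleftrightarrow> (\<forall>d \<in> Ob D. \<exists>c \<in> Ob C. isos D (fob F c) d \<noteq> {})"

text \<open>Fullness supplies a preimage of the inverse of \<open>far F f\<close>; faithfulness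
  brings the two inverse laws back to \<open>C\<close>.\<close>

lemma fully_faithful_reflects_iso:
  assumes F: "is_functor C D F" "fully_faithful C D F"
    and a: "a \<in> Ob C" and b: "b \<in> Ob C" and f: "f \<in> hom C a b"
    and iso: "far F f \<in> isos D (fob F a) (fob F b)"
  shows "f \<in> isos C a b"
proof -
  interpret C: category C using F(1) by (rule is_functorD)
  interpret D: category D using F(1) by (rule is_functorD)
  obtain k where k: "k \<in> hom D (fob F b) (fob F a)"
    "Cmp D k (far F f) = Idn D (fob F a)" "Cmp D (far F f) k = Idn D (fob F b)"
    using D.iso_inverse[OF iso] by metis
  have ff: "bij_betw (far F) (hom C x y) (hom D (fob F x) (fob F y))"
    if "x \<in> Ob C" "y \<in> Ob C" for x y
    using F(2) that by (auto simp: fully_faithful_def)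
  obtain g where g: "g \<in> hom C b a" "k = far F g"
    using ff[OF b a] k(1) by (auto simp: bij_betw_def)
  note * = is_functorD[OF F(1)]
  have "far F (Cmp C g f) = far F (Idn C a)" "far F (Cmp C f g) = far F (Idn C b)"
    using k g f a b by (auto simp: *(5) *(6)[OF f g(1)] *(6)[OF g(1) f])
  then have "Cmp C g f = Idn C a" "Cmp C f g = Idn C b"
    using ff[OF a a] ff[OF b b] C.Cmp_in_hom[OF f g(1)] C.Cmp_in_hom[OF g(1) f]
      C.Idn_in_hom[OF a] C.Idn_in_hom[OF b]
    by (auto simp: bij_betw_def inj_on_def)
  then show ?thesis using f g(1) by (auto simp: isos_def)
qed

text \<open>Naturality turns equality of images into \<open>Cmp C (s b) f = Cmp C (s b) g\<close>,
  and the invertible \<open>s b\<close> cancels. A single natural isomorphism is involved, so the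
  lemma serves for a functor and for its quasi-inverse alike.\<close>

lemma faithful_if_left_inverse:
  assumes s: "nat_iso C C id_func (comp_func G F) s"
    and fg: "f \<in> hom C a b" "g \<in> hom C a b" "far F f = far F g"
  shows "f = g"
proof -
  have s1: "nat_trans C C id_func (comp_func G F) s" "\<And>c. c \<in> Ob C \<Longrightarrow> s c \<in> isos C c (fob G (fob F c))"
    using s by (auto simp: nat_iso_def id_func_def comp_func_def)
  then interpret C: category C by (auto simp: nat_trans_def is_functor_def)
  have nat: "Cmp C (s b) h = Cmp C (far G (far F h)) (s a)" if "h \<in> hom C a b" for h
    using s1(1) that by (auto simp: nat_trans_def id_func_def comp_func_def)
  have "b \<in> Ob C" using C.hom_Ob fg by blast
  moreover have "Cmp C (s b) f = Cmp C (s b) g" using nat fg by simp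
  ultimately show ?thesis using C.iso_monic s1(2) fg by blast
qed

text \<open>The two natural isomorphisms of an equivalence point in opposite directions, from
  \<open>id_func\<close> to \<open>G F\<close> and from \<open>F G\<close> to
  \<open>id_func\<close>; reversing the second lets \<open>faithful_if_left_inverse\<close> be used
  for \<open>G\<close> too. Naturality of the inverses is checked after precomposing with
  \<open>t a\<close>, which is epic.\<close>

lemma nat_iso_inverse:
  assumes t: "nat_iso C D F G t"
  obtains s where "nat_iso C D G F s"
proof -
  have F: "is_functor C D F" and G: "is_functor C D G"
    and ti: "\<And>c. c \<in> Ob C \<Longrightarrow> t c \<in> isos D (fob F c) (fob G c)"
    and nat: "\<And>a b f. f \<in> hom C a b \<Longrightarrow> Cmp D (t b) (far F f) = Cmp D (far G f) (t a)"
    using t by (auto simp: nat_iso_def nat_trans_def)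
  interpret C: category C using F by (rule is_functorD)
  interpret D: category D using F by (rule is_functorD)
  have "\<exists>k. k \<in> isos D (fob G c) (fob F c) \<and> k \<in> hom D (fob G c) (fob F c)
      \<and> Cmp D k (t c) = Idn D (fob F c) \<and> Cmp D (t c) k = Idn D (fob G c)" if "c \<in> Ob C" for c
    using D.iso_inverse[OF ti[OF that]] by metis
  then obtain s where s: "\<And>c. c \<in> Ob C \<Longrightarrow> s c \<in> isos D (fob G c) (fob F c)
      \<and> s c \<in> hom D (fob G c) (fob F c)
      \<and> Cmp D (s c) (t c) = Idn D (fob F c) \<and> Cmp D (t c) (s c) = Idn D (fob G c)"
    by metis
  have "Cmp D (s b) (far G f) = Cmp D (far F f) (s a)" if f: "f \<in> hom C a b" for a b f
  proof -
    have ab: "a \<in> Ob C" "b \<in> Ob C" using C.hom_Ob[OF f] by auto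
    have tab: "t a \<in> hom D (fob F a) (fob G a)" "t b \<in> hom D (fob F b) (fob G b)"
      using ti[OF ab(1)] ti[OF ab(2)] by (auto simp: isos_def)
    have Ff: "far F f \<in> hom D (fob F a) (fob F b)" and Gf: "far G f \<in> hom D (fob G a) (fob G b)"
      using f F G is_functorD by metis+
    have "Cmp D (Cmp D (s b) (far G f)) (t a) = Cmp D (Cmp D (s b) (t b)) (far F f)"
      using D.Cmp_assoc[OF tab(1) Gf, of "s b" "fob F b"] D.Cmp_assoc[OF Ff tab(2), of "s b" "fob F b"]
        nat[OF f] s[OF ab(2)] by simp
    also have "\<dots> = Cmp D (far F f) (Cmp D (s a) (t a))"
      using s[OF ab(1)] s[OF ab(2)] D.Cmp_Idn_left[OF Ff] D.Cmp_Idn_right[OF Ff] by simp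
    also have "\<dots> = Cmp D (Cmp D (far F f) (s a)) (t a)"
      using D.Cmp_assoc[OF tab(1) _ Ff, of "s a"] s[OF ab(1)] by simp
    finally have eq: "Cmp D (Cmp D (s b) (far G f)) (t a) = Cmp D (Cmp D (far F f) (s a)) (t a)" .
    have "Cmp D (s b) (far G f) \<in> hom D (fob G a) (fob F b)"
      "Cmp D (far F f) (s a) \<in> hom D (fob G a) (fob F b)"
      using D.Cmp_in_hom[OF Gf, of "s b"] D.Cmp_in_hom[OF _ Ff, of "s a"] s[OF ab(1)] s[OF ab(2)]
      by simp_all
    then show ?thesis using D.iso_epic[OF ti[OF ab(1)] _ _ eq] by blast
  qed
  then show ?thesis using s F G by (intro that[of s]) (auto simp: nat_iso_def nat_trans_def)
qed

text \<open>In this form equivalences of hom-categories can be compared along the counit. The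
  converse direction builds the quasi-inverse by choice.\<close>

lemma equivalence_of_categories_iff:
  "equivalence_of_categories C D F \<longleftrightarrow>
     is_functor C D F \<and> fully_faithful C D F \<and> essentially_surjective C D F"
proof
  assume "equivalence_of_categories C D F"
  then obtain G s t where F: "is_functor C D F" and G: "is_functor D C G"
    and s: "nat_iso C C id_func (comp_func G F) s" and t: "nat_iso D D (comp_func F G) id_func t"
    by (auto simp: equivalence_of_categories_def)
  interpret C: category C using F by (rule is_functorD)
  interpret D: category D using F by (rule is_functorD)
  obtain t' where t': "nat_iso D D id_func (comp_func F G) t'"
    using nat_iso_inverse[OF t] by metis
  have si: "s c \<in> isos C c (fob G (fob F c))" if "c \<in> Ob C" for c
    using s that by (auto simp: nat_iso_def id_func_def comp_func_def)
  have nat: "Cmp C (s b) h = Cmp C (far G (far F h)) (s a)" if "h \<in> hom C a b" for a b h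
    using s that by (auto simp: nat_iso_def nat_trans_def id_func_def comp_func_def)
  \<comment> \<open>The preimage of \<open>k\<close> is the inverse of \<open>s b\<close> after
    \<open>far G k\<close> after \<open>s a\<close>. Naturality of \<open>s\<close> shows that
    \<open>far G\<close> takes the same value on \<open>k\<close> and on the image of this arrow
    under \<open>F\<close>, and \<open>G\<close> is faithful.\<close>
  have full: "\<exists>f \<in> hom C a b. far F f = k"
    if a: "a \<in> Ob C" and b: "b \<in> Ob C" and k: "k \<in> hom D (fob F a) (fob F b)" for a b k
  proof -
    obtain r where r: "r \<in> hom C (fob G (fob F b)) b" "Cmp C (s b) r = Idn C (fob G (fob F b))"
      using C.iso_inverse[OF si[OF b]] by metis
    have sh: "s a \<in> hom C a (fob G (fob F a))" "s b \<in> hom C b (fob G (fob F b))"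
      using si[OF a] si[OF b] by (auto simp: isos_def)
    have Gk: "far G k \<in> hom C (fob G (fob F a)) (fob G (fob F b))"
      using is_functorD(4)[OF G k] .
    let ?f = "Cmp C r (Cmp C (far G k) (s a))"
    have Gks: "Cmp C (far G k) (s a) \<in> hom C a (fob G (fob F b))"
      using C.Cmp_in_hom sh(1) Gk by metis
    then have f: "?f \<in> hom C a b" using C.Cmp_in_hom r(1) by metis
    have GFf: "far G (far F ?f) \<in> hom C (fob G (fob F a)) (fob G (fob F b))"
      using is_functorD(4)[OF G is_functorD(4)[OF F f]] .
    have "Cmp C (far G (far F ?f)) (s a) = Cmp C (s b) ?f" using nat[OF f] by simp
    also have "\<dots> = Cmp C (far G k) (s a)"
      using C.Cmp_assoc[OF Gks r(1) sh(2)] r(2) C.Cmp_Idn_left[OF Gks] by simp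
    finally have "far G (far F ?f) = far G k" using C.iso_epic[OF si[OF a] GFf Gk] by metis
    then have "far F ?f = k"
      using faithful_if_left_inverse[OF t' is_functorD(4)[OF F f] k] by metis
    with f show ?thesis by blast
  qed
  have "bij_betw (far F) (hom C a b) (hom D (fob F a) (fob F b))" if "a \<in> Ob C" "b \<in> Ob C" for a b
    unfolding bij_betw_def
  proof
    show "inj_on (far F) (hom C a b)"
      using faithful_if_left_inverse[OF s] by (auto intro: inj_onI)
    show "far F ` hom C a b = hom D (fob F a) (fob F b)"
      using full[OF that] is_functorD(4)[OF F] by blast
  qed
  then have "fully_faithful C D F" by (auto simp: fully_faithful_def)
  moreover have "t d \<in> isos D (fob F (fob G d)) d" if "d \<in> Ob D" for d
    using t that by (auto simp: nat_iso_def id_func_def comp_func_def)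
  then have "essentially_surjective C D F"
    using is_functorD(3)[OF G] by (auto simp: essentially_surjective_def)
  ultimately show "is_functor C D F \<and> fully_faithful C D F \<and> essentially_surjective C D F"
    using F by blast
next
  assume "is_functor C D F \<and> fully_faithful C D F \<and> essentially_surjective C D F"
  then have F: "is_functor C D F" and fff: "fully_faithful C D F"
    and es: "essentially_surjective C D F"
    by auto
  interpret C: category C using F by (rule is_functorD)
  interpret D: category D using F by (rule is_functorD)
  note * = is_functorD[OF F]
  have ff: "bij_betw (far F) (hom C x y) (hom D (fob F x) (fob F y))"
    if "x \<in> Ob C" "y \<in> Ob C" for x y
    using fff that by (auto simp: fully_faithful_def)
  have "\<exists>c k. c \<in> Ob C \<and> k \<in> isos D (fob F c) d" if "d \<in> Ob D" for d
    using es that by (auto simp: essentially_surjective_def)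
  then obtain G0 t where G0: "\<And>d. d \<in> Ob D \<Longrightarrow> G0 d \<in> Ob C"
    and t: "\<And>d. d \<in> Ob D \<Longrightarrow> t d \<in> isos D (fob F (G0 d)) d"
    by metis
  have th: "t d \<in> hom D (fob F (G0 d)) d" if "d \<in> Ob D" for d
    using t[OF that] by (simp add: isos_def)
  have "\<exists>r. r \<in> isos D d (fob F (G0 d)) \<and> r \<in> hom D d (fob F (G0 d))
      \<and> Cmp D (t d) r = Idn D d" if "d \<in> Ob D" for d
    using D.iso_inverse[OF t[OF that]] by metis
  then obtain r where r: "\<And>d. d \<in> Ob D \<Longrightarrow> r d \<in> isos D d (fob F (G0 d))"
    and rh: "\<And>d. d \<in> Ob D \<Longrightarrow> r d \<in> hom D d (fob F (G0 d))"
    and tr: "\<And>d. d \<in> Ob D \<Longrightarrow> Cmp D (t d) (r d) = Idn D d"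
    by metis
  \<comment> \<open>The value of the quasi-inverse on \<open>k\<close> lifts the conjugate of
    \<open>k\<close> by the isomorphisms \<open>t\<close>. The equation recorded here is naturality
    of \<open>t\<close>, and it determines the lift.\<close>
  have lift: "\<exists>h. h \<in> hom C (G0 d) (G0 e) \<and> Cmp D (t e) (far F h) = Cmp D k (t d)"
    if k: "k \<in> hom D d e" for d e k
  proof -
    have de: "d \<in> Ob D" "e \<in> Ob D" using D.hom_Ob[OF k] by auto
    have kt: "Cmp D k (t d) \<in> hom D (fob F (G0 d)) e" using D.Cmp_in_hom[OF th[OF de(1)] k] .
    then have "Cmp D (r e) (Cmp D k (t d)) \<in> hom D (fob F (G0 d)) (fob F (G0 e))"
      using D.Cmp_in_hom rh[OF de(2)] by metis
    then obtain h where "h \<in> hom C (G0 d) (G0 e)" "far F h = Cmp D (r e) (Cmp D k (t d))"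
      using ff[OF G0[OF de(1)] G0[OF de(2)]] by (auto simp: bij_betw_def) (metis imageE)
    moreover have "Cmp D (t e) (Cmp D (r e) (Cmp D k (t d))) = Cmp D k (t d)"
      using D.Cmp_assoc[OF kt rh[OF de(2)] th[OF de(2)]] tr[OF de(2)] D.Cmp_Idn_left[OF kt] by simp
    ultimately show ?thesis by metis
  qed
  \<comment> \<open>The choice has to depend on \<open>k\<close> alone, so the ends are read off
    with \<open>Dom\<close> and \<open>Cod\<close>.\<close>
  obtain G1 where G1: "\<And>k d e. k \<in> hom D d e \<Longrightarrow>
      G1 k \<in> hom C (G0 d) (G0 e) \<and> Cmp D (t e) (far F (G1 k)) = Cmp D k (t d)"
  proof
    fix k d e assume k: "k \<in> hom D d e"
    then have "d = Dom D k" "e = Cod D k" by (auto simp: hom_iff)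
    with lift[OF k] show "(SOME h. h \<in> hom C (G0 (Dom D k)) (G0 (Cod D k))
        \<and> Cmp D (t (Cod D k)) (far F h) = Cmp D k (t (Dom D k))) \<in> hom C (G0 d) (G0 e)
        \<and> Cmp D (t e) (far F (SOME h. h \<in> hom C (G0 (Dom D k)) (G0 (Cod D k))
        \<and> Cmp D (t (Cod D k)) (far F h) = Cmp D k (t (Dom D k)))) = Cmp D k (t d)"
      by simp (rule someI_ex)
  qed
  \<comment> \<open>Arrows between values of \<open>G0\<close> are tested after applying
    \<open>F\<close> and composing with \<open>t e\<close>; both preservation laws for
    \<open>G1\<close> reduce to such an equation.\<close>
  have uniq: "h = h'" if "d \<in> Ob D" "e \<in> Ob D" "h \<in> hom C (G0 d) (G0 e)" "h' \<in> hom C (G0 d) (G0 e)"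
    "Cmp D (t e) (far F h) = Cmp D (t e) (far F h')" for d e h h'
  proof -
    have "far F h = far F h'"
      using D.iso_monic[OF t[OF that(2)] *(4)[OF that(3)] *(4)[OF that(4)] that(5)] .
    then show ?thesis using ff[OF G0[OF that(1)] G0[OF that(2)]] that(3,4)
      by (auto simp: bij_betw_def inj_on_def)
  qed
  let ?G = "\<lparr>fob = G0, far = G1\<rparr>"
  have G: "is_functor D C ?G"
  proof (rule is_functorI)
    fix d assume d: "d \<in> Ob D"
    have "G1 (Idn D d) = Idn C (G0 d)"
    proof (rule uniq[OF d d])
      show "Cmp D (t d) (far F (G1 (Idn D d))) = Cmp D (t d) (far F (Idn C (G0 d)))"
        using G1[OF D.Idn_in_hom[OF d]] *(5)[OF G0[OF d]]
          D.Cmp_Idn_left[OF th[OF d]] D.Cmp_Idn_right[OF th[OF d]] by simp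
    qed (use d G1[OF D.Idn_in_hom[OF d]] C.Idn_in_hom[OF G0[OF d]] in auto)
    then show "far ?G (Idn D d) = Idn C (fob ?G d)" by simp
  next
    fix f g d d' d'' assume f: "f \<in> hom D d d'" and g: "g \<in> hom D d' d''"
    have Ob: "d \<in> Ob D" "d' \<in> Ob D" "d'' \<in> Ob D" using D.hom_Ob[OF f] D.hom_Ob[OF g] by auto
    have gf: "Cmp D g f \<in> hom D d d''" using D.Cmp_in_hom[OF f g] .
    note G1f = G1[OF f] and G1g = G1[OF g]
    have Ff: "far F (G1 f) \<in> hom D (fob F (G0 d)) (fob F (G0 d'))"
      and Fg: "far F (G1 g) \<in> hom D (fob F (G0 d')) (fob F (G0 d''))"
      using *(4) G1f G1g by auto
    have "G1 (Cmp D g f) = Cmp C (G1 g) (G1 f)"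
    proof (rule uniq[OF Ob(1,3)])
      have "Cmp D (t d'') (far F (Cmp C (G1 g) (G1 f)))
          = Cmp D (t d'') (Cmp D (far F (G1 g)) (far F (G1 f)))"
        using *(6) G1f G1g by metis
      also have "\<dots> = Cmp D (Cmp D (t d'') (far F (G1 g))) (far F (G1 f))"
        using D.Cmp_assoc[OF Ff Fg th[OF Ob(3)]] .
      also have "\<dots> = Cmp D g (Cmp D (t d') (far F (G1 f)))"
        using G1g D.Cmp_assoc[OF Ff th[OF Ob(2)] g] by simp
      also have "\<dots> = Cmp D (Cmp D g f) (t d)"
        using G1f D.Cmp_assoc[OF th[OF Ob(1)] f g] by simp
      finally show "Cmp D (t d'') (far F (G1 (Cmp D g f)))
          = Cmp D (t d'') (far F (Cmp C (G1 g) (G1 f)))"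
        using G1[OF gf] by simp
      show "Cmp C (G1 g) (G1 f) \<in> hom C (G0 d) (G0 d'')" using C.Cmp_in_hom G1f G1g by blast
    qed (use G1[OF gf] in auto)
    then show "far ?G (Cmp D g f) = Cmp C (far ?G g) (far ?G f)" by simp
  qed (use G0 G1 *(1,2) in auto)
  have t_nat: "nat_iso D D (comp_func F ?G) id_func t"
    using t th G1 is_functor_comp[OF G F] is_functor_id[OF *(2)]
    by (auto simp: nat_iso_def nat_trans_def comp_func_def id_func_def)
  \<comment> \<open>The unit is a preimage of the inverse of \<open>t\<close> at
    \<open>fob F c\<close>; its invertibility is reflected by \<open>F\<close>.\<close>
  have "\<exists>s. s \<in> hom C c (G0 (fob F c)) \<and> far F s = r (fob F c)" if c: "c \<in> Ob C" for c
  proof -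
    have "r (fob F c) \<in> far F ` hom C c (G0 (fob F c))"
      using ff[OF c G0] rh *(3)[OF c] by (auto simp: bij_betw_def)
    then show ?thesis by (metis imageE)
  qed
  then obtain s where s: "\<And>c. c \<in> Ob C \<Longrightarrow> s c \<in> hom C c (G0 (fob F c))"
    and Fs: "\<And>c. c \<in> Ob C \<Longrightarrow> far F (s c) = r (fob F c)"
    by metis
  have si: "s c \<in> isos C c (G0 (fob F c))" if c: "c \<in> Ob C" for c
    using fully_faithful_reflects_iso[OF F fff c G0 s[OF c]] r[of "fob F c"] Fs[OF c] *(3)[OF c]
    by simp
  \<comment> \<open>Naturality is tested after applying \<open>F\<close> and then composing with the
    monic \<open>t (fob F b)\<close>, where both sides become \<open>far F f\<close>.\<close>
  have s_nat: "Cmp C (s b) f = Cmp C (G1 (far F f)) (s a)" if f: "f \<in> hom C a b" for a b f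
  proof -
    have ab: "a \<in> Ob C" "b \<in> Ob C" using C.hom_Ob[OF f] by auto
    have Ff: "far F f \<in> hom D (fob F a) (fob F b)" using *(4)[OF f] .
    note FO = *(3)[OF ab(1)] *(3)[OF ab(2)] and G1f = G1[OF Ff]
    have FGf: "far F (G1 (far F f)) \<in> hom D (fob F (G0 (fob F a))) (fob F (G0 (fob F b)))"
      using *(4) G1f by blast
    have "Cmp D (t (fob F b)) (Cmp D (far F (G1 (far F f))) (r (fob F a)))
        = Cmp D (far F f) (Cmp D (t (fob F a)) (r (fob F a)))"
      using D.Cmp_assoc[OF rh[OF FO(1)] FGf th[OF FO(2)]]
        D.Cmp_assoc[OF rh[OF FO(1)] th[OF FO(1)] Ff] G1f by simp
    also have "\<dots> = Cmp D (t (fob F b)) (Cmp D (r (fob F b)) (far F f))"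
      using D.Cmp_assoc[OF Ff rh[OF FO(2)] th[OF FO(2)]] tr[OF FO(1)] tr[OF FO(2)]
        D.Cmp_Idn_left[OF Ff] D.Cmp_Idn_right[OF Ff] by simp
    finally have "Cmp D (far F (G1 (far F f))) (r (fob F a)) = Cmp D (r (fob F b)) (far F f)"
      using D.iso_monic[OF t[OF FO(2)] D.Cmp_in_hom[OF rh[OF FO(1)] FGf]
          D.Cmp_in_hom[OF Ff rh[OF FO(2)]]] by metis
    then have "far F (Cmp C (s b) f) = far F (Cmp C (G1 (far F f)) (s a))"
      using *(6)[OF f s[OF ab(2)]] *(6)[OF s[OF ab(1)]] G1f Fs[OF ab(1)] Fs[OF ab(2)] by metis
    moreover have "Cmp C (s b) f \<in> hom C a (G0 (fob F b))"
      "Cmp C (G1 (far F f)) (s a) \<in> hom C a (G0 (fob F b))"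
      using C.Cmp_in_hom f s ab G1f by blast+
    ultimately show ?thesis using ff[OF ab(1) G0[OF FO(2)]] by (auto simp: bij_betw_def inj_on_def)
  qed
  have "nat_iso C C id_func (comp_func ?G F) s"
    using s si s_nat is_functor_comp[OF F G] is_functor_id[OF *(1)]
    by (auto simp: nat_iso_def nat_trans_def comp_func_def id_func_def)
  with F G t_nat show "equivalence_of_categories C D F"
    by (auto simp: equivalence_of_categories_def)
qed

section \<open>Free categories\<close>

lemma atomic_Ar: "atomic C f \<Longrightarrow> f \<in> Ar C"
  by (simp add: atomic_def)

lemma atomic_nonidentity: "atomic C f \<Longrightarrow> \<not> is_identity C f"
  by (simp add: atomic_def)

lemma atomic_Cmp:
  "\<lbrakk>atomic C (Cmp C g f); f \<in> hom C a b; g \<in> hom C b c\<rbrakk> \<Longrightarrow> is_identity C f \<or> is_identity C g"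
  by (auto simp: atomic_def hom_iff)

context
  fixes C :: "('o, 'm) cat"
  assumes free: "free_category C"
begin

interpretation category C
  using free by (simp add: free_category_def)

lemma atomic_decomposition_atoms: "f \<in> Ar C \<Longrightarrow> atomic_decomposition C f (atoms C f)"
  using free unfolding free_category_def atoms_def by (blast intro: theI')

lemma atoms_path: "f \<in> hom C a b \<Longrightarrow> is_path C a (atoms C f) b"
  and atomic_atoms: "\<lbrakk>f \<in> hom C a b; g \<in> set (atoms C f)\<rbrakk> \<Longrightarrow> atomic C g"
  and composite_atoms: "f \<in> hom C a b \<Longrightarrow> composite C a (atoms C f) = f"
  using atomic_decomposition_atoms[of f] by (auto simp: atomic_decomposition_def hom_iff)

text \<open>The uniqueness half of freeness in usable form: exhibiting a path of atomic arrows with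
  the right composite determines \<open>atoms\<close>. The computations of \<open>atoms\<close>
  below go through it.\<close>

lemma atoms_composite:
  assumes "is_path C a fs b" "\<And>g. g \<in> set fs \<Longrightarrow> atomic C g"
  shows "atoms C (composite C a fs) = fs"
proof -
  have f: "composite C a fs \<in> hom C a b" using assms(1) by (rule composite_in_hom)
  then have "atomic_decomposition C (composite C a fs) fs"
    using assms by (auto simp: atomic_decomposition_def hom_iff)
  moreover have "\<exists>!fs'. atomic_decomposition C (composite C a fs) fs'"
    using free f by (auto simp: free_category_def hom_iff)
  ultimately show ?thesis unfolding atoms_def by (intro the1_equality)
qed

lemma atoms_Idn: "a \<in> Ob C \<Longrightarrow> atoms C (Idn C a) = []"
  using atoms_composite[of a "[]" a] by simp

lemma atoms_Cmp:
  assumes "f \<in> hom C a b" "g \<in> hom C b c"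
  shows "atoms C (Cmp C g f) = atoms C g @ atoms C f"
proof -
  have gf: "Cmp C g f = composite C a (atoms C g @ atoms C f)"
    using composite_append[OF atoms_path[OF assms(1)] atoms_path[OF assms(2)]]
      composite_atoms[OF assms(1)] composite_atoms[OF assms(2)] by simp
  have "is_path C a (atoms C g @ atoms C f) c"
    using atoms_path[OF assms(1)] atoms_path[OF assms(2)] by (auto simp: is_path_append)
  then have "atoms C (composite C a (atoms C g @ atoms C f)) = atoms C g @ atoms C f"
    using atomic_atoms[OF assms(1)] atomic_atoms[OF assms(2)] by (intro atoms_composite) auto
  with gf show ?thesis by simp
qed

lemma atoms_atomic: "atomic C f \<Longrightarrow> atoms C f = [f]"
  using atoms_composite[of "Dom C f" "[f]" "Cod C f"] composite_single[of f]
  by (simp add: atomic_Ar Dom_in_Ob)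

end

lemma free_functorD:
  assumes "free_functor C D F"
  shows "free_category C" and "free_category D" and "is_functor C D F"
    and "atomic C f \<Longrightarrow> atomic D (far F f) \<or> is_identity D (far F f)"
  using assms by (auto simp: free_functor_def atomic_Ar)

text \<open>The images of the atoms of \<open>f\<close> are atomic or identities; deleting the
  identities leaves a path of atomic arrows with composite \<open>far F f\<close>, and
  decompositions are unique. The right-hand side has the shape of \<open>map_path\<close>, so this
  is naturality of the unit on 1-cells.\<close>

lemma atoms_free_functor:
  assumes F: "free_functor C D F" and f: "f \<in> hom C a b"
  shows "atoms D (far F f) = filter (\<lambda>g. \<not> is_identity D g) (map (far F) (atoms C f))"
    (is "_ = ?gs")
proof -
  note * = free_functorD[OF F]
  interpret D: category D using *(3) by (rule is_functorD)
  have path: "is_path D (fob F a) (map (far F) (atoms C f)) (fob F b)"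
    using functor_path[OF *(3) atoms_path[OF *(1) f]] .
  have "composite D (fob F a) ?gs = far F f"
    using D.composite_filter_nonidentity[OF path] functor_composite[OF *(3) atoms_path[OF *(1) f]]
      composite_atoms[OF *(1) f] by simp
  moreover have "atomic D g" if "g \<in> set ?gs" for g
    using that *(4) atomic_atoms[OF *(1) f] by auto
  ultimately show ?thesis
    using atoms_composite[OF *(2) D.is_path_filter_nonidentity[OF path]] by metis
qed

lemma free_functor_id: "free_category C \<Longrightarrow> free_functor C C id_func"
  by (auto simp: free_functor_def free_category_def is_functor_id) (simp add: id_func_def)

lemma free_functor_comp:
  assumes F: "free_functor C D F" and G: "free_functor D E G"
  shows "free_functor C E (comp_func G F)"
proof -
  have "atomic E (far G (far F f)) \<or> is_identity E (far G (far F f))" if "atomic C f" for f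
    using free_functorD(4)[OF F that] free_functorD(4)[OF G]
      functor_identity[OF free_functorD(3)[OF G]] by blast
  then show ?thesis
    using F G is_functor_comp by (auto simp: free_functor_def comp_func_def)
qed

lemma free_functor_cong:
  assumes F: "free_functor C D F"
    and "\<And>a. a \<in> Ob C \<Longrightarrow> fob G a = fob F a" "\<And>f. f \<in> Ar C \<Longrightarrow> far G f = far F f"
  shows "free_functor C D G"
  using F is_functor_cong[of C D F G] assms(2,3) by (auto simp: free_functor_def)


section \<open>2-categories and 2-functors\<close>

context two_category
begin

sublocale U: category "Und A" by (rule Und)
sublocale V: category "Vert A" by (rule Vert)

lemma hcomposable_iff:
  "\<lbrakk>\<alpha> \<in> hom (Vert A) f f'; \<beta> \<in> hom (Vert A) g g'\<rbrakk>
     \<Longrightarrow> hcomposable A \<beta> \<alpha> \<longleftrightarrow> Dom (Und A) g = Cod (Und A) f"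
  by (auto simp: hcomposable_def hom_iff)

lemma hcomposableE:
  assumes "hcomposable A \<beta> \<alpha>"
  obtains f f' g g' where "\<alpha> \<in> hom (Vert A) f f'" "\<beta> \<in> hom (Vert A) g g'"
    "Dom (Und A) g = Cod (Und A) f"
  using assms that[OF Ar_in_hom Ar_in_hom] by (simp add: hcomposable_def)

lemma hom_Vert_Cell1:
  assumes "\<alpha> \<in> hom (Vert A) f f'"
  shows "f \<in> Cell1 A" and "f' \<in> Cell1 A"
  using V.hom_Ob[OF assms] by (auto simp: Ob_Vert)

lemma category_hom_cat: "category (hom_cat A a b)"
proof
  fix f assume "f \<in> Ob (hom_cat A a b)"
  then show "Idn (hom_cat A a b) f \<in> hom (hom_cat A a b) f f"
    using V.Idn_in_hom[of f] by (auto simp: hom_cat_def hom_iff Ob_Vert)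
next
  fix \<alpha> \<beta> f g h assume "\<alpha> \<in> hom (hom_cat A a b) f g" "\<beta> \<in> hom (hom_cat A a b) g h"
  then show "Cmp (hom_cat A a b) \<beta> \<alpha> \<in> hom (hom_cat A a b) f h"
    using V.Cmp_in_hom[of \<alpha> f g \<beta> h] by (auto simp: hom_cat_def hom_iff)
next
  fix \<alpha> \<beta> \<gamma> f g h k
  assume "\<alpha> \<in> hom (hom_cat A a b) f g" "\<beta> \<in> hom (hom_cat A a b) g h" "\<gamma> \<in> hom (hom_cat A a b) h k"
  then show "Cmp (hom_cat A a b) \<gamma> (Cmp (hom_cat A a b) \<beta> \<alpha>)
      = Cmp (hom_cat A a b) (Cmp (hom_cat A a b) \<gamma> \<beta>) \<alpha>"
    using V.Cmp_assoc[of \<alpha> f g \<beta> h \<gamma> k] by (auto simp: hom_cat_def hom_iff)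
qed (use V.Cmp_Idn_left V.Cmp_Idn_right in \<open>auto simp: hom_cat_def hom_iff\<close>)

lemma hom_hom_cat:
  assumes "f \<in> hom (Und A) a b" "g \<in> hom (Und A) a b"
  shows "hom (hom_cat A a b) f g = hom (Vert A) f g"
  using assms by (auto simp: hom_cat_def hom_iff)

text \<open>An inverse of a 2-cell between \<open>f\<close> and \<open>g\<close> runs between the
  same 1-cells, hence stays in the hom-category. Invertibility can therefore be computed in
  \<open>Vert A\<close>.\<close>

lemma isos_hom_cat:
  assumes "f \<in> hom (Und A) a b" "g \<in> hom (Und A) a b"
  shows "isos (hom_cat A a b) f g = isos (Vert A) f g"
  using hom_hom_cat[OF assms] hom_hom_cat[OF assms(2,1)] by (auto simp: isos_def) (auto simp: hom_cat_def)

end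

context two_functor
begin

sublocale S: two_category "src F" by (rule src)
sublocale T: two_category "tgt F" by (rule tgt)

lemma map0_Obj: "a \<in> Obj (src F) \<Longrightarrow> map0 F a \<in> Obj (tgt F)"
  and map1_hom: "f \<in> hom (Und (src F)) a b \<Longrightarrow> map1 F f \<in> hom (Und (tgt F)) (map0 F a) (map0 F b)"
  using is_functorD(3,4)[OF und_func] by (auto simp: und_func_def)

lemma map2_hom: "\<alpha> \<in> hom (Vert (src F)) f g \<Longrightarrow> map2 F \<alpha> \<in> hom (Vert (tgt F)) (map1 F f) (map1 F g)"
  and map2_Idn: "f \<in> Cell1 (src F) \<Longrightarrow> map2 F (Idn (Vert (src F)) f) = Idn (Vert (tgt F)) (map1 F f)"
  and map2_Cmp: "\<lbrakk>\<alpha> \<in> hom (Vert (src F)) f g; \<beta> \<in> hom (Vert (src F)) g h\<rbrakk>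
    \<Longrightarrow> map2 F (Cmp (Vert (src F)) \<beta> \<alpha>) = Cmp (Vert (tgt F)) (map2 F \<beta>) (map2 F \<alpha>)"
  using is_functorD(4-6)[OF vert_func] by (auto simp: vert_func_def S.Ob_Vert)

lemma map1_Cell1: "f \<in> Cell1 (src F) \<Longrightarrow> map1 F f \<in> Cell1 (tgt F)"
  and Dom_map1: "f \<in> Cell1 (src F) \<Longrightarrow> Dom (Und (tgt F)) (map1 F f) = map0 F (Dom (Und (src F)) f)"
  and Cod_map1: "f \<in> Cell1 (src F) \<Longrightarrow> Cod (Und (tgt F)) (map1 F f) = map0 F (Cod (Und (src F)) f)"
  using map1_hom[OF Ar_in_hom, of f] by (auto simp: hom_iff)

lemma map2_Cell2: "\<alpha> \<in> Cell2 (src F) \<Longrightarrow> map2 F \<alpha> \<in> Cell2 (tgt F)"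
  using map2_hom[OF Ar_in_hom, of \<alpha>] by (auto simp: hom_iff)

lemma hcomposable_map2:
  assumes "hcomposable (src F) \<beta> \<alpha>"
  shows "hcomposable (tgt F) (map2 F \<beta>) (map2 F \<alpha>)"
proof -
  obtain f f' g g' where \<alpha>: "\<alpha> \<in> hom (Vert (src F)) f f'" and \<beta>: "\<beta> \<in> hom (Vert (src F)) g g'"
    and "Dom (Und (src F)) g = Cod (Und (src F)) f"
    using S.hcomposableE[OF assms] .
  then show ?thesis
    using T.hcomposable_iff[OF map2_hom[OF \<alpha>] map2_hom[OF \<beta>]]
      S.hom_Vert_Cell1[OF \<alpha>] S.hom_Vert_Cell1[OF \<beta>] by (simp add: Dom_map1 Cod_map1)
qed

lemma hom_cat_functor:
  "is_functor (hom_cat (src F) a b) (hom_cat (tgt F) (map0 F a) (map0 F b)) (vert_func F)"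
proof (rule is_functorI)
  fix \<alpha> f g assume "\<alpha> \<in> hom (hom_cat (src F) a b) f g"
  then show "far (vert_func F) \<alpha> \<in> hom (hom_cat (tgt F) (map0 F a) (map0 F b))
      (fob (vert_func F) f) (fob (vert_func F) g)"
    using map2_hom[of \<alpha> f g] map1_hom[of _ a b] by (auto simp: hom_cat_def vert_func_def hom_iff)
next
  fix \<alpha> \<beta> f g h
  assume "\<alpha> \<in> hom (hom_cat (src F) a b) f g" "\<beta> \<in> hom (hom_cat (src F) a b) g h"
  then show "far (vert_func F) (Cmp (hom_cat (src F) a b) \<beta> \<alpha>)
      = Cmp (hom_cat (tgt F) (map0 F a) (map0 F b)) (far (vert_func F) \<beta>) (far (vert_func F) \<alpha>)"
    using map2_Cmp[of \<alpha> f g \<beta> h] by (auto simp: hom_cat_def vert_func_def hom_iff)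
qed (use map1_hom map2_Idn S.category_hom_cat T.category_hom_cat in
    \<open>auto simp: hom_cat_def vert_func_def hom_iff\<close>)

end

text \<open>Extensionality makes both sides \<open>undefined\<close> off the carriers, so agreement
  on cells gives equality of the records. The category laws and the equations of the adjunction are
  proved this way.\<close>

lemma two_func_eqI:
  assumes F: "two_functor F" and G: "two_functor G" and st: "src F = src G" "tgt F = tgt G"
    and "\<And>a. a \<in> Obj (src F) \<Longrightarrow> map0 F a = map0 G a"
    and "\<And>f. f \<in> Cell1 (src F) \<Longrightarrow> map1 F f = map1 G f"
    and "\<And>\<alpha>. \<alpha> \<in> Cell2 (src F) \<Longrightarrow> map2 F \<alpha> = map2 G \<alpha>"
  shows "F = G"
proof -
  interpret F: two_functor F by (rule F)
  interpret G: two_functor G by (rule G)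
  have "map0 F = map0 G" "map1 F = map1 G" "map2 F = map2 G"
    using assms F.map0_extensional G.map0_extensional F.map1_extensional G.map1_extensional
      F.map2_extensional G.map2_extensional
    by (auto intro: extensionalityI)
  with st show ?thesis by (cases F, cases G) simp
qed

lemma two_functor_id:
  assumes "two_category A"
  shows "two_functor (id_two_func A)"
proof -
  interpret two_category A by (rule assms)
  have 1: "is_functor (Und A) (Und A) (und_func (id_two_func A))"
    by (rule is_functor_cong[OF is_functor_id[OF Und]])
      (auto simp: und_func_def id_two_func_def id_func_def)
  have 2: "is_functor (Vert A) (Vert A) (vert_func (id_two_func A))"
    by (rule is_functor_cong[OF is_functor_id[OF Vert]])
      (auto simp: vert_func_def id_two_func_def id_func_def Ob_Vert)
  have "HCmp A \<beta> \<alpha> \<in> Cell2 A" if "hcomposable A \<beta> \<alpha>" for \<alpha> \<beta>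
    using HCmp_in_hom[OF Ar_in_hom Ar_in_hom that] that by (auto simp: hcomposable_def hom_iff)
  then show ?thesis
    using assms 1 2 by (intro two_functor.intro) (auto simp: id_two_func_def hcomposable_def)
qed

lemma two_functor_comp:
  assumes "two_functor F" "two_functor G" and GF: "tgt F = src G"
  shows "two_functor (comp_two_func G F)"
proof -
  interpret F: two_functor F by (rule assms)
  interpret G: two_functor G by (rule assms)
  have 1: "is_functor (Und (src F)) (Und (tgt G)) (und_func (comp_two_func G F))"
    by (rule is_functor_cong[OF is_functor_comp[OF F.und_func G.und_func[folded GF]]])
      (auto simp: und_func_def comp_two_func_def comp_func_def)
  have 2: "is_functor (Vert (src F)) (Vert (tgt G)) (vert_func (comp_two_func G F))"
    by (rule is_functor_cong[OF is_functor_comp[OF F.vert_func G.vert_func[folded GF]]])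
      (auto simp: vert_func_def comp_two_func_def comp_func_def F.S.Ob_Vert)
  have "HCmp (src F) \<beta> \<alpha> \<in> Cell2 (src F)" if "hcomposable (src F) \<beta> \<alpha>" for \<alpha> \<beta>
    using F.S.HCmp_in_hom[OF Ar_in_hom Ar_in_hom that] that by (auto simp: hcomposable_def hom_iff)
  moreover have "map2 G (map2 F (HCmp (src F) \<beta> \<alpha>))
      = HCmp (tgt G) (map2 G (map2 F \<beta>)) (map2 G (map2 F \<alpha>))"
    if "hcomposable (src F) \<beta> \<alpha>" for \<alpha> \<beta>
    using F.map2_HCmp[OF that] F.hcomposable_map2[OF that] G.map2_HCmp by (simp add: GF)
  ultimately show ?thesis
    using 1 2 F.src G.tgt
    by (intro two_functor.intro) (auto simp: comp_two_func_def hcomposable_def)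
qed

lemma comp_two_func_simps [simp]:
  "src (comp_two_func G F) = src F" "tgt (comp_two_func G F) = tgt G"
  "a \<in> Obj (src F) \<Longrightarrow> map0 (comp_two_func G F) a = map0 G (map0 F a)"
  "f \<in> Cell1 (src F) \<Longrightarrow> map1 (comp_two_func G F) f = map1 G (map1 F f)"
  "\<alpha> \<in> Cell2 (src F) \<Longrightarrow> map2 (comp_two_func G F) \<alpha> = map2 G (map2 F \<alpha>)"
  by (auto simp: comp_two_func_def)

lemma id_two_func_simps [simp]:
  "src (id_two_func A) = A" "tgt (id_two_func A) = A"
  "a \<in> Obj A \<Longrightarrow> map0 (id_two_func A) a = a"
  "f \<in> Cell1 A \<Longrightarrow> map1 (id_two_func A) f = f"
  "\<alpha> \<in> Cell2 A \<Longrightarrow> map2 (id_two_func A) \<alpha> = \<alpha>"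
  by (auto simp: id_two_func_def)

lemma comp_id_two_func:
  assumes "two_functor F"
  shows "comp_two_func (id_two_func (tgt F)) F = F" and "comp_two_func F (id_two_func (src F)) = F"
proof -
  interpret two_functor F by (rule assms)
  show "comp_two_func (id_two_func (tgt F)) F = F"
    using two_functor_comp[OF assms two_functor_id[OF tgt]] assms
    by (intro two_func_eqI) (auto simp: map0_Obj map1_Cell1 map2_Cell2)
  show "comp_two_func F (id_two_func (src F)) = F"
    using two_functor_comp[OF two_functor_id[OF src] assms] assms
    by (intro two_func_eqI) auto
qed

lemma comp_two_func_assoc:
  assumes "two_functor F" "two_functor G" "two_functor H" "tgt F = src G" "tgt G = src H"
  shows "comp_two_func H (comp_two_func G F) = comp_two_func (comp_two_func H G) F"
proof -
  interpret F: two_functor F by (rule assms)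
  have "two_functor (comp_two_func H (comp_two_func G F))"
    "two_functor (comp_two_func (comp_two_func H G) F)"
    using assms by (simp_all add: two_functor_comp)
  then show ?thesis
    using F.map0_Obj F.map1_Cell1 F.map2_Cell2 assms(4)
    by (intro two_func_eqI) auto
qed

section \<open>Morphisms of flexible 2-categories, and the categories \<open>TwoCat\<close> and
  \<open>Flex\<close>\<close>

lemma flexible_functor_two_functor: "flexible_functor F \<Longrightarrow> two_functor F"
  by (simp add: flexible_functor_def)

lemma flexible_functor_id:
  assumes "flexible A"
  shows "flexible_functor (id_two_func A)"
proof -
  have "free_functor (Und A) (Und A) (und_func (id_two_func A))"
    using assms
    by (intro free_functor_cong[OF free_functor_id]) (auto simp: flexible_def und_func_def id_func_def)
  then show ?thesis using assms two_functor_id by (auto simp: flexible_functor_def flexible_def)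
qed

lemma flexible_functor_comp:
  assumes "flexible_functor F" "flexible_functor G" "tgt F = src G"
  shows "flexible_functor (comp_two_func G F)"
proof -
  have "free_functor (Und (src F)) (Und (tgt F)) (und_func F)"
    and "free_functor (Und (tgt F)) (Und (tgt G)) (und_func G)"
    using assms by (auto simp: flexible_functor_def)
  then have "free_functor (Und (src F)) (Und (tgt G)) (und_func (comp_two_func G F))"
    by (rule free_functor_cong[OF free_functor_comp])
      (auto simp: und_func_def comp_func_def)
  then show ?thesis using assms two_functor_comp by (auto simp: flexible_functor_def)
qed

lemma category_TwoCat: "category (TwoCat small)"
  by unfold_locales
    (auto simp: TwoCat_def hom_iff two_functor.src two_functor.tgt two_functor_id two_functor_comp
      comp_id_two_func comp_two_func_assoc)

lemma category_Flex: "category (Flex small)"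
  by unfold_locales
    (auto simp: Flex_def hom_iff flexible_functor_id flexible_functor_comp comp_id_two_func
      comp_two_func_assoc flexible_functor_two_functor, auto simp: flexible_functor_def)

lemma inclusion_functor: "is_functor (Flex small) (TwoCat small) inclusion"
  by (auto simp: is_functor_def category_Flex category_TwoCat)
    (auto simp: inclusion_def Flex_def TwoCat_def hom_iff flexible_def flexible_functor_def)

section \<open>The path 2-category\<close>

lemma path_Tup [simp]:
  "path_src (Tup (a # fs)) = a"
  "path_steps (Tup (a # fs)) = fs"
  "path_concat (Tup (b # gs)) (Tup (a # fs)) = Tup (a # gs @ fs)"
  "path_value A (Tup (a # fs)) = composite (Und A) a fs"
  by (auto simp: path_src_def path_steps_def path_concat_def path_value_def)

lemma cell_Tup [simp]:
  "cell_dom (Tup [p, \<alpha>, q]) = p" "cell_name (Tup [p, \<alpha>, q]) = \<alpha>" "cell_cod (Tup [p, \<alpha>, q]) = q"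
  by (auto simp: cell_dom_def cell_name_def cell_cod_def)

lemma path_two_cat_simps [simp]:
  "Und (path_two_cat A) = path_und A" "Vert (path_two_cat A) = path_vert A"
  "Ob (path_und A) = Obj A" "Ar (path_und A) = path_cells1 A"
  "Ob (path_vert A) = path_cells1 A" "Ar (path_vert A) = path_cells2 A"
  by (auto simp: path_two_cat_def path_und_def path_vert_def)

text \<open>Fixes a type of cells closed under tuples, so that \<open>path_two_cat A\<close> lives
  over the same type as \<open>A\<close>.\<close>

locale cell_two_category = two_category A for A :: "'a cell two_cat"
begin

text \<open>The codomain of a path is defined through its composite, which covers the empty path as
  well; for a well-formed list it is the end \<open>b\<close> given by \<open>is_path\<close>. Paths
  can then be handled as lists.\<close>

lemma hom_path_und:
  "p \<in> hom (path_und A) a b \<longleftrightarrow>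
     (\<exists>fs. p = Tup (a # fs) \<and> is_path (Und A) a fs b \<and> (\<forall>f \<in> set fs. \<not> is_identity (Und A) f))"
proof
  assume "p \<in> hom (path_und A) a b"
  then have p: "p \<in> path_cells1 A" "path_src p = a" and "Cod (Und A) (path_value A p) = b"
    by (auto simp: hom_iff path_und_def)
  moreover from p obtain fs b' where fs: "p = Tup (a # fs)" "is_path (Und A) a fs b'"
      "\<forall>f \<in> set fs. \<not> is_identity (Und A) f"
    by (auto simp: path_cells1_def)
  ultimately have "b' = b" using U.composite_in_hom[OF fs(2)] by (simp add: hom_iff)
  with fs show "\<exists>fs. p = Tup (a # fs) \<and> is_path (Und A) a fs b
      \<and> (\<forall>f \<in> set fs. \<not> is_identity (Und A) f)"
    by blast
next
  assume "\<exists>fs. p = Tup (a # fs) \<and> is_path (Und A) a fs b \<and> (\<forall>f \<in> set fs. \<not> is_identity (Und A) f)"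
  then obtain fs where fs: "p = Tup (a # fs)" "is_path (Und A) a fs b"
      "\<forall>f \<in> set fs. \<not> is_identity (Und A) f"
    by blast
  then have "p \<in> path_cells1 A" by (auto simp: path_cells1_def)
  then show "p \<in> hom (path_und A) a b"
    using fs U.composite_in_hom[OF fs(2)] by (simp add: hom_iff path_und_def)
qed

lemma path_cells1_hom: "p \<in> path_cells1 A \<Longrightarrow> \<exists>a b. p \<in> hom (path_und A) a b"
  by (auto simp: hom_iff)

lemma path_und_hom_cells1: "p \<in> hom (path_und A) a b \<Longrightarrow> p \<in> path_cells1 A"
  by (simp add: hom_iff)

lemma path_value_hom: "p \<in> hom (path_und A) a b \<Longrightarrow> path_value A p \<in> hom (Und A) a b"
  by (auto simp: hom_path_und U.composite_in_hom)

lemma path_value_Cell1: "p \<in> path_cells1 A \<Longrightarrow> path_value A p \<in> Cell1 A"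
  using path_cells1_hom[of p] path_value_hom[of p] by (auto simp: hom_iff)

lemma path_und_Dom: "p \<in> path_cells1 A \<Longrightarrow> Dom (path_und A) p = Dom (Und A) (path_value A p)"
  and path_und_Cod: "p \<in> path_cells1 A \<Longrightarrow> Cod (path_und A) p = Cod (Und A) (path_value A p)"
  and path_src_eq: "p \<in> path_cells1 A \<Longrightarrow> path_src p = Dom (Und A) (path_value A p)"
  using path_cells1_hom[of p] path_value_hom[of p] by (auto simp: hom_iff path_und_def)

text \<open>The ends of a path are those of its composite, so typing questions about paths move to
  \<open>A\<close>.\<close>

lemma path_hom_iff:
  "p \<in> hom (path_und A) a b \<longleftrightarrow> p \<in> path_cells1 A \<and> path_value A p \<in> hom (Und A) a b"
  by (auto simp: hom_iff path_und_Dom path_und_Cod path_value_Cell1)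

lemma path_und_Cmp:
  "\<lbrakk>p \<in> hom (path_und A) a b; q \<in> hom (path_und A) b c\<rbrakk> \<Longrightarrow> Cmp (path_und A) q p = path_concat q p"
  by (auto simp: hom_iff path_und_def)

lemma path_und_Idn: "a \<in> Obj A \<Longrightarrow> Idn (path_und A) a = Tup [a]"
  by (auto simp: path_und_def)

lemma path_concat_hom:
  "\<lbrakk>p \<in> hom (path_und A) a b; q \<in> hom (path_und A) b c\<rbrakk> \<Longrightarrow> path_concat q p \<in> hom (path_und A) a c"
  by (auto simp: hom_path_und U.is_path_append)

lemma path_value_concat:
  "\<lbrakk>p \<in> hom (path_und A) a b; q \<in> hom (path_und A) b c\<rbrakk>
     \<Longrightarrow> path_value A (path_concat q p) = Cmp (Und A) (path_value A q) (path_value A p)"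
  by (auto simp: hom_path_und U.composite_append)

text \<open>Appending lists is strictly associative with the empty list as unit. The recorded source
  tells the empty paths on different objects apart.\<close>

lemma category_path_und: "category (path_und A)"
proof
  fix p a b assume p: "p \<in> hom (path_und A) a b"
  then have "a \<in> Obj A" "b \<in> Obj A" using U.is_path_Ob by (auto simp: hom_path_und)
  moreover have "Tup [a] \<in> hom (path_und A) a a" "Tup [b] \<in> hom (path_und A) b b"
    using calculation by (auto simp: hom_path_und)
  ultimately show "Cmp (path_und A) (Idn (path_und A) b) p = p"
    "Cmp (path_und A) p (Idn (path_und A) a) = p"
    using p by (auto simp: path_und_Cmp[of _ a b _ b] path_und_Cmp[of _ a a _ b] path_und_Idn)
      (auto simp: hom_path_und)
next
  fix p q r a b c d
  assume pqr: "p \<in> hom (path_und A) a b" "q \<in> hom (path_und A) b c" "r \<in> hom (path_und A) c d"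
  have "path_concat r (path_concat q p) = path_concat (path_concat r q) p"
    using pqr by (auto simp: hom_path_und)
  then show "Cmp (path_und A) r (Cmp (path_und A) q p) = Cmp (path_und A) (Cmp (path_und A) r q) p"
    using pqr path_concat_hom[OF pqr(1,2)] path_concat_hom[OF pqr(2,3)]
    by (simp add: path_und_Cmp[of _ a b] path_und_Cmp[of _ b c] path_und_Cmp[of _ a c]
        path_und_Cmp[of _ c d] path_und_Cmp[of _ b d])
next
  fix p assume "p \<in> Ar (path_und A)"
  then have "path_value A p \<in> Cell1 A" by (simp add: path_value_Cell1)
  then show "Dom (path_und A) p \<in> Ob (path_und A)" "Cod (path_und A) p \<in> Ob (path_und A)"
    using \<open>p \<in> Ar (path_und A)\<close> by (auto simp: path_und_Dom path_und_Cod U.Dom_in_Ob U.Cod_in_Ob)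
next
  fix p q a b c assume "p \<in> hom (path_und A) a b" "q \<in> hom (path_und A) b c"
  then show "Cmp (path_und A) q p \<in> hom (path_und A) a c"
    using path_concat_hom path_und_Cmp by metis
qed (auto simp: hom_path_und path_und_Idn)

lemma hom_path_vert:
  "x \<in> hom (path_vert A) p q \<longleftrightarrow>
     (\<exists>\<alpha>. x = Tup [p, \<alpha>, q] \<and> p \<in> path_cells1 A \<and> q \<in> path_cells1 A
        \<and> \<alpha> \<in> hom (Vert A) (path_value A p) (path_value A q))"
  by (auto simp: hom_iff path_vert_def path_cells2_def)

lemma path_cells2E:
  assumes "x \<in> path_cells2 A"
  obtains p \<alpha> q where "x = Tup [p, \<alpha>, q]" "p \<in> path_cells1 A" "q \<in> path_cells1 A"
    "\<alpha> \<in> hom (Vert A) (path_value A p) (path_value A q)"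
  using assms by (auto simp: path_cells2_def)

lemma path_vert_Dom: "Tup [p, \<alpha>, q] \<in> path_cells2 A \<Longrightarrow> Dom (path_vert A) (Tup [p, \<alpha>, q]) = p"
  by (auto simp: path_vert_def)

lemma path_vert_Cmp:
  "\<lbrakk>Tup [p, \<alpha>, q] \<in> hom (path_vert A) p q; Tup [q, \<beta>, r] \<in> hom (path_vert A) q r\<rbrakk>
     \<Longrightarrow> Cmp (path_vert A) (Tup [q, \<beta>, r]) (Tup [p, \<alpha>, q]) = Tup [p, Cmp (Vert A) \<beta> \<alpha>, r]"
  by (auto simp: hom_iff) (simp add: path_vert_def)

lemma path_vert_Idn: "p \<in> path_cells1 A \<Longrightarrow> Idn (path_vert A) p = Tup [p, Idn (Vert A) (path_value A p), p]"
  by (simp add: path_vert_def)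

lemma path_cells2_iff:
  "Tup [p, \<alpha>, q] \<in> path_cells2 A \<longleftrightarrow> Tup [p, \<alpha>, q] \<in> hom (path_vert A) p q"
  unfolding hom_path_vert by (auto simp: path_cells2_def)

lemma path_vert_Cmp_hom:
  assumes "Tup [p, \<alpha>, q] \<in> hom (path_vert A) p q" "Tup [q, \<beta>, r] \<in> hom (path_vert A) q r"
  shows "Tup [p, Cmp (Vert A) \<beta> \<alpha>, r] \<in> hom (path_vert A) p r"
  using assms unfolding hom_path_vert by (auto intro: V.Cmp_in_hom)

lemma category_path_vert: "category (path_vert A)"
proof
  fix x assume "x \<in> Ar (path_vert A)"
  then have "x \<in> path_cells2 A" by simp
  then show "Dom (path_vert A) x \<in> Ob (path_vert A)" "Cod (path_vert A) x \<in> Ob (path_vert A)"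
    by (simp_all add: path_vert_def) (auto elim!: path_cells2E)
next
  fix p assume "p \<in> Ob (path_vert A)"
  then show "Idn (path_vert A) p \<in> hom (path_vert A) p p"
    using V.Idn_in_hom[of "path_value A p"]
    by (auto simp: path_vert_Idn hom_path_vert Ob_Vert path_value_Cell1)
next
  fix x y p q r assume "x \<in> hom (path_vert A) p q" "y \<in> hom (path_vert A) q r"
  moreover from this obtain \<alpha> \<beta> where "x = Tup [p, \<alpha>, q]" "y = Tup [q, \<beta>, r]"
    by (auto simp: hom_path_vert)
  ultimately show "Cmp (path_vert A) y x \<in> hom (path_vert A) p r"
    by (simp add: path_vert_Cmp path_vert_Cmp_hom)
next
  fix x p q assume x: "x \<in> hom (path_vert A) p q"
  then obtain \<alpha> where \<alpha>: "x = Tup [p, \<alpha>, q]" "p \<in> path_cells1 A" "q \<in> path_cells1 A"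
      "\<alpha> \<in> hom (Vert A) (path_value A p) (path_value A q)"
    by (auto simp: hom_path_vert)
  then have "Tup [p, Idn (Vert A) (path_value A p), p] \<in> hom (path_vert A) p p"
    "Tup [q, Idn (Vert A) (path_value A q), q] \<in> hom (path_vert A) q q"
    by (auto simp: hom_path_vert Ob_Vert path_value_Cell1 intro: V.Idn_in_hom)
  with x show "Cmp (path_vert A) (Idn (path_vert A) q) x = x"
    "Cmp (path_vert A) x (Idn (path_vert A) p) = x"
    using \<alpha> by (auto simp: path_vert_Idn path_vert_Cmp V.Cmp_Idn_left V.Cmp_Idn_right)
next
  fix x y z p q r s
  assume xyz: "x \<in> hom (path_vert A) p q" "y \<in> hom (path_vert A) q r" "z \<in> hom (path_vert A) r s"
  then obtain \<alpha> \<beta> \<gamma> where *: "x = Tup [p, \<alpha>, q]" "y = Tup [q, \<beta>, r]" "z = Tup [r, \<gamma>, s]"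
    "\<alpha> \<in> hom (Vert A) (path_value A p) (path_value A q)"
    "\<beta> \<in> hom (Vert A) (path_value A q) (path_value A r)"
    "\<gamma> \<in> hom (Vert A) (path_value A r) (path_value A s)"
    by (auto simp: hom_path_vert)
  show "Cmp (path_vert A) z (Cmp (path_vert A) y x) = Cmp (path_vert A) (Cmp (path_vert A) z y) x"
    using xyz path_vert_Cmp_hom[of p \<alpha> q \<beta> r] path_vert_Cmp_hom[of q \<beta> r \<gamma> s]
    unfolding *(1-3) by (simp add: path_vert_Cmp V.Cmp_assoc[OF *(4-6)])
qed

text \<open>Parallelism of 2-cells in \<open>A\<close> passes to paths, whose ends are those of
  their composites. Typing the source path of a 2-cell thus types its target path.\<close>

lemma path_parallel:
  assumes "\<alpha> \<in> hom (Vert A) (path_value A p) (path_value A q)" "p \<in> path_cells1 A" "q \<in> path_cells1 A"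
    "p \<in> hom (path_und A) a b"
  shows "q \<in> hom (path_und A) a b"
  using assms(2-4) parallel[OF assms(1)] by (auto simp: hom_iff path_und_Dom path_und_Cod)

lemma path_hcomposable_iff:
  assumes "x = Tup [p, \<alpha>, p']" "y = Tup [q, \<beta>, q']"
    "x \<in> path_cells2 A" "y \<in> path_cells2 A"
  shows "hcomposable (path_two_cat A) y x \<longleftrightarrow> Dom (Und A) (path_value A q) = Cod (Und A) (path_value A p)"
  using assms path_cells2_iff[of p \<alpha> p'] path_cells2_iff[of q \<beta> q']
  by (auto simp: hcomposable_def path_vert_Dom hom_path_vert path_und_Dom path_und_Cod)

text \<open>A normal form for horizontally composable pairs: explicit tuples, with all four boundary
  paths typed over common objects. The target paths get their types from
  \<open>path_parallel\<close>.\<close>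

lemma path_hcomposableE:
  assumes "hcomposable (path_two_cat A) y x"
  obtains p \<alpha> p' q \<beta> q' a b c where "x = Tup [p, \<alpha>, p']" "y = Tup [q, \<beta>, q']"
    "\<alpha> \<in> hom (Vert A) (path_value A p) (path_value A p')"
    "\<beta> \<in> hom (Vert A) (path_value A q) (path_value A q')"
    "p \<in> hom (path_und A) a b" "p' \<in> hom (path_und A) a b"
    "q \<in> hom (path_und A) b c" "q' \<in> hom (path_und A) b c"
proof -
  have "x \<in> path_cells2 A" "y \<in> path_cells2 A" using assms by (auto simp: hcomposable_def)
  then obtain p \<alpha> p' q \<beta> q' where x: "x = Tup [p, \<alpha>, p']" "p \<in> path_cells1 A" "p' \<in> path_cells1 A"
      "\<alpha> \<in> hom (Vert A) (path_value A p) (path_value A p')"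
    and y: "y = Tup [q, \<beta>, q']" "q \<in> path_cells1 A" "q' \<in> path_cells1 A"
      "\<beta> \<in> hom (Vert A) (path_value A q) (path_value A q')"
    by (auto elim!: path_cells2E)
  then have eq: "Dom (Und A) (path_value A q) = Cod (Und A) (path_value A p)"
    using assms path_hcomposable_iff \<open>x \<in> path_cells2 A\<close> \<open>y \<in> path_cells2 A\<close> by blast
  let ?a = "Dom (Und A) (path_value A p)" and ?b = "Cod (Und A) (path_value A p)"
    and ?c = "Cod (Und A) (path_value A q)"
  have "p \<in> hom (path_und A) ?a ?b" "q \<in> hom (path_und A) ?b ?c"
    using x(2) y(2) eq by (auto simp: hom_iff path_und_Dom path_und_Cod)
  with x y show ?thesis using that path_parallel by blast
qed

text \<open>The last conclusion types the composite name in the form assumed of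
  \<open>\<alpha>\<close> and \<open>\<beta>\<close>, so the lemma can be applied again to an
  iterated composite, as associativity does.\<close>

lemma path_hcomposableI:
  assumes "p \<in> hom (path_und A) a b" "p' \<in> hom (path_und A) a b"
    "q \<in> hom (path_und A) b c" "q' \<in> hom (path_und A) b c"
    "\<alpha> \<in> hom (Vert A) (path_value A p) (path_value A p')"
    "\<beta> \<in> hom (Vert A) (path_value A q) (path_value A q')"
  shows "hcomposable (path_two_cat A) (Tup [q, \<beta>, q']) (Tup [p, \<alpha>, p'])"
    and "hcomposable A \<beta> \<alpha>"
    and "HCmp (path_two_cat A) (Tup [q, \<beta>, q']) (Tup [p, \<alpha>, p'])
      = Tup [path_concat q p, HCmp A \<beta> \<alpha>, path_concat q' p']"
    and "HCmp A \<beta> \<alpha> \<in> hom (Vert A) (path_value A (path_concat q p)) (path_value A (path_concat q' p'))"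
proof -
  have cells: "p \<in> path_cells1 A" "p' \<in> path_cells1 A" "q \<in> path_cells1 A" "q' \<in> path_cells1 A"
    and eq: "Dom (Und A) (path_value A q) = Cod (Und A) (path_value A p)"
    using assms by (auto simp: hom_iff path_und_Dom path_und_Cod)
  then have cells2: "Tup [p, \<alpha>, p'] \<in> path_cells2 A" "Tup [q, \<beta>, q'] \<in> path_cells2 A"
    using assms by (auto simp: path_cells2_iff hom_path_vert)
  with eq show "hcomposable (path_two_cat A) (Tup [q, \<beta>, q']) (Tup [p, \<alpha>, p'])"
    by (simp add: path_hcomposable_iff)
  show hc: "hcomposable A \<beta> \<alpha>" using hcomposable_iff[OF assms(5,6)] eq by simp
  show "HCmp (path_two_cat A) (Tup [q, \<beta>, q']) (Tup [p, \<alpha>, p'])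
      = Tup [path_concat q p, HCmp A \<beta> \<alpha>, path_concat q' p']"
    using cells cells2 eq by (simp add: path_two_cat_def path_src_eq)
  show "HCmp A \<beta> \<alpha> \<in> hom (Vert A) (path_value A (path_concat q p)) (path_value A (path_concat q' p'))"
    using HCmp_in_hom[OF assms(5,6) hc] path_value_concat[OF assms(1,3)] path_value_concat[OF assms(2,4)]
    by simp
qed

text \<open>Each axiom separates into boundary paths and name. For the paths it is a fact about
  concatenation; for the name it is the same axiom of \<open>A\<close>, because
  \<open>path_value_concat\<close> turns concatenation into composition.\<close>

lemma two_category_path: "two_category (path_two_cat A)"
proof (rule two_category.intro)
  let ?P = "path_two_cat A"
  show "category (Und ?P)" "category (Vert ?P)" "Ob (Vert ?P) = Cell1 ?P"
    by (simp_all add: category_path_und category_path_vert)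
  fix x p q assume x: "x \<in> hom (Vert ?P) p q"
  then obtain \<alpha> where \<alpha>: "x = Tup [p, \<alpha>, q]" "p \<in> path_cells1 A" "q \<in> path_cells1 A"
      "\<alpha> \<in> hom (Vert A) (path_value A p) (path_value A q)"
    by (auto simp: hom_path_vert)
  then show "Dom (Und ?P) p = Dom (Und ?P) q \<and> Cod (Und ?P) p = Cod (Und ?P) q"
    using parallel[OF \<alpha>(4)] by (simp add: path_und_Dom path_und_Cod)
  {
    fix a b assume "p \<in> hom (Und ?P) a b"
    then have p: "p \<in> hom (path_und A) a b" by simp
    then have q: "q \<in> hom (path_und A) a b" using path_parallel \<alpha> by blast
    have pv: "path_value A p \<in> hom (Und A) a b" using path_value_hom[OF p] .
    have Ob: "a \<in> Obj A" "b \<in> Obj A" using U.hom_Ob[OF pv] by auto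
    have I: "Tup [b] \<in> hom (path_und A) b b" "Tup [a] \<in> hom (path_und A) a a"
      using Ob by (auto simp: hom_path_und)
    \<comment> \<open>The empty path \<open>Tup [b]\<close> has composite
      \<open>Idn (Und A) b\<close>; hence its identity 2-cell is named by the 2-cell that occurs in
      the unit laws of \<open>A\<close>.\<close>
    have V: "Idn (Vert A) (Idn (Und A) b) \<in> hom (Vert A) (path_value A (Tup [b])) (path_value A (Tup [b]))"
      "Idn (Vert A) (Idn (Und A) a) \<in> hom (Vert A) (path_value A (Tup [a])) (path_value A (Tup [a]))"
      using Ob by (auto simp: V.Idn_in_hom Ob_Vert U.Ar_Idn)
    have "path_concat (Tup [b]) p = p" "path_concat (Tup [b]) q = q"
      "path_concat p (Tup [a]) = p" "path_concat q (Tup [a]) = q"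
      using p q by (auto simp: hom_path_und)
    then show "HCmp ?P (Idn (Vert ?P) (Idn (Und ?P) b)) x = x"
      and "HCmp ?P x (Idn (Vert ?P) (Idn (Und ?P) a)) = x"
      using path_hcomposableI(3)[OF p q I(1,1) \<alpha>(4) V(1)] path_hcomposableI(3)[OF I(2,2) p q V(2) \<alpha>(4)]
        HCmp_unit_left[OF \<alpha>(4) pv] HCmp_unit_right[OF \<alpha>(4) pv] I Ob
      by (auto simp: \<alpha>(1) path_und_Idn path_vert_Idn path_und_hom_cells1)
  }
  {
    fix y r s assume "y \<in> hom (Vert ?P) r s" and "hcomposable ?P y x"
    then obtain \<beta> a b c where y: "y = Tup [r, \<beta>, s]" "\<beta> \<in> hom (Vert A) (path_value A r) (path_value A s)"
      and h: "p \<in> hom (path_und A) a b" "q \<in> hom (path_und A) a b"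
        "r \<in> hom (path_und A) b c" "s \<in> hom (path_und A) b c"
      using \<alpha>(1) by (auto simp: hom_path_vert elim!: path_hcomposableE)
    note H = path_hcomposableI[OF h \<alpha>(4) y(2)]
    show "HCmp ?P y x \<in> hom (Vert ?P) (Cmp (Und ?P) r p) (Cmp (Und ?P) s q)"
      using H(3,4) path_concat_hom[OF h(1,3)] path_concat_hom[OF h(2,4)]
      by (auto simp: \<alpha>(1) y(1) path_und_Cmp[OF h(1,3)] path_und_Cmp[OF h(2,4)] hom_path_vert
          path_und_hom_cells1)
    fix x' y' q' s' assume "x' \<in> hom (Vert ?P) q q'" "y' \<in> hom (Vert ?P) s s'"
    then obtain \<alpha>' \<beta>' where x': "x' = Tup [q, \<alpha>', q']" "\<alpha>' \<in> hom (Vert A) (path_value A q) (path_value A q')"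
        "q' \<in> path_cells1 A"
      and y': "y' = Tup [s, \<beta>', s']" "\<beta>' \<in> hom (Vert A) (path_value A s) (path_value A s')"
        "s' \<in> path_cells1 A"
      by (auto simp: hom_path_vert)
    have h': "q' \<in> hom (path_und A) a b" "s' \<in> hom (path_und A) b c"
      using path_parallel x' y' h path_und_hom_cells1 by blast+
    note H' = path_hcomposableI[OF h(2) h'(1) h(4) h'(2) x'(2) y'(2)]
    have C: "Cmp (Vert ?P) x' x = Tup [p, Cmp (Vert A) \<alpha>' \<alpha>, q']"
      "Cmp (Vert ?P) y' y = Tup [r, Cmp (Vert A) \<beta>' \<beta>, s']"
      using \<alpha> x' y y' h h' by (auto simp: path_vert_Cmp hom_path_vert path_und_hom_cells1)
    have "Cmp (Vert ?P) (HCmp ?P y' x') (HCmp ?P y x)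
        = Tup [path_concat r p, Cmp (Vert A) (HCmp A \<beta>' \<alpha>') (HCmp A \<beta> \<alpha>), path_concat s' q']"
      unfolding \<alpha>(1) x'(1) y(1) y'(1) H(3) H'(3)
      using H(4) H'(4) path_concat_hom[OF h(1,3)] path_concat_hom[OF h(2,4)] path_concat_hom[OF h']
      by (auto simp: path_vert_Cmp hom_path_vert path_und_hom_cells1)
    then show "HCmp ?P (Cmp (Vert ?P) y' y) (Cmp (Vert ?P) x' x)
        = Cmp (Vert ?P) (HCmp ?P y' x') (HCmp ?P y x)"
      using path_hcomposableI(3)[OF h(1) h'(1) h(3) h'(2) V.Cmp_in_hom[OF \<alpha>(4) x'(2)]
          V.Cmp_in_hom[OF y(2) y'(2)]]
        interchange[OF \<alpha>(4) x'(2) y(2) y'(2) H(2)] unfolding C by simp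
  }
next
  let ?P = "path_two_cat A"
  fix p q a b c assume "p \<in> hom (Und ?P) a b" "q \<in> hom (Und ?P) b c"
  then have h: "p \<in> hom (path_und A) a b" "q \<in> hom (path_und A) b c" by simp_all
  have v: "path_value A p \<in> hom (Und A) a b" "path_value A q \<in> hom (Und A) b c"
    using h by (auto intro: path_value_hom)
  then have "Idn (Vert A) (path_value A p) \<in> hom (Vert A) (path_value A p) (path_value A p)"
    "Idn (Vert A) (path_value A q) \<in> hom (Vert A) (path_value A q) (path_value A q)"
    using h by (auto intro!: V.Idn_in_hom path_value_Cell1 simp: Ob_Vert path_hom_iff)
  then show "HCmp ?P (Idn (Vert ?P) q) (Idn (Vert ?P) p) = Idn (Vert ?P) (Cmp (Und ?P) q p)"
    using h path_concat_hom[OF h] HCmp_Idn[OF v]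
    by (simp add: path_vert_Idn path_und_hom_cells1[OF h(1)] path_und_hom_cells1[OF h(2)]
        path_und_hom_cells1[OF path_concat_hom[OF h]] path_und_Cmp[OF h] path_hcomposableI(3)[of _ a b _ _ c]
        path_value_concat[OF h])
next
  let ?P = "path_two_cat A"
  fix x y z assume xy: "hcomposable ?P y x" and yz: "hcomposable ?P z y"
  obtain p \<alpha> p' q \<beta> q' a b c where x: "x = Tup [p, \<alpha>, p']" "y = Tup [q, \<beta>, q']"
    and c2: "\<alpha> \<in> hom (Vert A) (path_value A p) (path_value A p')"
      "\<beta> \<in> hom (Vert A) (path_value A q) (path_value A q')"
    and h: "p \<in> hom (path_und A) a b" "p' \<in> hom (path_und A) a b"
    "q \<in> hom (path_und A) b c" "q' \<in> hom (path_und A) b c"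
    using path_hcomposableE[OF xy] by metis
  obtain r \<gamma> r' b' c' d where z: "z = Tup [r, \<gamma>, r']"
    and c3: "\<gamma> \<in> hom (Vert A) (path_value A r) (path_value A r')"
    and "q \<in> hom (path_und A) b' c'" "r \<in> hom (path_und A) c' d" "r' \<in> hom (path_und A) c' d"
    using path_hcomposableE[OF yz] x(2) by auto metis
  \<comment> \<open>The middle cell was put in normal form twice; its path \<open>q\<close> forces
    \<open>c'\<close> to be \<open>c\<close>.\<close>
  then have h': "r \<in> hom (path_und A) c d" "r' \<in> hom (path_und A) c d"
    using h(3) by (auto simp: hom_iff)
  note H = path_hcomposableI[OF h c2] and H' = path_hcomposableI[OF h(3,4) h' c2(2) c3]
  have "path_concat r (path_concat q p) = path_concat (path_concat r q) p"
    "path_concat r' (path_concat q' p') = path_concat (path_concat r' q') p'"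
    using h h' by (auto simp: hom_path_und)
  then show "HCmp ?P z (HCmp ?P y x) = HCmp ?P (HCmp ?P z y) x"
    using path_hcomposableI(3)[OF path_concat_hom[OF h(1,3)] path_concat_hom[OF h(2,4)] h' H(4) c3]
      path_hcomposableI(3)[OF h(1,2) path_concat_hom[OF h(3) h'(1)] path_concat_hom[OF h(4) h'(2)] c2(1) H'(4)]
      HCmp_assoc[OF H(2) H'(2)] by (simp add: x z H(3) H'(3))
next
  show "extensional_cat (Und (path_two_cat A))" "extensional_cat (Vert (path_two_cat A))"
    by (auto simp: extensional_cat_def path_two_cat_def path_und_def path_vert_def)
  show "HCmp (path_two_cat A) y x = undefined" if "\<not> hcomposable (path_two_cat A) y x" for y x
  proof -
    \<comment> \<open>The guard of \<open>HCmp\<close> compares \<open>path_src\<close> with the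
      codomain of a composite; on 2-cells this is exactly horizontal composability.\<close>
    have "\<not> (y \<in> path_cells2 A \<and> x \<in> path_cells2 A
        \<and> path_src (cell_dom y) = Cod (Und A) (path_value A (cell_dom x)))"
      using that by (auto elim!: path_cells2E simp: path_src_eq path_cells2_iff hom_path_vert
          path_hcomposable_iff[OF refl refl])
    then show ?thesis by (auto simp: path_two_cat_def)
  qed
qed

end

section \<open>Freeness of the underlying category of paths\<close>

definition path_step :: "'a cell two_cat \<Rightarrow> 'a cell \<Rightarrow> 'a cell" where
  "path_step A f = Tup [Dom (Und A) f, f]"

context cell_two_category
begin

lemma path_step_hom:
  "\<lbrakk>f \<in> hom (Und A) a b; \<not> is_identity (Und A) f\<rbrakk> \<Longrightarrow> path_step A f \<in> hom (path_und A) a b"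
  unfolding hom_path_und by (auto simp: path_step_def hom_iff U.Dom_in_Ob)

lemma path_value_step: "f \<in> Cell1 A \<Longrightarrow> path_value A (path_step A f) = f"
  using U.composite_single by (simp add: path_step_def)

lemma path_identity_iff: "p \<in> path_cells1 A \<Longrightarrow> is_identity (path_und A) p \<longleftrightarrow> path_steps p = []"
  by (auto simp: is_identity_def path_und_Idn dest!: path_cells1_hom)
    (auto simp: hom_path_und path_und_Idn)

text \<open>Lengths add under concatenation and the identities are the empty paths, so atomic means
  of length one.\<close>

lemma atomic_path_und_iff:
  "atomic (path_und A) p \<longleftrightarrow> (\<exists>f \<in> Cell1 A. \<not> is_identity (Und A) f \<and> p = path_step A f)"
proof
  assume p: "atomic (path_und A) p"
  then obtain a b fs where fs: "p = Tup (a # fs)" "is_path (Und A) a fs b"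
      "\<forall>f \<in> set fs. \<not> is_identity (Und A) f"
    using path_cells1_hom[of p] by (auto simp: atomic_def hom_path_und)
  show "\<exists>f \<in> Cell1 A. \<not> is_identity (Und A) f \<and> p = path_step A f"
  proof (cases fs)
    case Nil
    then show ?thesis using p fs path_identity_iff by (auto simp: atomic_def)
  next
    case (Cons f gs)
    then have f: "path_step A f \<in> hom (path_und A) (Dom (Und A) f) b"
      using fs by (intro path_step_hom) (auto simp: hom_iff)
    have gs: "Tup (a # gs) \<in> hom (path_und A) a (Dom (Und A) f)"
      using fs Cons by (auto simp: hom_path_und)
    \<comment> \<open>Splitting off the outermost step leaves a factor that atomicity forces to be
      an identity, that is, empty.\<close>
    have "p = Cmp (path_und A) (path_step A f) (Tup (a # gs))"
      using fs(1) Cons by (simp add: path_und_Cmp[OF gs f]) (simp add: path_step_def)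
    moreover have "\<not> is_identity (path_und A) (path_step A f)"
      using f path_identity_iff by (auto simp: path_und_hom_cells1 path_step_def)
    ultimately have "is_identity (path_und A) (Tup (a # gs))"
      using p atomic_Cmp[OF _ gs f] by metis
    then have "gs = []" using path_identity_iff gs path_und_hom_cells1 by fastforce
    then show ?thesis using fs Cons by (auto simp: path_step_def)
  qed
next
  assume "\<exists>f \<in> Cell1 A. \<not> is_identity (Und A) f \<and> p = path_step A f"
  then obtain f where f: "f \<in> Cell1 A" "\<not> is_identity (Und A) f" and p: "p = path_step A f"
    by blast
  then have ph: "p \<in> path_cells1 A" using path_step_hom[OF Ar_in_hom] path_und_hom_cells1 by blast
  have "is_identity (path_und A) q \<or> is_identity (path_und A) r"
    if "q \<in> path_cells1 A" "r \<in> path_cells1 A" "Cod (path_und A) q = Dom (path_und A) r"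
      "p = Cmp (path_und A) r q" for q r
  proof -
    have "q \<in> hom (path_und A) (Dom (path_und A) q) (Cod (path_und A) q)"
      "r \<in> hom (path_und A) (Cod (path_und A) q) (Cod (path_und A) r)"
      using that by (auto simp: hom_iff)
    then have "p = path_concat r q" using path_und_Cmp that(4) by metis
    then have "path_steps r @ path_steps q = [f]" by (simp add: p path_step_def path_concat_def)
    then show ?thesis using path_identity_iff that(1,2) by (auto simp: append_eq_Cons_conv)
  qed
  moreover have "\<not> is_identity (path_und A) p"
    using path_identity_iff[OF ph] by (simp add: p path_step_def)
  ultimately show "atomic (path_und A) p"
    using ph by (auto simp: atomic_def)
qed

text \<open>The existence half of freeness: a path is the composite of its one-step paths.\<close>

lemma path_steps_decomposition:
  assumes "is_path (Und A) a fs b" "\<forall>f \<in> set fs. \<not> is_identity (Und A) f"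
  shows "is_path (path_und A) a (map (path_step A) fs) b"
    and "composite (path_und A) a (map (path_step A) fs) = Tup (a # fs)"
proof -
  have "is_path (path_und A) a (map (path_step A) fs) b
      \<and> composite (path_und A) a (map (path_step A) fs) = Tup (a # fs)"
    using assms
  proof (induction fs arbitrary: b)
    case Nil
    then show ?case by (auto simp: path_und_Idn)
  next
    case (Cons f fs)
    then have f: "path_step A f \<in> hom (path_und A) (Dom (Und A) f) b"
      by (intro path_step_hom) (auto simp: hom_iff)
    have fs: "Tup (a # fs) \<in> hom (path_und A) a (Dom (Und A) f)"
      using Cons.prems by (auto simp: hom_path_und)
    have "Cmp (path_und A) (path_step A f) (Tup (a # fs)) = Tup (a # f # fs)"
      unfolding path_und_Cmp[OF fs f] by (simp add: path_step_def)
    with Cons f show ?case by (auto simp: hom_iff)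
  qed
  then show "is_path (path_und A) a (map (path_step A) fs) b"
    and "composite (path_und A) a (map (path_step A) fs) = Tup (a # fs)" by auto
qed

text \<open>Towards the uniqueness half: a path of atomic arrows comes from a path \<open>fs\<close>
  in \<open>A\<close>. By \<open>path_steps_decomposition\<close> its composite displays
  \<open>fs\<close>, so the composite determines the atoms.\<close>

lemma atomic_path_steps:
  assumes "is_path (path_und A) a ps b" "\<forall>p \<in> set ps. atomic (path_und A) p"
  shows "\<exists>fs. ps = map (path_step A) fs \<and> is_path (Und A) a fs b \<and> (\<forall>f \<in> set fs. \<not> is_identity (Und A) f)"
  using assms
proof (induction ps arbitrary: b)
  case (Cons p ps)
  then obtain f where f: "f \<in> Cell1 A" "\<not> is_identity (Und A) f" "p = path_step A f"
    by (auto simp: atomic_path_und_iff)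
  have "p \<in> hom (path_und A) (Dom (Und A) f) (Cod (Und A) f)"
    unfolding f(3) using f by (intro path_step_hom Ar_in_hom)
  then have "Dom (path_und A) p = Dom (Und A) f" "Cod (Und A) f = b"
    using Cons.prems by (auto simp: hom_iff)
  moreover from this obtain fs where "ps = map (path_step A) fs" "is_path (Und A) a fs (Dom (Und A) f)"
      "\<forall>f \<in> set fs. \<not> is_identity (Und A) f"
    using Cons by force
  ultimately show ?case using f by (intro exI[of _ "f # fs"]) auto
qed auto

lemma free_category_path_und: "free_category (path_und A)"
  unfolding free_category_def
proof (intro conjI ballI category_path_und)
  fix p assume "p \<in> Ar (path_und A)"
  then obtain a b where p: "p \<in> hom (path_und A) a b" using path_cells1_hom[of p] by auto
  then obtain fs where fs: "p = Tup (a # fs)" "is_path (Und A) a fs b"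
      "\<forall>f \<in> set fs. \<not> is_identity (Und A) f"
    by (auto simp: hom_path_und)
  have ab: "Dom (path_und A) p = a" "Cod (path_und A) p = b" using p by (auto simp: hom_iff)
  show "\<exists>!ps. atomic_decomposition (path_und A) p ps"
  proof
    show "atomic_decomposition (path_und A) p (map (path_step A) fs)"
      unfolding atomic_decomposition_def ab
      using path_steps_decomposition[OF fs(2,3)] fs U.is_path_Ar[OF fs(2)]
      by (auto simp: atomic_path_und_iff)
    fix ps assume "atomic_decomposition (path_und A) p ps"
    then have ps: "is_path (path_und A) a ps b" "\<forall>q \<in> set ps. atomic (path_und A) q"
      and c: "composite (path_und A) a ps = p"
      by (auto simp: atomic_decomposition_def ab)
    obtain gs where gs: "ps = map (path_step A) gs" "is_path (Und A) a gs b"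
        "\<forall>f \<in> set gs. \<not> is_identity (Und A) f"
      using atomic_path_steps[OF ps] by blast
    then have "Tup (a # gs) = Tup (a # fs)" using path_steps_decomposition(2)[OF gs(2,3)] c fs(1) by simp
    then show "ps = map (path_step A) fs" using gs(1) by simp
  qed
qed

lemma flexible_path: "flexible (path_two_cat A)"
  by (simp add: flexible_def two_category_path free_category_path_und)

text \<open>Needed for the second triangle identity, where the unit is taken at a path
  2-category.\<close>

lemma atoms_path_und:
  assumes "p \<in> path_cells1 A"
  shows "atoms (path_und A) p = map (path_step A) (path_steps p)"
proof -
  obtain a b fs where fs: "p = Tup (a # fs)" "is_path (Und A) a fs b"
      "\<forall>f \<in> set fs. \<not> is_identity (Und A) f"
    using path_cells1_hom[OF assms] by (auto simp: hom_path_und)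
  have "atomic (path_und A) q" if "q \<in> set (map (path_step A) fs)" for q
    using that fs(3) U.is_path_Ar[OF fs(2)] by (auto simp: atomic_path_und_iff)
  then have "atoms (path_und A) (composite (path_und A) a (map (path_step A) fs)) = map (path_step A) fs"
    using atoms_composite[OF free_category_path_und path_steps_decomposition(1)[OF fs(2,3)]] by blast
  then show ?thesis using path_steps_decomposition(2)[OF fs(2,3)] fs(1) by simp
qed

end

section \<open>Smallness of the path 2-category\<close>

context size_universe
begin

text \<open>Unions are available over a small index set in the same type, so two members of an
  infinite small set serve as indices.\<close>

lemma small_Un:
  assumes "small X" "small Y"
  shows "small (X \<union> Y)"
proof -
  obtain I where I: "small I" "infinite I" using small_infinite by blast
  then obtain i j where "i \<in> I" "j \<in> I" "i \<noteq> j"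
    by (metis finite.emptyI finite.insertI finite_subset insertI1 subsetI subset_singletonD)
  \<comment> \<open>Every index other than \<open>i\<close> contributes \<open>Y\<close>;
    \<open>j\<close> guarantees that there is one.\<close>
  then have "X \<union> Y \<subseteq> (\<Union>k \<in> I. if k = i then X else Y)" by auto
  moreover have "small (\<Union>k \<in> I. if k = i then X else Y)" using assms I by (intro small_Union) auto
  ultimately show ?thesis using small_subset by blast
qed

end

text \<open>Tuples are sorted by length. Each length is a small union over the first entry, and the
  lengths are indexed by a copy of the natural numbers inside an infinite small set.\<close>

lemma small_tuples:
  fixes small :: "'a cell set \<Rightarrow> bool"
  assumes "size_universe small" and X: "small X"
  shows "small {Tup xs | xs. set xs \<subseteq> X}"
proof -
  interpret size_universe small by (rule assms)
  obtain I where I: "small I" "infinite I" using small_infinite by blast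
  then obtain e :: "nat \<Rightarrow> 'a cell" where e: "inj e" "range e \<subseteq> I"
    using infinite_countable_subset by blast
  let ?L = "\<lambda>n. {Tup xs | xs. length xs = n \<and> set xs \<subseteq> X}"
  have L: "small (?L n)" for n
  proof (induction n)
    case 0
    \<comment> \<open>The only tuple of length 0 is the value of a constant map on the nonempty
      small set \<open>I\<close>.\<close>
    have "?L 0 \<subseteq> (\<lambda>_. Tup []) ` I" using I(2) by (cases "I = {}") auto
    then show ?case using small_image[OF I(1)] small_subset by blast
  next
    case (Suc n)
    have "?L (Suc n) \<subseteq> (\<Union>x \<in> X. (\<lambda>t. Tup (x # untup t)) ` ?L n)"
    proof
      fix t assume "t \<in> ?L (Suc n)"
      then obtain x xs where "t = Tup (x # xs)" "length xs = n" "x \<in> X" "set xs \<subseteq> X"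
        by (auto simp: length_Suc_conv)
      then show "t \<in> (\<Union>x \<in> X. (\<lambda>t. Tup (x # untup t)) ` ?L n)"
        by (intro UN_I[of x] image_eqI[of _ _ "Tup xs"]) auto
    qed
    moreover have "small (\<Union>x \<in> X. (\<lambda>t. Tup (x # untup t)) ` ?L n)"
      using X Suc by (intro small_Union small_image)
    ultimately show ?case using small_subset by blast
  qed
  \<comment> \<open>A tuple is found at the point of \<open>I\<close> that codes its length; points
    outside the range of \<open>e\<close> decode to some length and do no harm.\<close>
  have "t \<in> (\<Union>i \<in> I. ?L (inv e i))" if t: "t \<in> {Tup xs | xs. set xs \<subseteq> X}" for t
  proof -
    obtain xs where "t = Tup xs" "set xs \<subseteq> X" using t by blast
    then show ?thesis using e by (intro UN_I[of "e (length xs)"]) auto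
  qed
  moreover have "small (\<Union>i \<in> I. ?L (inv e i))" using I(1) L by (rule small_Union)
  ultimately show ?thesis using small_subset by blast
qed

text \<open>Paths are tuples of objects and 1-cells, and the 2-cells are tuples of paths and 2-cells
  of \<open>A\<close>, so \<open>small_tuples\<close> is used twice.\<close>

lemma (in cell_two_category) small_path:
  assumes "size_universe small" and small: "small_two_cat small A"
  shows "small_two_cat small (path_two_cat A)"
proof -
  interpret size_universe small by (rule assms)
  have s: "small (Obj A)" "small (Cell1 A)" "small (Cell2 A)"
    using small by (auto simp: small_two_cat_def)
  have "path_cells1 A \<subseteq> {Tup xs | xs. set xs \<subseteq> Obj A \<union> Cell1 A}"
    using U.is_path_Ar U.is_path_Ob by (fastforce simp: path_cells1_def)
  then have s1: "small (path_cells1 A)"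
    using small_tuples[OF assms(1) small_Un[OF s(1,2)]] small_subset by blast
  have "path_cells2 A \<subseteq> {Tup xs | xs. set xs \<subseteq> path_cells1 A \<union> Cell2 A}"
    by (fastforce simp: path_cells2_def hom_iff)
  then have "small (path_cells2 A)"
    using small_tuples[OF assms(1) small_Un[OF s1 s(3)]] small_subset by blast
  then show ?thesis using s s1 by (simp add: small_two_cat_def)
qed


section \<open>The path functor\<close>

locale cell_two_functor = two_functor F for F :: "'a cell two_func"
begin

sublocale PS: cell_two_category "src F" by unfold_locales
sublocale PT: cell_two_category "tgt F" by unfold_locales

lemma path_two_func_simps [simp]:
  "src (path_two_func F) = path_two_cat (src F)"
  "tgt (path_two_func F) = path_two_cat (tgt F)"
  "map0 (path_two_func F) = map0 F"
  "p \<in> path_cells1 (src F) \<Longrightarrow> map1 (path_two_func F) p = map_path F p"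
  "Tup [p, \<alpha>, q] \<in> path_cells2 (src F)
     \<Longrightarrow> map2 (path_two_func F) (Tup [p, \<alpha>, q]) = Tup [map_path F p, map2 F \<alpha>, map_path F q]"
  by (auto simp: path_two_func_def)

text \<open>Applying \<open>F\<close> stepwise gives a path whose composite is the image of the
  composite; deleting identities then changes neither ends nor composite. The second conclusion is
  naturality of the counit on 1-cells.\<close>

lemma map_path_hom:
  assumes "p \<in> hom (path_und (src F)) a b"
  shows "map_path F p \<in> hom (path_und (tgt F)) (map0 F a) (map0 F b)"
    and "path_value (tgt F) (map_path F p) = map1 F (path_value (src F) p)"
proof -
  obtain fs where fs: "p = Tup (a # fs)" "is_path (Und (src F)) a fs b"
    using assms by (auto simp: PS.hom_path_und)
  then have "is_path (Und (tgt F)) (map0 F a) (map (map1 F) fs) (map0 F b)"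
    and "composite (Und (tgt F)) (map0 F a) (map (map1 F) fs) = map1 F (path_value (src F) p)"
    using functor_path[OF und_func fs(2)] functor_composite[OF und_func fs(2)]
    by (auto simp: und_func_def)
  then show "map_path F p \<in> hom (path_und (tgt F)) (map0 F a) (map0 F b)"
    "path_value (tgt F) (map_path F p) = map1 F (path_value (src F) p)"
    using T.U.is_path_filter_nonidentity T.U.composite_filter_nonidentity fs(1)
    by (auto simp: map_path_def PT.hom_path_und)
qed

lemma map_path_cells1:
  assumes "p \<in> path_cells1 (src F)"
  shows "map_path F p \<in> path_cells1 (tgt F)"
    and "path_value (tgt F) (map_path F p) = map1 F (path_value (src F) p)"
  using PS.path_cells1_hom[OF assms] map_path_hom PT.path_und_hom_cells1 by blast+

lemma map_path_concat: "map_path F (path_concat q p) = path_concat (map_path F q) (map_path F p)"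
  by (simp add: map_path_def path_concat_def path_src_def path_steps_def)

lemma map_path_Idn: "map_path F (Tup [a]) = Tup [map0 F a]"
  by (simp add: map_path_def)

lemma map2_path_hom:
  assumes "Tup [p, \<alpha>, q] \<in> hom (path_vert (src F)) p q"
  shows "Tup [map_path F p, map2 F \<alpha>, map_path F q]
    \<in> hom (path_vert (tgt F)) (map_path F p) (map_path F q)"
  using assms unfolding PS.hom_path_vert PT.hom_path_vert
  by (auto simp: map_path_cells1 map2_hom)

text \<open>The laws hold on boundary paths because \<open>map_path\<close> respects concatenation
  and empty paths, and on names because \<open>F\<close> is a 2-functor. The two fit together since
  the value of a mapped path is the image of its value.\<close>

lemma two_functor_path: "two_functor (path_two_func F)"
proof (rule two_functor.intro)
  have "is_functor (path_und (src F)) (path_und (tgt F)) (und_func (path_two_func F))"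
  proof (rule is_functorI)
    fix p q a b c assume pq: "p \<in> hom (path_und (src F)) a b" "q \<in> hom (path_und (src F)) b c"
    show "far (und_func (path_two_func F)) (Cmp (path_und (src F)) q p)
        = Cmp (path_und (tgt F)) (far (und_func (path_two_func F)) q) (far (und_func (path_two_func F)) p)"
      using pq PS.path_und_hom_cells1 PS.path_concat_hom[OF pq]
      by (simp add: und_func_def PS.path_und_Cmp[OF pq] map_path_concat
          PT.path_und_Cmp[OF map_path_hom(1) map_path_hom(1)])
  next
    fix a assume "a \<in> Ob (path_und (src F))"
    moreover from this have "Tup [a] \<in> path_cells1 (src F)"
      using PS.path_und_hom_cells1[of _ a a] by (auto simp: PS.hom_path_und)
    ultimately show "far (und_func (path_two_func F)) (Idn (path_und (src F)) a)
        = Idn (path_und (tgt F)) (fob (und_func (path_two_func F)) a)"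
      by (simp add: und_func_def PS.path_und_Idn PT.path_und_Idn map0_Obj map_path_Idn)
  qed (auto simp: und_func_def PS.category_path_und PT.category_path_und map0_Obj map_path_hom
      PS.path_und_hom_cells1)
  then show "is_functor (Und (src (path_two_func F))) (Und (tgt (path_two_func F)))
      (und_func (path_two_func F))"
    by simp
  have "is_functor (path_vert (src F)) (path_vert (tgt F)) (vert_func (path_two_func F))"
  proof (rule is_functorI)
    fix x p q assume x: "x \<in> hom (path_vert (src F)) p q"
    then obtain \<alpha> where "x = Tup [p, \<alpha>, q]" by (auto simp: PS.hom_path_vert)
    moreover from this x have "p \<in> path_cells1 (src F)" "q \<in> path_cells1 (src F)"
      by (auto simp: PS.hom_path_vert)
    ultimately show "far (vert_func (path_two_func F)) x \<in> hom (path_vert (tgt F))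
        (fob (vert_func (path_two_func F)) p) (fob (vert_func (path_two_func F)) q)"
      using x map2_path_hom[of p \<alpha> q] by (simp add: vert_func_def PS.path_cells2_iff)
  next
    fix x y p q r assume xy: "x \<in> hom (path_vert (src F)) p q" "y \<in> hom (path_vert (src F)) q r"
    then obtain \<alpha> \<beta> where e: "x = Tup [p, \<alpha>, q]" "y = Tup [q, \<beta>, r]"
      and h: "\<alpha> \<in> hom (Vert (src F)) (path_value (src F) p) (path_value (src F) q)"
        "\<beta> \<in> hom (Vert (src F)) (path_value (src F) q) (path_value (src F) r)"
      by (auto simp: PS.hom_path_vert)
    show "far (vert_func (path_two_func F)) (Cmp (path_vert (src F)) y x)
        = Cmp (path_vert (tgt F)) (far (vert_func (path_two_func F)) y) (far (vert_func (path_two_func F)) x)"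
      using xy PS.path_vert_Cmp_hom[of p \<alpha> q \<beta> r] map2_path_hom[of p \<alpha> q] map2_path_hom[of q \<beta> r]
      unfolding e
      by (simp add: vert_func_def PS.path_vert_Cmp PT.path_vert_Cmp PS.path_cells2_iff map2_Cmp[OF h])
  next
    fix p assume p: "p \<in> Ob (path_vert (src F))"
    then have "Tup [p, Idn (Vert (src F)) (path_value (src F) p), p] \<in> path_cells2 (src F)"
      by (auto simp: PS.path_cells2_iff PS.hom_path_vert S.Ob_Vert PS.path_value_Cell1
          intro!: S.V.Idn_in_hom)
    with p show "far (vert_func (path_two_func F)) (Idn (path_vert (src F)) p)
        = Idn (path_vert (tgt F)) (fob (vert_func (path_two_func F)) p)"
      by (simp add: vert_func_def PS.path_vert_Idn PT.path_vert_Idn map_path_cells1 map2_Idn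
          PS.path_value_Cell1)
  qed (auto simp: vert_func_def PS.category_path_vert PT.category_path_vert map_path_cells1)
  then show "is_functor (Vert (src (path_two_func F))) (Vert (tgt (path_two_func F)))
      (vert_func (path_two_func F))"
    by simp
  fix y x assume "hcomposable (src (path_two_func F)) y x"
  then have "hcomposable (path_two_cat (src F)) y x" by simp
  then obtain p \<alpha> p' q \<beta> q' a b c where e: "x = Tup [p, \<alpha>, p']" "y = Tup [q, \<beta>, q']"
    and c2: "\<alpha> \<in> hom (Vert (src F)) (path_value (src F) p) (path_value (src F) p')"
      "\<beta> \<in> hom (Vert (src F)) (path_value (src F) q) (path_value (src F) q')"
    and h: "p \<in> hom (path_und (src F)) a b" "p' \<in> hom (path_und (src F)) a b"
      "q \<in> hom (path_und (src F)) b c" "q' \<in> hom (path_und (src F)) b c"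
    by (rule PS.path_hcomposableE)
  note H = PS.path_hcomposableI[OF h c2]
  have "map2 F \<alpha> \<in> hom (Vert (tgt F)) (path_value (tgt F) (map_path F p)) (path_value (tgt F) (map_path F p'))"
    "map2 F \<beta> \<in> hom (Vert (tgt F)) (path_value (tgt F) (map_path F q)) (path_value (tgt F) (map_path F q'))"
    using map2_hom[OF c2(1)] map2_hom[OF c2(2)] h by (simp_all add: map_path_hom(2))
  note H' = PT.path_hcomposableI[OF map_path_hom(1)[OF h(1)] map_path_hom(1)[OF h(2)]
      map_path_hom(1)[OF h(3)] map_path_hom(1)[OF h(4)] this]
  have "Tup [path_concat q p, HCmp (src F) \<beta> \<alpha>, path_concat q' p'] \<in> path_cells2 (src F)"
    using H(4) PS.path_concat_hom[OF h(1,3)] PS.path_concat_hom[OF h(2,4)]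
    by (auto simp: PS.path_cells2_iff PS.hom_path_vert PS.path_und_hom_cells1)
  moreover have "x \<in> path_cells2 (src F)" "y \<in> path_cells2 (src F)"
    using \<open>hcomposable (path_two_cat (src F)) y x\<close> by (auto simp: hcomposable_def)
  ultimately show "map2 (path_two_func F) (HCmp (src (path_two_func F)) y x)
      = HCmp (tgt (path_two_func F)) (map2 (path_two_func F) y) (map2 (path_two_func F) x)"
    unfolding e by (simp add: H(3) H'(3) map2_HCmp[OF H(2)] map_path_concat)
qed (use map0_extensional in \<open>auto simp: PS.two_category_path PT.two_category_path path_two_func_def\<close>)

lemma map_path_step:
  assumes "f \<in> Cell1 (src F)"
  shows "map_path F (path_step (src F) f) =
    (if is_identity (Und (tgt F)) (map1 F f) then Tup [map0 F (Dom (Und (src F)) f)]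
     else path_step (tgt F) (map1 F f))"
  using assms by (simp add: path_step_def map_path_def Dom_map1)

text \<open>An atomic arrow is a one-step path; its image is again one step, or is empty if the step
  becomes an identity. \<open>free_functor\<close> allows both.\<close>

lemma flexible_functor_path: "flexible_functor (path_two_func F)"
proof -
  have "atomic (path_und (tgt F)) (map_path F p) \<or> is_identity (path_und (tgt F)) (map_path F p)"
    if "atomic (path_und (src F)) p" for p
  proof -
    obtain f where f: "f \<in> Cell1 (src F)" "p = path_step (src F) f"
      using \<open>atomic (path_und (src F)) p\<close> by (auto simp: PS.atomic_path_und_iff)
    have "p \<in> path_cells1 (src F)" using atomic_Ar[OF that] by simp
    then have "map_path F p \<in> path_cells1 (tgt F)" by (rule map_path_cells1)
    then show ?thesis using f map_path_step[OF f(1)] map1_Cell1[OF f(1)]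
      by (auto simp: PT.atomic_path_und_iff PT.path_identity_iff)
  qed
  then show ?thesis
    using two_functor_path two_functor.und_func[OF two_functor_path] PS.flexible_path PT.flexible_path
    by (simp add: flexible_functor_def free_functor_def PS.free_category_path_und
        PT.free_category_path_und und_func_def)
qed

end

section \<open>Functoriality of the path construction\<close>

lemma (in cell_two_category) path_two_func_id:
  "path_two_func (id_two_func A) = id_two_func (path_two_cat A)"
proof -
  interpret F: cell_two_functor "id_two_func A"
    using two_functor_id[OF two_category_axioms] by (rule cell_two_functor.intro)
  have p: "map_path (id_two_func A) p = p" if p: "p \<in> path_cells1 A" for p
  proof -
    obtain a b fs where fs: "p = Tup (a # fs)" "is_path (Und A) a fs b"
        "\<forall>f \<in> set fs. \<not> is_identity (Und A) f"
      using path_cells1_hom[OF p] by (auto simp: hom_path_und)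
    then have "map (map1 (id_two_func A)) fs = fs" "a \<in> Obj A"
      using U.is_path_Ar[OF fs(2)] U.is_path_Ob[OF fs(2)] by (auto intro: map_idI)
    \<comment> \<open>The steps of a path are non-identities, so the filter in
      \<open>map_path\<close> removes nothing.\<close>
    then show ?thesis using fs by (simp add: map_path_def)
  qed
  show ?thesis
  proof (rule two_func_eqI[OF F.two_functor_path two_functor_id[OF two_category_path]])
    fix x assume "x \<in> Cell2 (src (path_two_func (id_two_func A)))"
    then have x: "x \<in> path_cells2 A" by simp
    then obtain q \<alpha> r where "x = Tup [q, \<alpha>, r]" "q \<in> path_cells1 A" "r \<in> path_cells1 A"
        "\<alpha> \<in> Cell2 A"
      by (auto simp: hom_iff elim!: path_cells2E)
    then show "map2 (path_two_func (id_two_func A)) x = map2 (id_two_func (path_two_cat A)) x"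
      using x by (simp add: p)
  qed (auto simp: p)
qed

lemma path_two_func_comp:
  fixes F G :: "'a cell two_func"
  assumes "two_functor F" "two_functor G" and GF: "tgt F = src G"
  shows "path_two_func (comp_two_func G F) = comp_two_func (path_two_func G) (path_two_func F)"
proof -
  interpret F: cell_two_functor F using assms(1) by (rule cell_two_functor.intro)
  interpret G: cell_two_functor G using assms(2) by (rule cell_two_functor.intro)
  interpret GF: cell_two_functor "comp_two_func G F"
    using two_functor_comp[OF assms] by (rule cell_two_functor.intro)
  \<comment> \<open>Deleting identities after \<open>F\<close> and again after \<open>G\<close> has
    the same effect as deleting once at the end, since \<open>G\<close> sends identities to
    identities.\<close>
  have steps: "filter (\<lambda>g. \<not> is_identity (Und (tgt G)) g) (map (map1 (comp_two_func G F)) fs)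
      = filter (\<lambda>g. \<not> is_identity (Und (tgt G)) g)
          (map (map1 G) (filter (\<lambda>g. \<not> is_identity (Und (tgt F)) g) (map (map1 F) fs)))"
    if "set fs \<subseteq> Cell1 (src F)" for fs
    using that functor_identity[OF G.und_func]
    by (induction fs) (auto simp: GF und_func_def)
  have p: "map_path (comp_two_func G F) p = map_path G (map_path F p)" if p: "p \<in> path_cells1 (src F)" for p
  proof -
    obtain a b fs where fs: "p = Tup (a # fs)" "is_path (Und (src F)) a fs b"
      using F.PS.path_cells1_hom[OF p] by (auto simp: F.PS.hom_path_und)
    then have "set fs \<subseteq> Cell1 (src F)" "a \<in> Obj (src F)"
      using F.S.U.is_path_Ar[OF fs(2)] F.S.U.is_path_Ob[OF fs(2)] by auto
    then show ?thesis using fs steps by (simp add: map_path_def del: filter_map)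
  qed
  have "two_functor (comp_two_func (path_two_func G) (path_two_func F))"
    using two_functor_comp[OF F.two_functor_path G.two_functor_path] by (simp add: GF)
  with GF.two_functor_path show ?thesis
  proof (rule two_func_eqI)
    fix q assume "q \<in> Cell1 (src (path_two_func (comp_two_func G F)))"
    then show "map1 (path_two_func (comp_two_func G F)) q
        = map1 (comp_two_func (path_two_func G) (path_two_func F)) q"
      using F.map_path_cells1(1)[of q] by (simp add: p GF)
  next
    fix x assume "x \<in> Cell2 (src (path_two_func (comp_two_func G F)))"
    then have x: "x \<in> path_cells2 (src F)" by simp
    then obtain q \<alpha> r where e: "x = Tup [q, \<alpha>, r]" "q \<in> path_cells1 (src F)" "r \<in> path_cells1 (src F)"
        "\<alpha> \<in> Cell2 (src F)"
      by (auto simp: hom_iff elim!: F.PS.path_cells2E)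
    moreover have "Tup [map_path F q, map2 F \<alpha>, map_path F r] \<in> path_cells2 (src G)"
      using x F.map2_path_hom[of q \<alpha> r] unfolding e by (simp add: F.PS.path_cells2_iff G.PS.path_cells2_iff GF)
    ultimately show "map2 (path_two_func (comp_two_func G F)) x
        = map2 (comp_two_func (path_two_func G) (path_two_func F)) x"
      using x by (simp add: p)
  qed auto
qed

lemma path_functor_is_functor:
  fixes small :: "'a cell set \<Rightarrow> bool"
  assumes "size_universe small"
  shows "is_functor (TwoCat small) (Flex small) path_functor"
proof -
  have 1: "flexible (path_two_cat A) \<and> small_two_cat small (path_two_cat A)"
    if "two_category A" "small_two_cat small A" for A :: "'a cell two_cat"
  proof -
    interpret cell_two_category A using that(1) by (rule cell_two_category.intro)
    show ?thesis using flexible_path small_path[OF assms that(2)] by blast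
  qed
  have 2: "flexible_functor (path_two_func F)"
    "src (path_two_func F) = path_two_cat (src F)" "tgt (path_two_func F) = path_two_cat (tgt F)"
    if "two_functor F" for F :: "'a cell two_func"
  proof -
    interpret cell_two_functor F using that by (rule cell_two_functor.intro)
    show "flexible_functor (path_two_func F)" by (rule flexible_functor_path)
  qed (simp_all add: path_two_func_def)
  have 3: "path_two_func (id_two_func A) = id_two_func (path_two_cat A)"
    if "two_category A" for A :: "'a cell two_cat"
    using cell_two_category.path_two_func_id[OF cell_two_category.intro[OF that]] .
  show ?thesis
    by (rule is_functorI[OF category_TwoCat category_Flex])
      (auto simp: path_functor_def TwoCat_def Flex_def hom_iff 1 2 3 path_two_func_comp
        two_functor.src two_functor.tgt)
qed


section \<open>The counit and the unit\<close>

lemma path_counit_simps [simp]: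
  "src (path_counit A) = path_two_cat A" "tgt (path_counit A) = A"
  "a \<in> Obj A \<Longrightarrow> map0 (path_counit A) a = a"
  "p \<in> path_cells1 A \<Longrightarrow> map1 (path_counit A) p = path_value A p"
  "x \<in> path_cells2 A \<Longrightarrow> map2 (path_counit A) x = cell_name x"
  by (auto simp: path_counit_def)

lemma path_unit_simps [simp]:
  "src (path_unit A) = A" "tgt (path_unit A) = path_two_cat A"
  "a \<in> Obj A \<Longrightarrow> map0 (path_unit A) a = a"
  "f \<in> Cell1 A \<Longrightarrow> map1 (path_unit A) f = atomic_path A f"
  "\<alpha> \<in> Cell2 A \<Longrightarrow> map2 (path_unit A) \<alpha>
     = Tup [atomic_path A (Dom (Vert A) \<alpha>), \<alpha>, atomic_path A (Cod (Vert A) \<alpha>)]"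
  by (auto simp: path_unit_def)

text \<open>Functoriality on 1-cells is \<open>path_value_concat\<close>. On 2-cells the counit
  forgets the boundary paths, and both compositions of 2-cells are computed on names.\<close>

lemma (in cell_two_category) two_functor_counit: "two_functor (path_counit A)"
proof (rule two_functor.intro)
  have "is_functor (path_und A) (Und A) (und_func (path_counit A))"
  proof (rule is_functorI[OF category_path_und Und])
    fix p a b assume p: "p \<in> hom (path_und A) a b"
    then show "far (und_func (path_counit A)) p
        \<in> hom (Und A) (fob (und_func (path_counit A)) a) (fob (und_func (path_counit A)) b)"
      using path_value_hom[OF p] U.hom_Ob[OF path_value_hom[OF p]]
      by (simp add: und_func_def path_und_hom_cells1)
  next
    fix p q a b c assume h: "p \<in> hom (path_und A) a b" "q \<in> hom (path_und A) b c"
    then show "far (und_func (path_counit A)) (Cmp (path_und A) q p)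
        = Cmp (Und A) (far (und_func (path_counit A)) q) (far (und_func (path_counit A)) p)"
      using path_concat_hom[OF h]
      by (simp add: und_func_def path_und_Cmp[OF h] path_value_concat[OF h] path_und_hom_cells1)
  next
    fix a assume "a \<in> Ob (path_und A)"
    moreover from this have "Tup [a] \<in> hom (path_und A) a a" by (auto simp: hom_path_und)
    ultimately show "far (und_func (path_counit A)) (Idn (path_und A) a)
        = Idn (Und A) (fob (und_func (path_counit A)) a)"
      by (simp add: und_func_def path_und_Idn path_und_hom_cells1)
  qed (simp add: und_func_def)
  then show "is_functor (Und (src (path_counit A))) (Und (tgt (path_counit A))) (und_func (path_counit A))"
    by simp
  have "is_functor (path_vert A) (Vert A) (vert_func (path_counit A))"
  proof (rule is_functorI[OF category_path_vert Vert])
    fix x p q assume x: "x \<in> hom (path_vert A) p q"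
    then have "x \<in> path_cells2 A" by (simp add: hom_iff)
    with x show "far (vert_func (path_counit A)) x
        \<in> hom (Vert A) (fob (vert_func (path_counit A)) p) (fob (vert_func (path_counit A)) q)"
      by (auto simp: vert_func_def hom_path_vert)
  next
    fix x y p q r assume xy: "x \<in> hom (path_vert A) p q" "y \<in> hom (path_vert A) q r"
    then obtain \<alpha> \<beta> where e: "x = Tup [p, \<alpha>, q]" "y = Tup [q, \<beta>, r]"
      by (auto simp: hom_path_vert)
    show "far (vert_func (path_counit A)) (Cmp (path_vert A) y x)
        = Cmp (Vert A) (far (vert_func (path_counit A)) y) (far (vert_func (path_counit A)) x)"
      using xy path_vert_Cmp_hom[of p \<alpha> q \<beta> r] unfolding e
      by (simp add: vert_func_def path_vert_Cmp path_cells2_iff)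
  next
    fix p assume "p \<in> Ob (path_vert A)"
    then have p: "p \<in> path_cells1 A" by simp
    then have "Tup [p, Idn (Vert A) (path_value A p), p] \<in> path_cells2 A"
      by (auto simp: path_cells2_iff hom_path_vert Ob_Vert path_value_Cell1 intro!: V.Idn_in_hom)
    with p show "far (vert_func (path_counit A)) (Idn (path_vert A) p)
        = Idn (Vert A) (fob (vert_func (path_counit A)) p)"
      by (simp add: vert_func_def path_vert_Idn)
  qed (simp add: vert_func_def path_value_Cell1 Ob_Vert)
  then show "is_functor (Vert (src (path_counit A))) (Vert (tgt (path_counit A))) (vert_func (path_counit A))"
    by simp
  fix y x assume "hcomposable (src (path_counit A)) y x"
  then have yx: "hcomposable (path_two_cat A) y x" by simp
  then obtain p \<alpha> p' q \<beta> q' a b c where e: "x = Tup [p, \<alpha>, p']" "y = Tup [q, \<beta>, q']"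
    and c2: "\<alpha> \<in> hom (Vert A) (path_value A p) (path_value A p')"
      "\<beta> \<in> hom (Vert A) (path_value A q) (path_value A q')"
    and h: "p \<in> hom (path_und A) a b" "p' \<in> hom (path_und A) a b"
      "q \<in> hom (path_und A) b c" "q' \<in> hom (path_und A) b c"
    by (rule path_hcomposableE)
  note H = path_hcomposableI[OF h c2]
  have "Tup [path_concat q p, HCmp A \<beta> \<alpha>, path_concat q' p'] \<in> path_cells2 A"
    using H(4) path_concat_hom[OF h(1,3)] path_concat_hom[OF h(2,4)]
    by (auto simp: path_cells2_iff hom_path_vert path_und_hom_cells1)
  moreover have "x \<in> path_cells2 A" "y \<in> path_cells2 A"
    using yx by (auto simp: hcomposable_def)
  ultimately show "map2 (path_counit A) (HCmp (src (path_counit A)) y x)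
      = HCmp (tgt (path_counit A)) (map2 (path_counit A) y) (map2 (path_counit A) x)"
    unfolding e by (simp add: H(3))
qed (auto simp: two_category_path two_category_axioms, auto simp: path_counit_def)

text \<open>On 1-cells, deleting identities from the image of a path does not change its composite;
  on 2-cells both sides apply \<open>F\<close> to the name.\<close>

lemma path_counit_natural:
  fixes F :: "'a cell two_func"
  assumes "two_functor F"
  shows "comp_two_func (path_counit (tgt F)) (path_two_func F) = comp_two_func F (path_counit (src F))"
proof -
  interpret cell_two_functor F using assms by (rule cell_two_functor.intro)
  show ?thesis
  proof (rule two_func_eqI)
    show "two_functor (comp_two_func (path_counit (tgt F)) (path_two_func F))"
      using two_functor_comp[OF two_functor_path PT.two_functor_counit] by simp
    show "two_functor (comp_two_func F (path_counit (src F)))"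
      using two_functor_comp[OF PS.two_functor_counit assms] by simp
    fix x assume "x \<in> Cell2 (src (comp_two_func (path_counit (tgt F)) (path_two_func F)))"
    then have x: "x \<in> path_cells2 (src F)" by simp
    then obtain p \<alpha> q where e: "x = Tup [p, \<alpha>, q]" by (auto elim!: PS.path_cells2E)
    moreover have "Tup [map_path F p, map2 F \<alpha>, map_path F q] \<in> path_cells2 (tgt F)"
      using x map2_path_hom[of p \<alpha> q] unfolding e by (simp add: PS.path_cells2_iff PT.path_cells2_iff)
    ultimately show "map2 (comp_two_func (path_counit (tgt F)) (path_two_func F)) x
        = map2 (comp_two_func F (path_counit (src F))) x"
      using x by simp
  qed (auto simp: map_path_cells1 map0_Obj)
qed

section \<open>The unit of a flexible 2-category\<close>

locale flexible_two_category = cell_two_category +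
  assumes free: "free_category (Und A)"
begin

lemma flexible: "flexible A"
  by (simp add: flexible_def free two_category_axioms)

lemma atomic_path_hom:
  assumes "f \<in> hom (Und A) a b"
  shows "atomic_path A f \<in> hom (path_und A) a b" and "path_value A (atomic_path A f) = f"
proof -
  have "Dom (Und A) f = a" using assms by (simp add: hom_iff)
  then show "atomic_path A f \<in> hom (path_und A) a b" "path_value A (atomic_path A f) = f"
    using atoms_path[OF free assms] atomic_atoms[OF free assms] composite_atoms[OF free assms]
    by (auto simp: atomic_path_def hom_path_und dest: atomic_nonidentity)
qed

lemma atomic_path_cells1:
  assumes "f \<in> Cell1 A"
  shows "atomic_path A f \<in> path_cells1 A" and "path_value A (atomic_path A f) = f"
  using atomic_path_hom[OF Ar_in_hom[OF assms]] path_und_hom_cells1 by auto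

text \<open>This is where freeness enters the strict functoriality of the unit: decompositions
  concatenate.\<close>

lemma atomic_path_Cmp:
  assumes "f \<in> hom (Und A) a b" "g \<in> hom (Und A) b c"
  shows "atomic_path A (Cmp (Und A) g f) = path_concat (atomic_path A g) (atomic_path A f)"
  using atoms_Cmp[OF free assms] U.Cmp_in_hom[OF assms] assms(1) by (simp add: atomic_path_def hom_iff)

lemma atomic_path_Idn: "a \<in> Obj A \<Longrightarrow> atomic_path A (Idn (Und A) a) = Tup [a]"
  using atoms_Idn[OF free] by (simp add: atomic_path_def U.Dom_Idn)

text \<open>Composing a decomposition gives back the 1-cell, so \<open>\<alpha>\<close> itself is a
  legitimate name between the two atomic paths.\<close>

lemma map2_unit:
  assumes "\<alpha> \<in> hom (Vert A) f g"
  shows "map2 (path_unit A) \<alpha> = Tup [atomic_path A f, \<alpha>, atomic_path A g]"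
    and "Tup [atomic_path A f, \<alpha>, atomic_path A g]
      \<in> hom (path_vert A) (atomic_path A f) (atomic_path A g)"
  using assms hom_Vert_Cell1[OF assms] atomic_path_cells1 unfolding hom_path_vert by (auto simp: hom_iff)

lemma two_functor_unit: "two_functor (path_unit A)"
proof (rule two_functor.intro)
  have "is_functor (Und A) (path_und A) (und_func (path_unit A))"
  proof (rule is_functorI[OF Und category_path_und])
    fix f a b assume f: "f \<in> hom (Und A) a b"
    then show "far (und_func (path_unit A)) f
        \<in> hom (path_und A) (fob (und_func (path_unit A)) a) (fob (und_func (path_unit A)) b)"
      using atomic_path_hom[OF f] U.hom_Ob[OF f] by (auto simp: und_func_def hom_iff)
  next
    fix f g a b c assume fg: "f \<in> hom (Und A) a b" "g \<in> hom (Und A) b c"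
    then show "far (und_func (path_unit A)) (Cmp (Und A) g f)
        = Cmp (path_und A) (far (und_func (path_unit A)) g) (far (und_func (path_unit A)) f)"
      using U.Cmp_in_hom[OF fg] atomic_path_Cmp[OF fg]
        path_und_Cmp[OF atomic_path_hom(1)[OF fg(1)] atomic_path_hom(1)[OF fg(2)]]
      by (simp add: und_func_def hom_iff)
  qed (simp_all add: und_func_def atomic_path_Idn path_und_Idn U.Ar_Idn)
  then show "is_functor (Und (src (path_unit A))) (Und (tgt (path_unit A))) (und_func (path_unit A))"
    by simp
  have "is_functor (Vert A) (path_vert A) (vert_func (path_unit A))"
  proof (rule is_functorI[OF Vert category_path_vert])
    fix \<alpha> f g assume \<alpha>: "\<alpha> \<in> hom (Vert A) f g"
    then show "far (vert_func (path_unit A)) \<alpha>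
        \<in> hom (path_vert A) (fob (vert_func (path_unit A)) f) (fob (vert_func (path_unit A)) g)"
      using map2_unit[OF \<alpha>] hom_Vert_Cell1[OF \<alpha>] by (simp add: vert_func_def)
  next
    fix \<alpha> \<beta> f g h assume c: "\<alpha> \<in> hom (Vert A) f g" "\<beta> \<in> hom (Vert A) g h"
    show "far (vert_func (path_unit A)) (Cmp (Vert A) \<beta> \<alpha>)
        = Cmp (path_vert A) (far (vert_func (path_unit A)) \<beta>) (far (vert_func (path_unit A)) \<alpha>)"
      by (simp add: vert_func_def map2_unit(1)[OF V.Cmp_in_hom[OF c]] map2_unit(1)[OF c(1)]
          map2_unit(1)[OF c(2)] path_vert_Cmp[OF map2_unit(2)[OF c(1)] map2_unit(2)[OF c(2)]])
  next
    fix f assume "f \<in> Ob (Vert A)"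
    then show "far (vert_func (path_unit A)) (Idn (Vert A) f)
        = Idn (path_vert A) (fob (vert_func (path_unit A)) f)"
      using map2_unit(1)[OF V.Idn_in_hom[of f]]
      by (simp add: vert_func_def Ob_Vert path_vert_Idn atomic_path_cells1)
  qed (simp add: vert_func_def Ob_Vert atomic_path_cells1)
  then show "is_functor (Vert (src (path_unit A))) (Vert (tgt (path_unit A))) (vert_func (path_unit A))"
    by simp
  fix \<beta> \<alpha> assume "hcomposable (src (path_unit A)) \<beta> \<alpha>"
  then have hc: "hcomposable A \<beta> \<alpha>" by simp
  then obtain f f' g g' where \<alpha>: "\<alpha> \<in> hom (Vert A) f f'" and \<beta>: "\<beta> \<in> hom (Vert A) g g'"
    and eq: "Dom (Und A) g = Cod (Und A) f"
    by (rule hcomposableE)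
  let ?a = "Dom (Und A) f" and ?b = "Cod (Und A) f" and ?c = "Cod (Und A) g"
  have h: "f \<in> hom (Und A) ?a ?b" "f' \<in> hom (Und A) ?a ?b" "g \<in> hom (Und A) ?b ?c" "g' \<in> hom (Und A) ?b ?c"
    using hom_Vert_Cell1[OF \<alpha>] hom_Vert_Cell1[OF \<beta>] parallel[OF \<alpha>] parallel[OF \<beta>] eq
    by (auto simp: hom_iff)
  \<comment> \<open>Names are required to run between the values of the boundary paths; here these
    values are the original 1-cells.\<close>
  have v: "\<alpha> \<in> hom (Vert A) (path_value A (atomic_path A f)) (path_value A (atomic_path A f'))"
    "\<beta> \<in> hom (Vert A) (path_value A (atomic_path A g)) (path_value A (atomic_path A g'))"
    using \<alpha> \<beta> by (simp_all add: atomic_path_hom(2)[OF h(1)] atomic_path_hom(2)[OF h(2)]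
        atomic_path_hom(2)[OF h(3)] atomic_path_hom(2)[OF h(4)])
  show "map2 (path_unit A) (HCmp (src (path_unit A)) \<beta> \<alpha>)
      = HCmp (tgt (path_unit A)) (map2 (path_unit A) \<beta>) (map2 (path_unit A) \<alpha>)"
    using path_hcomposableI(3)[OF atomic_path_hom(1)[OF h(1)] atomic_path_hom(1)[OF h(2)]
        atomic_path_hom(1)[OF h(3)] atomic_path_hom(1)[OF h(4)] v]
      map2_unit(1)[OF HCmp_in_hom[OF \<alpha> \<beta> hc]]
    by (simp add: map2_unit(1)[OF \<alpha>] map2_unit(1)[OF \<beta>] atomic_path_Cmp[OF h(1,3)] atomic_path_Cmp[OF h(2,4)])
qed (auto simp: two_category_path two_category_axioms, auto simp: path_unit_def)

text \<open>An atomic 1-cell is its own decomposition, so it goes to a one-step path.\<close>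

lemma flexible_functor_unit: "flexible_functor (path_unit A)"
proof -
  have "atomic (path_und A) (atomic_path A f)" if "atomic (Und A) f" for f
    using atoms_atomic[OF free that] atomic_Ar[OF that] atomic_nonidentity[OF that]
    by (auto simp: atomic_path_und_iff atomic_path_def path_step_def)
  then show ?thesis
    using two_functor_unit two_functor.und_func[OF two_functor_unit] flexible flexible_path
    by (simp add: flexible_functor_def free_functor_def free free_category_path_und und_func_def)
qed

text \<open>The first triangle identity: composing the atoms of a 1-cell returns it.\<close>

lemma counit_unit: "comp_two_func (path_counit A) (path_unit A) = id_two_func A"
proof (rule two_func_eqI)
  show "two_functor (comp_two_func (path_counit A) (path_unit A))"
    using two_functor_comp[OF two_functor_unit two_functor_counit] by simp
  show "two_functor (id_two_func A)" by (rule two_functor_id[OF two_category_axioms])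
  fix \<alpha> assume "\<alpha> \<in> Cell2 (src (comp_two_func (path_counit A) (path_unit A)))"
  then have \<alpha>: "\<alpha> \<in> Cell2 A" by simp
  then show "map2 (comp_two_func (path_counit A) (path_unit A)) \<alpha> = map2 (id_two_func A) \<alpha>"
    using map2_unit[OF Ar_in_hom[OF \<alpha>]] by (simp add: hom_iff)
qed (auto simp: atomic_path_cells1)

end

text \<open>By \<open>atoms_free_functor\<close>, decomposing \<open>map1 F f\<close> amounts to
  mapping the atoms of \<open>f\<close> and deleting identities, which is what
  \<open>map_path\<close> does.\<close>

lemma path_unit_natural:
  fixes F :: "'a cell two_func"
  assumes F: "flexible_functor F"
  shows "comp_two_func (path_two_func F) (path_unit (src F)) = comp_two_func (path_unit (tgt F)) F"
proof -
  interpret cell_two_functor F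
    using assms by (intro cell_two_functor.intro flexible_functor_two_functor)
  interpret FS: flexible_two_category "src F"
    using assms by unfold_locales (auto simp: flexible_functor_def flexible_def)
  interpret FT: flexible_two_category "tgt F"
    using assms by unfold_locales (auto simp: flexible_functor_def flexible_def)
  have *: "map_path F (atomic_path (src F) f) = atomic_path (tgt F) (map1 F f)" if "f \<in> Cell1 (src F)" for f
  proof -
    have "free_functor (Und (src F)) (Und (tgt F)) (und_func F)"
      using F by (simp add: flexible_functor_def)
    then show ?thesis
      using atoms_free_functor[OF _ Ar_in_hom[OF that], of "Und (tgt F)" "und_func F"] that
      by (auto simp: atomic_path_def map_path_def Dom_map1 und_func_def)
  qed
  show ?thesis
  proof (rule two_func_eqI)
    show "two_functor (comp_two_func (path_two_func F) (path_unit (src F)))"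
      using two_functor_comp[OF FS.two_functor_unit two_functor_path] by simp
    show "two_functor (comp_two_func (path_unit (tgt F)) F)"
      using two_functor_comp[OF two_functor_axioms FT.two_functor_unit] by simp
    fix \<alpha> assume "\<alpha> \<in> Cell2 (src (comp_two_func (path_two_func F) (path_unit (src F))))"
    then have \<alpha>: "\<alpha> \<in> Cell2 (src F)" by simp
    note h = Ar_in_hom[OF \<alpha>]
    have "Tup [atomic_path (src F) (Dom (Vert (src F)) \<alpha>), \<alpha>, atomic_path (src F) (Cod (Vert (src F)) \<alpha>)]
        \<in> path_cells2 (src F)"
      using FS.map2_unit(2)[OF h] by (simp add: PS.path_cells2_iff)
    then show "map2 (comp_two_func (path_two_func F) (path_unit (src F))) \<alpha>
        = map2 (comp_two_func (path_unit (tgt F)) F) \<alpha>"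
      using \<alpha> S.hom_Vert_Cell1[OF h] FT.map2_unit(1)[OF map2_hom[OF h]] by (simp add: *)
  qed (auto simp: * FS.atomic_path_cells1 map1_Cell1 map0_Obj)
qed

text \<open>The second triangle identity. The atoms of a path are its one-step paths; the counit
  returns their steps, none of which is an identity, so \<open>map_path\<close> restores the
  path.\<close>

lemma (in cell_two_category) path_counit_unit:
  "comp_two_func (path_two_func (path_counit A)) (path_unit (path_two_cat A)) = id_two_func (path_two_cat A)"
proof -
  interpret E: cell_two_functor "path_counit A"
    using two_functor_counit by (rule cell_two_functor.intro)
  interpret P: flexible_two_category "path_two_cat A"
    using two_category_path free_category_path_und
    by (intro flexible_two_category.intro cell_two_category.intro flexible_two_category_axioms.intro) auto
  have *: "map_path (path_counit A) (atomic_path (path_two_cat A) p) = p" if p: "p \<in> path_cells1 A" for p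
  proof -
    obtain a b fs where fs: "p = Tup (a # fs)" "is_path (Und A) a fs b"
        "\<forall>f \<in> set fs. \<not> is_identity (Und A) f"
      using path_cells1_hom[OF p] by (auto simp: hom_path_und)
    have "map1 (path_counit A) (path_step A f) = f" if "f \<in> set fs" for f
    proof -
      have "f \<in> Cell1 A" using U.is_path_Ar[OF fs(2) that] .
      then have "path_step A f \<in> path_cells1 A"
        using path_step_hom[OF Ar_in_hom] fs(3) that path_und_hom_cells1 by blast
      with \<open>f \<in> Cell1 A\<close> show ?thesis by (simp add: path_value_step)
    qed
    then have "map (map1 (path_counit A)) (map (path_step A) fs) = fs" by (simp add: map_idI)
    moreover have "filter (\<lambda>f. \<not> is_identity (Und A) f) fs = fs" using fs(3) by simp
    moreover have "Dom (path_und A) p = a"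
      using path_und_Dom[OF p] path_src_eq[OF p] fs(1) by simp
    moreover have "a \<in> Obj A" using U.is_path_Ob[OF fs(2)] by simp
    moreover have "atoms (path_und A) p = map (path_step A) fs" using atoms_path_und[OF p] fs(1) by simp
    ultimately show ?thesis
      using fs(1) by (simp add: atomic_path_def map_path_def del: filter_map map_map)
  qed
  show ?thesis
  proof (rule two_func_eqI)
    show "two_functor (comp_two_func (path_two_func (path_counit A)) (path_unit (path_two_cat A)))"
      using two_functor_comp[OF P.two_functor_unit E.two_functor_path] by simp
    show "two_functor (id_two_func (path_two_cat A))" by (rule two_functor_id[OF two_category_path])
    fix x assume "x \<in> Cell2 (src (comp_two_func (path_two_func (path_counit A)) (path_unit (path_two_cat A))))"
    then have x: "x \<in> path_cells2 A" by simp
    then obtain p \<alpha> q where e: "x = Tup [p, \<alpha>, q]" and pq: "p \<in> path_cells1 A" "q \<in> path_cells1 A"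
      by (auto elim!: path_cells2E)
    have h: "x \<in> hom (Vert (path_two_cat A)) p q" using x path_cells2_iff[of p \<alpha> q] by (simp add: e)
    \<comment> \<open>A 2-cell of the iterated path 2-category: its name \<open>x\<close> is itself
      a triple over \<open>A\<close>.\<close>
    have "Tup [atomic_path (path_two_cat A) p, x, atomic_path (path_two_cat A) q] \<in> path_cells2 (path_two_cat A)"
      using P.map2_unit(2)[OF h] by (simp add: P.path_cells2_iff)
    then show "map2 (comp_two_func (path_two_func (path_counit A)) (path_unit (path_two_cat A))) x
        = map2 (id_two_func (path_two_cat A)) x"
      using x P.map2_unit(1)[OF h] pq by (simp add: *) (simp add: e)
  next
    fix p assume "p \<in> Cell1 (src (comp_two_func (path_two_func (path_counit A)) (path_unit (path_two_cat A))))"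
    then have p: "p \<in> path_cells1 A" by simp
    then show "map1 (comp_two_func (path_two_func (path_counit A)) (path_unit (path_two_cat A))) p
        = map1 (id_two_func (path_two_cat A)) p"
      using P.atomic_path_cells1(1)[of p] by (simp add: *)
  qed auto
qed

section \<open>The adjunction between \<open>Flex\<close> and \<open>TwoCat\<close>\<close>

lemma path_adjunction:
  fixes small :: "'a cell set \<Rightarrow> bool"
  assumes "size_universe small"
  shows "adjunction (Flex small) (TwoCat small) inclusion path_functor path_unit path_counit"
proof -
  note I = inclusion_functor[of small] and P = path_functor_is_functor[OF assms]
  have c: "cell_two_category A \<and> two_functor (path_counit A) \<and> small_two_cat small A
      \<and> small_two_cat small (path_two_cat A)" if "A \<in> Ob (TwoCat small)" for A
  proof -
    interpret cell_two_category A using that by (auto simp: TwoCat_def intro: cell_two_category.intro)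
    show ?thesis using that two_functor_counit small_path[OF assms] cell_two_category_axioms
      by (auto simp: TwoCat_def)
  qed
  have u: "flexible_two_category A \<and> flexible_functor (path_unit A) \<and> small_two_cat small A
      \<and> small_two_cat small (path_two_cat A)" if "A \<in> Ob (Flex small)" for A
  proof -
    interpret flexible_two_category A
      using that by (auto simp: Flex_def flexible_def intro!: flexible_two_category.intro
          cell_two_category.intro flexible_two_category_axioms.intro)
    show ?thesis using that flexible_functor_unit small_path[OF assms] flexible_two_category_axioms
      by (auto simp: Flex_def)
  qed
  have "nat_trans (Flex small) (Flex small) id_func (comp_func path_functor inclusion) path_unit"
    unfolding nat_trans_def
  proof (intro conjI ballI allI is_functor_id category_Flex is_functor_comp[OF I P])
    fix A assume A: "A \<in> Ob (Flex small)"
    show "path_unit A \<in> hom (Flex small) (fob id_func A) (fob (comp_func path_functor inclusion) A)"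
      using u[OF A] by (simp add: hom_iff id_func_def comp_func_def path_functor_def inclusion_def Flex_def)
  next
    fix A B F assume "F \<in> hom (Flex small) A B"
    then show "Cmp (Flex small) (path_unit B) (far id_func F)
        = Cmp (Flex small) (far (comp_func path_functor inclusion) F) (path_unit A)"
      using path_unit_natural[of F]
      by (auto simp: hom_iff id_func_def comp_func_def path_functor_def inclusion_def Flex_def)
  qed
  moreover have "nat_trans (TwoCat small) (TwoCat small) (comp_func inclusion path_functor) id_func path_counit"
    unfolding nat_trans_def
  proof (intro conjI ballI allI is_functor_id category_TwoCat is_functor_comp[OF P I])
    fix A assume A: "A \<in> Ob (TwoCat small)"
    show "path_counit A \<in> hom (TwoCat small) (fob (comp_func inclusion path_functor) A) (fob id_func A)"
      using c[OF A] by (simp add: hom_iff id_func_def comp_func_def path_functor_def inclusion_def TwoCat_def)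
  next
    fix A B F assume "F \<in> hom (TwoCat small) A B"
    then show "Cmp (TwoCat small) (path_counit B) (far (comp_func inclusion path_functor) F)
        = Cmp (TwoCat small) (far id_func F) (path_counit A)"
      using path_counit_natural[of F]
      by (auto simp: hom_iff id_func_def comp_func_def path_functor_def inclusion_def TwoCat_def)
  qed
  moreover have "comp_two_func (path_counit A) (path_unit A) = id_two_func A" if "A \<in> Ob (Flex small)" for A
    using u[OF that] flexible_two_category.counit_unit by blast
  moreover have "comp_two_func (path_two_func (path_counit A)) (path_unit (path_two_cat A))
      = id_two_func (path_two_cat A)" if "A \<in> Ob (TwoCat small)" for A
    using c[OF that] cell_two_category.path_counit_unit by blast
  moreover have "Cmp (Flex small) = comp_two_func" "Idn (Flex small) = id_two_func"
    "Cmp (TwoCat small) = comp_two_func" "Idn (TwoCat small) = id_two_func"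
    by (simp_all add: Flex_def TwoCat_def)
  ultimately show ?thesis
    using I P by (simp add: adjunction_def inclusion_def path_functor_def)
qed


section \<open>Weak equivalences\<close>

context cell_two_category
begin

interpretation P: two_category "path_two_cat A"
  by (rule two_category_path)

text \<open>Vertical composites and identities are computed on names, so an inverse of the name,
  with the boundary reversed, is an inverse of the cell.\<close>

lemma path_isos_iff:
  assumes "p \<in> path_cells1 A" "q \<in> path_cells1 A"
  shows "isos (path_vert A) p q = (\<lambda>\<alpha>. Tup [p, \<alpha>, q]) ` isos (Vert A) (path_value A p) (path_value A q)"
proof -
  have "Tup [p, \<alpha>, q] \<in> isos (path_vert A) p q \<longleftrightarrow> \<alpha> \<in> isos (Vert A) (path_value A p) (path_value A q)" for \<alpha>
  proof -
    have "Cmp (path_vert A) (Tup [q, \<beta>, p]) (Tup [p, \<alpha>, q]) = Tup [p, Cmp (Vert A) \<beta> \<alpha>, p]"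
      "Cmp (path_vert A) (Tup [p, \<alpha>, q]) (Tup [q, \<beta>, p]) = Tup [q, Cmp (Vert A) \<alpha> \<beta>, q]"
      if "\<alpha> \<in> hom (Vert A) (path_value A p) (path_value A q)"
        "\<beta> \<in> hom (Vert A) (path_value A q) (path_value A p)" for \<beta>
      using that assms by (simp_all add: path_vert_Cmp hom_path_vert)
    moreover have "hom (path_vert A) q p = (\<lambda>\<beta>. Tup [q, \<beta>, p]) ` hom (Vert A) (path_value A q) (path_value A p)"
      using assms by (auto simp: hom_path_vert)
    ultimately show ?thesis
      using assms by (auto simp: isos_def hom_path_vert[of _ p q] path_vert_Idn)
  qed
  moreover have "\<exists>\<alpha>. x = Tup [p, \<alpha>, q]" if "x \<in> isos (path_vert A) p q" for x
    using that by (auto simp: isos_def hom_path_vert)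
  ultimately show ?thesis by blast
qed

text \<open>A non-identity 1-cell is the value of a one-step path. Steps are never identities, so an
  identity is represented by the empty path instead.\<close>

lemma path_value_surj:
  assumes "f \<in> hom (Und A) a b"
  obtains p where "p \<in> hom (path_und A) a b" "path_value A p = f"
proof (cases "is_identity (Und A) f")
  case True
  then have "f = Idn (Und A) a" "b = a" "a \<in> Obj A"
    using U.identity_eq_Idn[OF True] U.hom_Ob[OF assms] assms by (auto simp: hom_iff)
  then show ?thesis using that[of "Tup [a]"] by (auto simp: hom_path_und)
next
  case False
  then show ?thesis using that[OF path_step_hom[OF assms False]] path_value_step assms by (simp add: hom_iff)
qed

text \<open>A quasi-inverse in \<open>A\<close> lifts to a path by \<open>path_value_surj\<close>,
  and \<open>path_isos_iff\<close> compares the invertible 2-cells that witness it.\<close>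

lemma path_equivalences_iff:
  "p \<in> equivalences (path_two_cat A) a b \<longleftrightarrow>
     p \<in> hom (path_und A) a b \<and> path_value A p \<in> equivalences A a b"
proof -
  have *: "isos (path_vert A) (Cmp (path_und A) q p) (Idn (path_und A) a) \<noteq> {} \<longleftrightarrow>
      isos (Vert A) (Cmp (Und A) (path_value A q) (path_value A p)) (Idn (Und A) a) \<noteq> {}"
    if p: "p \<in> hom (path_und A) a b" and q: "q \<in> hom (path_und A) b a" for p q a b
  proof -
    have "a \<in> Obj A" using U.hom_Ob[OF path_value_hom[OF p]] by simp
    then have "Tup [a] \<in> hom (path_und A) a a" by (auto simp: hom_path_und)
    then show ?thesis
      using path_isos_iff[OF path_und_hom_cells1[OF path_concat_hom[OF p q]], of "Tup [a]"] \<open>a \<in> Obj A\<close>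
      by (simp add: path_und_Cmp[OF p q] path_und_Idn path_value_concat[OF p q] path_und_hom_cells1)
  qed
  show ?thesis
  proof
    assume "p \<in> equivalences (path_two_cat A) a b"
    then obtain q where p: "p \<in> hom (path_und A) a b" and q: "q \<in> hom (path_und A) b a"
      and "isos (path_vert A) (Cmp (path_und A) q p) (Idn (path_und A) a) \<noteq> {}"
        "isos (path_vert A) (Cmp (path_und A) p q) (Idn (path_und A) b) \<noteq> {}"
      by (auto simp: equivalences_def)
    then show "p \<in> hom (path_und A) a b \<and> path_value A p \<in> equivalences A a b"
      using *[OF p q] *[OF q p] path_value_hom[OF p] path_value_hom[OF q]
      unfolding equivalences_def by blast
  next
    assume a: "p \<in> hom (path_und A) a b \<and> path_value A p \<in> equivalences A a b"
    then obtain g where p: "p \<in> hom (path_und A) a b" and g: "g \<in> hom (Und A) b a"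
      and gi: "isos (Vert A) (Cmp (Und A) g (path_value A p)) (Idn (Und A) a) \<noteq> {}"
        "isos (Vert A) (Cmp (Und A) (path_value A p) g) (Idn (Und A) b) \<noteq> {}"
      by (auto simp: equivalences_def)
    obtain q where q: "q \<in> hom (path_und A) b a" "path_value A q = g"
      using path_value_surj[OF g] .
    have "isos (path_vert A) (Cmp (path_und A) q p) (Idn (path_und A) a) \<noteq> {}"
      "isos (path_vert A) (Cmp (path_und A) p q) (Idn (path_und A) b) \<noteq> {}"
      using *[OF p q(1)] *[OF q(1) p] gi q(2) by simp_all
    then show "p \<in> equivalences (path_two_cat A) a b"
      using p q(1) unfolding equivalences_def path_two_cat_simps by blast
  qed
qed

text \<open>The two clauses of biequivalence are matched separately: the one on objects by
  \<open>path_equivalences_iff\<close>, the one on hom-categories by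
  \<open>equivalence_of_categories_iff\<close> and \<open>path_isos_iff\<close>. It will be applied
  with \<open>G\<close> the adjunct of a 2-functor.\<close>

lemma biequivalence_counit_iff:
  assumes G: "two_functor G" and tgt: "tgt G = path_two_cat A"
  shows "biequivalence (comp_two_func (path_counit A) G) \<longleftrightarrow> biequivalence G"
proof -
  let ?F = "comp_two_func (path_counit A) G"
  interpret G: two_functor G by (rule G)
  have F: "two_functor ?F"
    using two_functor_comp[OF G two_functor_counit] tgt by simp
  interpret F: two_functor ?F by (rule F)
  have map0: "map0 ?F a = map0 G a" if "a \<in> Obj (src G)" for a
    using G.map0_Obj[OF that] that by (simp add: tgt)
  have map1: "map1 ?F f = path_value A (map1 G f)" if "f \<in> Cell1 (src G)" for f
    using G.map1_Cell1[OF that] that by (simp add: tgt)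
  \<comment> \<open>A 2-cell of the path 2-category is its name together with its boundary, so
    \<open>map2 G\<close> is recovered from the composite with the counit.\<close>
  have map2: "map2 G \<alpha> = Tup [map1 G f, map2 ?F \<alpha>, map1 G g]" if "\<alpha> \<in> hom (Vert (src G)) f g" for \<alpha> f g
  proof -
    have "map2 G \<alpha> \<in> hom (path_vert A) (map1 G f) (map1 G g)" "\<alpha> \<in> Cell2 (src G)"
      using G.map2_hom[OF that] that by (auto simp: tgt hom_iff)
    moreover from this have "map2 G \<alpha> \<in> path_cells2 A" by (simp add: hom_iff)
    ultimately show ?thesis by (auto simp: hom_path_vert)
  qed
  have "equivalences A a b \<noteq> {} \<longleftrightarrow> equivalences (path_two_cat A) a b \<noteq> {}" for a b
  proof
    assume "equivalences A a b \<noteq> {}"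
    then obtain f where f: "f \<in> equivalences A a b" by blast
    then have "f \<in> hom (Und A) a b" by (simp add: equivalences_def)
    then obtain p where "p \<in> hom (path_und A) a b" "path_value A p = f" by (rule path_value_surj)
    with f show "equivalences (path_two_cat A) a b \<noteq> {}" using path_equivalences_iff by blast
  qed (use path_equivalences_iff in blast)
  then have ob: "(\<forall>b \<in> Obj A. \<exists>a \<in> Obj (src G). equivalences A (map0 ?F a) b \<noteq> {}) \<longleftrightarrow>
      (\<forall>b \<in> Obj A. \<exists>a \<in> Obj (src G). equivalences (path_two_cat A) (map0 G a) b \<noteq> {})"
    by (simp add: map0 del: comp_two_func_simps)
  have "equivalence_of_categories (hom_cat (src G) a a') (hom_cat A (map0 G a) (map0 G a')) (vert_func ?F)
      \<longleftrightarrow> equivalence_of_categories (hom_cat (src G) a a')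
        (hom_cat (path_two_cat A) (map0 G a) (map0 G a')) (vert_func G)"
    if a: "a \<in> Obj (src G)" and a': "a' \<in> Obj (src G)" for a a'
  proof -
    let ?S = "hom_cat (src G) a a'" and ?T = "hom_cat A (map0 G a) (map0 G a')"
      and ?P = "hom_cat (path_two_cat A) (map0 G a) (map0 G a')"
    have Ob: "Ob ?S = hom (Und (src G)) a a'" "Ob ?T = hom (Und A) (map0 G a) (map0 G a')"
      "Ob ?P = hom (path_und A) (map0 G a) (map0 G a')"
      by (simp_all add: hom_cat_def)
    have functors: "is_functor ?S ?T (vert_func ?F)" "is_functor ?S ?P (vert_func G)"
      using F.hom_cat_functor[of a a'] G.hom_cat_functor[of a a'] by (simp_all only: map0[OF a] map0[OF a'] tgt path_counit_simps comp_two_func_simps(1,2))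
    have Gh: "map1 G f \<in> hom (path_und A) (map0 G a) (map0 G a')" if "f \<in> hom (Und (src G)) a a'" for f
      using G.map1_hom[OF that] by (simp add: tgt)
    have Fh: "map1 ?F f = path_value A (map1 G f)" if "f \<in> hom (Und (src G)) a a'" for f
      using map1 that by (simp add: hom_iff)
    have "bij_betw (map2 ?F) (hom (Vert (src G)) f g) (hom (Vert A) (map1 ?F f) (map1 ?F g)) \<longleftrightarrow>
        bij_betw (map2 G) (hom (Vert (src G)) f g) (hom (path_vert A) (map1 G f) (map1 G g))"
      if f: "f \<in> hom (Und (src G)) a a'" and g: "g \<in> hom (Und (src G)) a a'" for f g
    proof -
      \<comment> \<open>Adding the fixed boundary is a bijection of hom-sets that carries
        \<open>map2 ?F\<close> to \<open>map2 G\<close>, so one of these is bijective if and only if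
        the other is.\<close>
      let ?t = "\<lambda>\<alpha>. Tup [map1 G f, \<alpha>, map1 G g]"
      have "hom (path_vert A) (map1 G f) (map1 G g) = ?t ` hom (Vert A) (map1 ?F f) (map1 ?F g)"
        using Gh[OF f] Gh[OF g] path_und_hom_cells1 by (auto simp: hom_path_vert Fh[OF f] Fh[OF g])
      then have t: "bij_betw ?t (hom (Vert A) (map1 ?F f) (map1 ?F g))
          (hom (path_vert A) (map1 G f) (map1 G g))"
        by (auto simp: bij_betw_def inj_on_def)
      have "map2 ?F ` hom (Vert (src G)) f g \<subseteq> hom (Vert A) (map1 ?F f) (map1 ?F g)"
        using F.map2_hom by auto
      then have "bij_betw (map2 ?F) (hom (Vert (src G)) f g) (hom (Vert A) (map1 ?F f) (map1 ?F g)) \<longleftrightarrow>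
          bij_betw (?t \<circ> map2 ?F) (hom (Vert (src G)) f g) (hom (path_vert A) (map1 G f) (map1 G g))"
        using bij_betw_comp_iff2[OF t] by blast
      also have "\<dots> \<longleftrightarrow> bij_betw (map2 G) (hom (Vert (src G)) f g) (hom (path_vert A) (map1 G f) (map1 G g))"
        by (rule bij_betw_cong) (simp add: map2)
      finally show ?thesis .
    qed
    then have ff: "fully_faithful ?S ?T (vert_func ?F) \<longleftrightarrow> fully_faithful ?S ?P (vert_func G)"
      using Gh Fh path_value_hom
      by (simp add: fully_faithful_def Ob vert_func_def G.S.hom_hom_cat hom_hom_cat P.hom_hom_cat)
    have iso: "isos ?P (map1 G f) p \<noteq> {} \<longleftrightarrow> isos ?T (map1 ?F f) (path_value A p) \<noteq> {}"
      if "f \<in> hom (Und (src G)) a a'" "p \<in> hom (path_und A) (map0 G a) (map0 G a')" for f p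
      using that Gh[OF that(1)] path_value_hom
      by (simp add: Fh isos_hom_cat P.isos_hom_cat path_isos_iff path_und_hom_cells1)
    have es: "essentially_surjective ?S ?T (vert_func ?F) \<longleftrightarrow> essentially_surjective ?S ?P (vert_func G)"
      unfolding essentially_surjective_def Ob vert_func_def func.simps
    proof (intro iffI ballI)
      fix p assume "\<forall>d \<in> hom (Und A) (map0 G a) (map0 G a').
          \<exists>c \<in> hom (Und (src G)) a a'. isos ?T (map1 ?F c) d \<noteq> {}"
        and p: "p \<in> hom (path_und A) (map0 G a) (map0 G a')"
      then show "\<exists>c \<in> hom (Und (src G)) a a'. isos ?P (map1 G c) p \<noteq> {}"
        using iso path_value_hom[OF p] by blast
    next
      fix d assume es: "\<forall>p \<in> hom (path_und A) (map0 G a) (map0 G a').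
          \<exists>c \<in> hom (Und (src G)) a a'. isos ?P (map1 G c) p \<noteq> {}"
        and d: "d \<in> hom (Und A) (map0 G a) (map0 G a')"
      \<comment> \<open>The 1-cell \<open>d\<close> is lifted to a path; an isomorphism found for
        the path is then carried down to \<open>d\<close>.\<close>
      obtain p where "p \<in> hom (path_und A) (map0 G a) (map0 G a')" "path_value A p = d"
        using path_value_surj[OF d] .
      then show "\<exists>c \<in> hom (Und (src G)) a a'. isos ?T (map1 ?F c) d \<noteq> {}"
        using iso es by metis
    qed
    show ?thesis using functors ff es by (simp add: equivalence_of_categories_iff)
  qed
  then show ?thesis
    using F G ob by (simp add: biequivalence_def tgt map0 del: comp_two_func_simps(3-5))
qed

end

section \<open>Weak equivalences under the bijection of the adjunction\<close>

theorem theorem4p10: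
  fixes small :: "'a cell set \<Rightarrow> bool"
  assumes "size_universe small"
  shows "quillen_equivalence
           (Flex small) (left_induced (Flex small) inclusion (Lack_structure small))
           (TwoCat small) (Lack_structure small)
           inclusion path_functor path_unit path_counit"
proof -
  let ?N = "Lack_structure small"
  let ?M = "left_induced (Flex small) inclusion ?N"
  have adj: "adjunction (Flex small) (TwoCat small) inclusion path_functor path_unit path_counit"
    using path_adjunction[OF assms] .
  have "quillen_adjunction (Flex small) ?M (TwoCat small) ?N inclusion path_functor path_unit path_counit"
    using adj by (auto simp: quillen_adjunction_def left_induced_def Let_def)
  moreover have "f \<in> weq ?N \<longleftrightarrow> Cmp (Flex small) (far path_functor f) (path_unit X) \<in> weq ?M"
    if X: "X \<in> Ob (Flex small)" and f: "f \<in> hom (TwoCat small) (fob inclusion X) Y" for X Y f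
  proof -
    let ?g = "comp_two_func (path_two_func f) (path_unit X)"
    have f': "two_functor f" "src f = X" "tgt f = Y" "f \<in> Ar (TwoCat small)"
      using f by (auto simp: hom_iff TwoCat_def inclusion_def)
    interpret cell_two_functor f using f'(1) by (rule cell_two_functor.intro)
    interpret X: flexible_two_category X
      using X by (auto simp: Flex_def flexible_def intro!: flexible_two_category.intro
          cell_two_category.intro flexible_two_category_axioms.intro)
    have "path_two_func f \<in> hom (Flex small) (path_two_cat X) (path_two_cat Y)"
      using is_functorD(4)[OF path_functor_is_functor[OF assms] f]
      by (simp add: path_functor_def inclusion_def)
    moreover have "path_unit X \<in> hom (Flex small) X (path_two_cat X)"
      using adj X by (simp add: adjunction_def nat_trans_def id_func_def comp_func_def
          path_functor_def inclusion_def)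
    ultimately have "Cmp (Flex small) (path_two_func f) (path_unit X) \<in> hom (Flex small) X (path_two_cat Y)"
      by (intro category.Cmp_in_hom[OF category_Flex])
    then have g: "?g \<in> hom (Flex small) X (path_two_cat Y)" by (simp add: Flex_def)
    \<comment> \<open>Weak equivalences of \<open>?M\<close> are tested in \<open>TwoCat\<close>, so
      the adjunct has to be an arrow there as well as in \<open>Flex\<close>.\<close>
    then have g2: "two_functor ?g" "?g \<in> Ar (Flex small)" "?g \<in> Ar (TwoCat small)"
      by (auto simp: hom_iff Flex_def TwoCat_def flexible_functor_def flexible_def f'(3))
    \<comment> \<open>Naturality moves the counit past \<open>f\<close>, and the first triangle
      identity then cancels the unit.\<close>
    have "comp_two_func (path_counit Y) ?g
        = comp_two_func (comp_two_func (path_counit Y) (path_two_func f)) (path_unit X)"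
      using X.two_functor_unit two_functor_path PT.two_functor_counit f'
      by (intro comp_two_func_assoc) simp_all
    also have "\<dots> = comp_two_func (comp_two_func f (path_counit X)) (path_unit X)"
      using path_counit_natural[OF f'(1)] f' by simp
    also have "\<dots> = comp_two_func f (comp_two_func (path_counit X) (path_unit X))"
      using X.two_functor_unit X.two_functor_counit f'
      by (intro comp_two_func_assoc[symmetric]) simp_all
    also have "\<dots> = f"
      using X.counit_unit comp_id_two_func(2)[OF f'(1)] f' by simp
    finally have "biequivalence f \<longleftrightarrow> biequivalence ?g"
      using PT.biequivalence_counit_iff[OF g2(1)] f' by simp
    moreover have "Cmp (Flex small) (far path_functor f) (path_unit X) = ?g"
      by (simp add: Flex_def path_functor_def)
    ultimately show ?thesis
      using g2 f'(4) by (simp add: left_induced_def Lack_structure_def Let_def inclusion_def)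
  qed
  ultimately show ?thesis
    by (auto simp: quillen_equivalence_def cofibrant_def)
qed

end
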